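(* Let $p\in\mathbb C[z,w]$ be a non-zero homogeneous polynomial, let $\mathcal M=[p]$, and let $(\alpha_n)_{n\ge 0}$ be the Verblunsky coefficients of the measure $\mu_p$. Then (all lists are counted with multiplicity, before decreasing rearrangement, and with zero terms discarded): (i) the non-zero singular values of $P_zP_w$ are $1,|\alpha_0|,|\alpha_1|,\ldots$; (ii) the non-zero singular values of $X_{\mathcal M}$ are $|\alpha_0|,|\alpha_1|,\ldots$; (iii) the non-zero eigenvalues of $C_{\mathcal M}$ are $1$ and $\pm|\alpha_n|$, $n\ge 0$; (iv) for every real $r>0$, $C_{\mathcal M}\in\mathcal S_r$ if and only if $(\alpha_n)\in\ell^r$, and $$\|C_{\mathcal M}\|_{\mathcal S_r}^r=1+2\sum_{n\ge0}|\alpha_n|^r .$$ In particular, every submodule $[p]$ with $p\ne0$ a homogeneous polynomial is Hilbert--Schmidt (that is, $C_{[p]}$ is a Hilbert--Schmidt operator), and $$\Sigma_0([p])=1+\sum_{n\ge0}|\alpha_n|^2,\qquad \Sigma_1([p])=\sum_{n\ge0}|\alpha_n|^2 .$$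
   Context: $H^2(\mathbb D^2)$ is the Hardy space of the bidisc (monomials $z^iw^j$ orthonormal, inner products linear in the first variable), and $m$ is normalized Haar measure on $\mathbb T$. For a polynomial $p$, $[p]$ is the closure of $p\,\mathbb C[z,w]$ in $H^2(\mathbb D^2)$. For $\mathcal M=[p]$ put $R_z=M_z|_{\mathcal M}$, $R_w=M_w|_{\mathcal M}$ (multiplication by the coordinates), $P_z=I-R_zR_z^*=P_{\mathcal M\ominus z\mathcal M}$, $P_w=I-R_wR_w^*=P_{\mathcal M\ominus w\mathcal M}$, operators on $\mathcal M$; $$X_{\mathcal M}=[R_z^*,R_w]=R_z^*R_w-R_wR_z^*,\qquad C_{\mathcal M}=I-R_zR_z^*-R_wR_w^*+R_zR_wR_z^*R_w^* .$$ $\Sigma_0(\mathcal M)=\|P_zP_w\|_{HS}^2$ and $\Sigma_1(\mathcal M)=\|X_{\mathcal M}\|_{HS}^2$, with $\|\cdot\|_{HS}$ the Hilbert--Schmidt norm. $\mathcal S_r$ is the Schatten class, $\|T\|_{\mathcal S_r}^r=\sum_j s_j(T)^r$ (a quasi-norm for $0<r<1$). For $p\neq0$ homogeneous put $q(\zeta)=p(\zeta,1)$ and let $\mu_p$ be the probability measure on $\mathbb T$ given by $d\mu_p=\frac{|q|^2}{\|q\|_2^2}\,dm$, with $\|q\|_2$ the norm of $L^2(\mathbb T,m)$. Let $(\varphi_n)_{n\ge0}$ be the orthonormal polynomials of $\mu_p$ with positive leading coefficients, and $\varphi_n^*(\zeta)=\zeta^n\overline{\varphi_n(1/\overline\zeta)}$.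 The Verblunsky coefficients $\alpha_n\in\mathbb D$ are defined by the Szegő recursion $\rho_n\varphi_{n+1}(\zeta)=\zeta\varphi_n(\zeta)-\overline{\alpha_n}\varphi_n^*(\zeta)$, $\rho_n=(1-|\alpha_n|^2)^{1/2}$. *)

theory Defs
  imports "HOL-Analysis.Analysis" "HOL-Computational_Algebra.Polynomial"
begin

section \<open>The Hardy space of the bidisc\<close>

text \<open>
  A function in \<open>H\<^sup>2(D\<^sup>2)\<close> is identified with the square-summable family of its Taylor
  coefficients: \<open>hcoeff f (i, j)\<close> is the coefficient of \<open>z\<^sup>i w\<^sup>j\<close>.
\<close>

typedef hardy2 = "{a :: nat \<times> nat \<Rightarrow> complex. (\<lambda>k. (cmod (a k))\<^sup>2) summable_on UNIV}"
  morphisms hcoeff Abs_hardy2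
  by (rule exI[of _ "\<lambda>_. 0"]) simp

setup_lifting type_definition_hardy2

lemma hcoeff_summable: "(\<lambda>k. (cmod (hcoeff f k))\<^sup>2) summable_on UNIV"
  using hcoeff[of f] by simp

lemma hardy2_eqI: "(\<And>k. hcoeff f k = hcoeff g k) \<Longrightarrow> f = g"
  by (meson hcoeff_inject ext)

lemma square_summable_add:
  fixes a b :: "'k \<Rightarrow> complex"
  assumes "(\<lambda>k. (cmod (a k))\<^sup>2) summable_on A" "(\<lambda>k. (cmod (b k))\<^sup>2) summable_on A"
  shows "(\<lambda>k. (cmod (a k + b k))\<^sup>2) summable_on A"
proof (rule summable_on_comparison_test)
  show "(\<lambda>k. 2 * (cmod (a k))\<^sup>2 + 2 * (cmod (b k))\<^sup>2) summable_on A"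
    by (intro summable_on_add summable_on_cmult_right assms)
  show "(cmod (a k + b k))\<^sup>2 \<le> 2 * (cmod (a k))\<^sup>2 + 2 * (cmod (b k))\<^sup>2" for k
  proof -
    have "(cmod (a k + b k))\<^sup>2 \<le> (cmod (a k) + cmod (b k))\<^sup>2"
      by (simp add: norm_triangle_ineq power_mono)
    also have "\<dots> \<le> 2 * (cmod (a k))\<^sup>2 + 2 * (cmod (b k))\<^sup>2"
      using sum_squares_bound[of "cmod (a k)" "cmod (b k)"] by (simp add: power2_sum)
    finally show ?thesis .
  qed
qed simp

lemma product_summable:
  fixes a b :: "'k \<Rightarrow> complex"
  assumes "(\<lambda>k. (cmod (a k))\<^sup>2) summable_on A" "(\<lambda>k. (cmod (b k))\<^sup>2) summable_on A"
  shows "(\<lambda>k. a k * cnj (b k)) summable_on A"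
proof -
  have "(\<lambda>k. norm (a k * cnj (b k))) summable_on A"
  proof (rule summable_on_comparison_test)
    show "(\<lambda>k. (cmod (a k))\<^sup>2 + (cmod (b k))\<^sup>2) summable_on A"
      by (intro summable_on_add assms)
    show "norm (a k * cnj (b k)) \<le> (cmod (a k))\<^sup>2 + (cmod (b k))\<^sup>2" for k
      using sum_squares_bound[of "cmod (a k)" "cmod (b k)"]
        mult_nonneg_nonneg[OF norm_ge_zero[of "a k"] norm_ge_zero[of "b k"]]
      unfolding norm_mult complex_mod_cnj by linarith
  qed simp
  then show ?thesis
    using summable_on_iff_abs_summable_on_complex by blast
qed

text \<open>The inner product is linear in the first variable; monomials are orthonormal.\<close>

definition cinner :: "hardy2 \<Rightarrow> hardy2 \<Rightarrow> complex" where
  "cinner f g = (\<Sum>\<^sub>\<infinity>k. hcoeff f k * cnj (hcoeff g k))"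

lift_definition cscale :: "complex \<Rightarrow> hardy2 \<Rightarrow> hardy2" is "\<lambda>c a k. c * a k"
  by (simp add: norm_mult power_mult_distrib summable_on_cmult_right)

instantiation hardy2 :: ab_group_add
begin

lift_definition zero_hardy2 :: hardy2 is "\<lambda>_. 0" by simp
lift_definition plus_hardy2 :: "hardy2 \<Rightarrow> hardy2 \<Rightarrow> hardy2" is "\<lambda>a b k. a k + b k"
  by (rule square_summable_add)
lift_definition uminus_hardy2 :: "hardy2 \<Rightarrow> hardy2" is "\<lambda>a k. - a k" by simp
lift_definition minus_hardy2 :: "hardy2 \<Rightarrow> hardy2 \<Rightarrow> hardy2" is "\<lambda>a b k. a k - b k"
  subgoal for a b using square_summable_add[of a UNIV "\<lambda>k. - b k"] by simp
  done

instance
  by standard (transfer; simp add: fun_eq_iff)+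

end

text \<open>The real structure is the one underlying the complex one; it supplies the norm and the topology.\<close>

instantiation hardy2 :: real_vector
begin

definition scaleR_hardy2 :: "real \<Rightarrow> hardy2 \<Rightarrow> hardy2" where
  "scaleR r f = cscale (complex_of_real r) f"

instance
  by standard (unfold scaleR_hardy2_def; transfer; simp add: fun_eq_iff algebra_simps)+

end

instantiation hardy2 :: real_inner
begin

definition inner_hardy2 :: "hardy2 \<Rightarrow> hardy2 \<Rightarrow> real" where
  "inner f g = Re (cinner f g)"
definition norm_hardy2 :: "hardy2 \<Rightarrow> real" where
  "norm f = sqrt (inner f (f::hardy2))"
definition sgn_hardy2 :: "hardy2 \<Rightarrow> hardy2" where
  "sgn f = (f :: hardy2) /\<^sub>R norm f"
definition dist_hardy2 :: "hardy2 \<Rightarrow> hardy2 \<Rightarrow> real" where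
  "dist f g = norm (f - g :: hardy2)"
definition uniformity_hardy2 :: "(hardy2 \<times> hardy2) filter" where
  "uniformity = (INF e\<in>{0<..}. principal {(f, g). dist f (g::hardy2) < e})"
definition open_hardy2 :: "hardy2 set \<Rightarrow> bool" where
  "open U \<longleftrightarrow> (\<forall>x\<in>U. \<forall>\<^sub>F (x', y :: hardy2) in uniformity. x' = x \<longrightarrow> y \<in> U)"

instance
proof
  have summ: "(\<lambda>k. hcoeff f k * cnj (hcoeff g k)) summable_on UNIV" for f g
    by (rule product_summable[OF hcoeff_summable hcoeff_summable])
  have self: "inner f f = (\<Sum>\<^sub>\<infinity>k. (cmod (hcoeff f k))\<^sup>2)" for f :: hardy2
    unfolding inner_hardy2_def cinner_def infsum_Re[OF summ, symmetric]
    by (simp add: complex_norm_square[symmetric] flip: of_real_power)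
  fix f g h :: hardy2 and r :: real
  show "sgn f = f /\<^sub>R norm f" by (rule sgn_hardy2_def)
  show "dist f g = norm (f - g)" by (rule dist_hardy2_def)
  show "(uniformity :: (hardy2 \<times> hardy2) filter) = (INF e\<in>{0<..}. principal {(x, y). dist x y < e})"
    by (rule uniformity_hardy2_def)
  show "open U \<longleftrightarrow> (\<forall>x\<in>U. \<forall>\<^sub>F (x', y :: hardy2) in uniformity. x' = x \<longrightarrow> y \<in> U)" for U :: "hardy2 set"
    by (rule open_hardy2_def)
  have "cinner f g = cnj (cinner g f)"
    unfolding cinner_def infsum_cnj[symmetric] by (simp add: mult.commute)
  then show "inner f g = inner g f" by (simp add: inner_hardy2_def)
  have "cinner (f + g) h = cinner f h + cinner g h"
    unfolding cinner_def plus_hardy2.rep_eq distrib_right by (rule infsum_add[OF summ summ])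
  then show "inner (f + g) h = inner f h + inner g h" by (simp add: inner_hardy2_def)
  have "cinner (r *\<^sub>R f) g = complex_of_real r * cinner f g"
    unfolding cinner_def scaleR_hardy2_def cscale.rep_eq mult.assoc
    by (rule infsum_cmult_right) (rule summ)
  then show "inner (r *\<^sub>R f) g = r * inner f g" by (simp add: inner_hardy2_def)
  show "0 \<le> inner f f" unfolding self by (simp add: infsum_nonneg)
  show "inner f f = 0 \<longleftrightarrow> f = 0"
  proof
    assume "inner f f = 0"
    then have "(cmod (hcoeff f k))\<^sup>2 = 0" for k
      using nonneg_infsum_le_0D[OF _ hcoeff_summable[of f], of k] by (simp add: self)
    then show "f = 0" by (intro hardy2_eqI) (simp add: zero_hardy2.rep_eq)
  qed (simp add: self zero_hardy2.rep_eq)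
  show "norm f = sqrt (inner f f)" by (rule norm_hardy2_def)
qed

end

global_interpretation hardy2: vector_space cscale
  by standard (transfer; simp add: fun_eq_iff algebra_simps)+

lemma shift_summable:
  fixes a b :: "nat \<times> nat \<Rightarrow> complex" and s :: "nat \<times> nat \<Rightarrow> nat \<times> nat"
  assumes "(\<lambda>k. (cmod (a k))\<^sup>2) summable_on UNIV" and "inj s"
    and "\<And>k. b (s k) = a k" and "\<And>k. k \<notin> range s \<Longrightarrow> b k = 0"
  shows "(\<lambda>k. (cmod (b k))\<^sup>2) summable_on UNIV"
proof -
  have "(\<lambda>k. (cmod (b k))\<^sup>2) summable_on range s"
    using assms by (subst summable_on_reindex) (auto simp: o_def)
  then show ?thesis
    by (subst summable_on_cong_neutral[where T = "range s" and g = "\<lambda>k. (cmod (b k))\<^sup>2"])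
      (auto simp: assms(4))
qed

lift_definition Mz :: "hardy2 \<Rightarrow> hardy2" is
  "\<lambda>a (i, j). case i of 0 \<Rightarrow> 0 | Suc i' \<Rightarrow> a (i', j)"
  by (rule shift_summable[where s = "\<lambda>(i, j). (Suc i, j)"])
    (force simp: inj_on_def image_iff split: nat.splits)+

lift_definition Mw :: "hardy2 \<Rightarrow> hardy2" is
  "\<lambda>a (i, j). case j of 0 \<Rightarrow> 0 | Suc j' \<Rightarrow> a (i, j')"
  by (rule shift_summable[where s = "\<lambda>(i, j). (i, Suc j)"])
    (force simp: inj_on_def image_iff split: nat.splits)+


section \<open>Polynomials in two variables and the submodules they generate\<close>

text \<open>
  \<open>\<complex>[z,w]\<close> is \<open>(\<complex>[w])[z]\<close>, the type \<^typ>\<open>complex poly poly\<close>: the coefficient of \<open>z\<^sup>i w\<^sup>j\<close>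
  in \<open>p\<close> is \<open>coeff (coeff p i) j\<close>, the outer variable being \<open>z\<close>.
\<close>

lift_definition hardy_of_poly :: "complex poly poly \<Rightarrow> hardy2" is
  "\<lambda>p (i, j). coeff (coeff p i) j"
proof -
  fix p :: "complex poly poly"
  let ?S = "SIGMA i:{..degree p}. {..degree (coeff p i)}"
  have "(\<lambda>k. (cmod ((\<lambda>(i, j). coeff (coeff p i) j) k))\<^sup>2) summable_on ?S"
    by (rule summable_on_finite) auto
  moreover have "(\<lambda>(i, j). coeff (coeff p i) j) k = 0" if "k \<notin> ?S" for k
    using that by (cases k) (auto simp: not_le coeff_eq_0)
  ultimately show "(\<lambda>k. (cmod ((\<lambda>(i, j). coeff (coeff p i) j) k))\<^sup>2) summable_on UNIV"
    by (subst summable_on_cong_neutral[where T = ?S and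
          g = "\<lambda>k. (cmod ((\<lambda>(i, j). coeff (coeff p i) j) k))\<^sup>2"]) auto
qed

lemma Mz_hardy_of_poly: "Mz (hardy_of_poly p) = hardy_of_poly ([:0, 1:] * p)"
  by (rule hardy2_eqI)
    (auto simp: Mz.rep_eq hardy_of_poly.rep_eq coeff_pCons split: nat.splits)

lemma Mw_hardy_of_poly: "Mw (hardy_of_poly p) = hardy_of_poly ([:[:0, 1:]:] * p)"
  by (rule hardy2_eqI)
    (auto simp: Mw.rep_eq hardy_of_poly.rep_eq coeff_pCons split: nat.splits)

definition submodule_gen :: "complex poly poly \<Rightarrow> hardy2 set" where
  "submodule_gen p = closure (range (\<lambda>g. hardy_of_poly (p * g)))"

definition homogeneous :: "complex poly poly \<Rightarrow> bool" where
  "homogeneous p \<longleftrightarrow> (\<exists>d. \<forall>i j. coeff (coeff p i) j \<noteq> 0 \<longrightarrow> i + j = d)"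

definition eval2 :: "complex poly poly \<Rightarrow> complex \<Rightarrow> complex \<Rightarrow> complex" where
  "eval2 p z w = poly (poly p [:z:]) w"


section \<open>Operators on a closed subspace\<close>

text \<open>
  An operator on a closed subspace \<open>M\<close> is a function on the whole type of which only the values
  on \<open>M\<close> matter.
\<close>

definition bounded_op_on :: "hardy2 set \<Rightarrow> (hardy2 \<Rightarrow> hardy2) \<Rightarrow> bool" where
  "bounded_op_on M T \<longleftrightarrow>
     (\<forall>f\<in>M. T f \<in> M) \<and>
     (\<forall>f\<in>M. \<forall>g\<in>M. T (f + g) = T f + T g) \<and>
     (\<forall>c. \<forall>f\<in>M. T (cscale c f) = cscale c (T f)) \<and>
     (\<exists>K. \<forall>f\<in>M. norm (T f) \<le> K * norm f)"

definition compact_op_on :: "hardy2 set \<Rightarrow> (hardy2 \<Rightarrow> hardy2) \<Rightarrow> bool" where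
  "compact_op_on M T \<longleftrightarrow>
     bounded_op_on M T \<and> compact (closure (T ` {f \<in> M. norm f \<le> 1}))"

text \<open>The adjoint is taken in \<open>M\<close>, not in the ambient space.\<close>

definition adj_on :: "hardy2 set \<Rightarrow> (hardy2 \<Rightarrow> hardy2) \<Rightarrow> hardy2 \<Rightarrow> hardy2" where
  "adj_on M T f = (THE g. g \<in> M \<and> (\<forall>h\<in>M. cinner (T h) f = cinner h g))"

text \<open>Dimension over the complex numbers; \<open>has_cdim V n\<close> entails that \<open>V\<close> is finite-dimensional.\<close>

definition has_cdim :: "hardy2 set \<Rightarrow> nat \<Rightarrow> bool" where
  "has_cdim V n \<longleftrightarrow>
     (\<exists>B. finite B \<and> card B = n \<and> hardy2.independent B \<and> hardy2.span B = V)"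

definition eigenspace_on :: "hardy2 set \<Rightarrow> (hardy2 \<Rightarrow> hardy2) \<Rightarrow> complex \<Rightarrow> hardy2 set" where
  "eigenspace_on M T c = {f \<in> M. T f = cscale c f}"

text \<open>
  The sequence \<open>a\<close> lists, in some order, the non-zero eigenvalues of \<open>T\<close> with their
  (geometric) multiplicities; its zero terms are ignored.
\<close>

definition lists_nonzero_eigenvalues ::
    "hardy2 set \<Rightarrow> (hardy2 \<Rightarrow> hardy2) \<Rightarrow> (nat \<Rightarrow> complex) \<Rightarrow> bool" where
  "lists_nonzero_eigenvalues M T a \<longleftrightarrow>
     (\<forall>c. c \<noteq> 0 \<longrightarrow> finite {n. a n = c} \<and> has_cdim (eigenspace_on M T c) (card {n. a n = c}))"

text \<open>
  Singular values are taken of compact operators only. The singular values \<open>s > 0\<close> of \<open>T\<close> are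
  the square roots of the eigenvalues \<open>s\<^sup>2 > 0\<close> of \<open>T\<^sup>*T\<close>, with the same multiplicities.
\<close>

definition lists_nonzero_singular_values ::
    "hardy2 set \<Rightarrow> (hardy2 \<Rightarrow> hardy2) \<Rightarrow> (nat \<Rightarrow> real) \<Rightarrow> bool" where
  "lists_nonzero_singular_values M T a \<longleftrightarrow> compact_op_on M T \<and>
     (\<forall>s>0. finite {n. a n = s} \<and>
        has_cdim (eigenspace_on M (\<lambda>f. adj_on M T (T f)) (complex_of_real (s\<^sup>2)))
          (card {n. a n = s}))"

text \<open>
  \<open>s\<^sub>0(T) \<ge> s\<^sub>1(T) \<ge> \<dots>\<close>, extended by zeros if there are only finitely many non-zero singular
  values. For compact \<open>T\<close> exactly one sequence has this property; for other \<open>T\<close> none has.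
\<close>

definition singular_value :: "hardy2 set \<Rightarrow> (hardy2 \<Rightarrow> hardy2) \<Rightarrow> nat \<Rightarrow> real" where
  "singular_value M T =
     (THE s. decseq s \<and> (\<forall>j. 0 \<le> s j) \<and> lists_nonzero_singular_values M T s)"

definition in_schatten :: "real \<Rightarrow> hardy2 set \<Rightarrow> (hardy2 \<Rightarrow> hardy2) \<Rightarrow> bool" where
  "in_schatten r M T \<longleftrightarrow>
     compact_op_on M T \<and> summable (\<lambda>j. singular_value M T j powr r)"

text \<open>The \<open>r\<close>-th power of the Schatten (quasi-)norm, infinite outside the Schatten class.\<close>

definition schatten_norm_powr :: "real \<Rightarrow> hardy2 set \<Rightarrow> (hardy2 \<Rightarrow> hardy2) \<Rightarrow> ennreal" where
  "schatten_norm_powr r M T = (\<Sum>j. ennreal (singular_value M T j powr r))"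

definition orthonormal_basis_on :: "hardy2 set \<Rightarrow> hardy2 set \<Rightarrow> bool" where
  "orthonormal_basis_on M B \<longleftrightarrow>
     (\<forall>e\<in>B. \<forall>e'\<in>B. cinner e e' = (if e = e' then 1 else 0)) \<and> closure (hardy2.span B) = M"

text \<open>The value does not depend on the orthonormal basis chosen.\<close>

definition hs_norm_sq :: "hardy2 set \<Rightarrow> (hardy2 \<Rightarrow> hardy2) \<Rightarrow> ennreal" where
  "hs_norm_sq M T = (\<Sum>\<^sub>\<infinity>e\<in>(SOME B. orthonormal_basis_on M B). ennreal ((norm (T e))\<^sup>2))"

definition hilbert_schmidt_on :: "hardy2 set \<Rightarrow> (hardy2 \<Rightarrow> hardy2) \<Rightarrow> bool" where
  "hilbert_schmidt_on M T \<longleftrightarrow> bounded_op_on M T \<and> hs_norm_sq M T < \<infinity>"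


section \<open>The operators attached to a submodule\<close>

definition Pz :: "hardy2 set \<Rightarrow> hardy2 \<Rightarrow> hardy2" where
  "Pz M f = f - Mz (adj_on M Mz f)"

definition Pw :: "hardy2 set \<Rightarrow> hardy2 \<Rightarrow> hardy2" where
  "Pw M f = f - Mw (adj_on M Mw f)"

definition cross_commutator :: "hardy2 set \<Rightarrow> hardy2 \<Rightarrow> hardy2" where
  "cross_commutator M f = adj_on M Mz (Mw f) - Mw (adj_on M Mz f)"

definition core_operator :: "hardy2 set \<Rightarrow> hardy2 \<Rightarrow> hardy2" where
  "core_operator M f =
     f - Mz (adj_on M Mz f) - Mw (adj_on M Mw f) + Mz (Mw (adj_on M Mz (adj_on M Mw f)))"

definition hilbert_schmidt_submodule :: "hardy2 set \<Rightarrow> bool" where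
  "hilbert_schmidt_submodule M \<longleftrightarrow> hilbert_schmidt_on M (core_operator M)"

definition Sigma0 :: "hardy2 set \<Rightarrow> ennreal" where
  "Sigma0 M = hs_norm_sq M (\<lambda>f. Pz M (Pw M f))"

definition Sigma1 :: "hardy2 set \<Rightarrow> ennreal" where
  "Sigma1 M = hs_norm_sq M (cross_commutator M)"


section \<open>Orthogonal polynomials on the unit circle\<close>

text \<open>Measures on the circle are Borel measures on the plane carried by the circle.\<close>

definition circle_haar :: "complex measure" where
  "circle_haar = distr (uniform_measure lborel {0..<2 * pi}) borel cis"

definition l2norm_circle :: "(complex \<Rightarrow> complex) \<Rightarrow> real" where
  "l2norm_circle q = sqrt (\<integral>\<zeta>. (cmod (q \<zeta>))\<^sup>2 \<partial>circle_haar)"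

definition mu :: "complex poly poly \<Rightarrow> complex measure" where
  "mu p = (let q = (\<lambda>\<zeta>. eval2 p \<zeta> 1) in
     density circle_haar (\<lambda>\<zeta>. ennreal ((cmod (q \<zeta>))\<^sup>2 / (l2norm_circle q)\<^sup>2)))"

definition orthonormal_polys_pred :: "complex measure \<Rightarrow> (nat \<Rightarrow> complex poly) \<Rightarrow> bool" where
  "orthonormal_polys_pred \<mu> \<phi> \<longleftrightarrow>
     (\<forall>n. degree (\<phi> n) = n \<and> lead_coeff (\<phi> n) \<in> \<real> \<and> Re (lead_coeff (\<phi> n)) > 0) \<and>
     (\<forall>m n. (\<integral>\<zeta>. poly (\<phi> m) \<zeta> * cnj (poly (\<phi> n) \<zeta>) \<partial>\<mu>) = (if m = n then 1 else 0))"

definition orthonormal_polys :: "complex measure \<Rightarrow> nat \<Rightarrow> complex poly" where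
  "orthonormal_polys \<mu> = (THE \<phi>. orthonormal_polys_pred \<mu> \<phi>)"

text \<open>The Szego recursion determines \<open>\<alpha>\<^sub>n\<close>. It is imposed for \<open>\<zeta> \<noteq> 0\<close>, where the formula
  for \<open>\<phi>\<^sub>n\<^sup>*\<close> makes sense.\<close>

definition verblunsky :: "complex measure \<Rightarrow> nat \<Rightarrow> complex" where
  "verblunsky \<mu> n = (let \<phi> = orthonormal_polys \<mu> in
     THE a. cmod a < 1 \<and>
       (\<forall>\<zeta>. \<zeta> \<noteq> 0 \<longrightarrow>
          complex_of_real (sqrt (1 - (cmod a)\<^sup>2)) * poly (\<phi> (Suc n)) \<zeta> =
          \<zeta> * poly (\<phi> n) \<zeta> - cnj a * (\<zeta> ^ n * cnj (poly (\<phi> n) (1 / cnj \<zeta>)))))"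

end

theory Submission
  imports Defs
begin

text \<open>
  With \<open>q(\<zeta>) = p(\<zeta>, 1)\<close>, the map \<open>G \<mapsto> p \<cdot> w\<^sup>n G(z/w) / \<parallel>q\<parallel>\<close> embeds the polynomials of degree at most \<open>n\<close>,
  with the inner product of \<open>L\<^sup>2(\<mu>\<^sub>p)\<close>, onto the degree \<open>n\<close> part of \<open>M = [p]\<close> (degrees being shifted
  by \<open>deg p\<close>); \<open>z\<close> becomes multiplication by \<open>\<zeta>\<close> and \<open>w\<close> an inclusion. Hence the images \<open>f\<^sub>n\<close> of
  \<open>\<phi>\<^sub>n\<close> and \<open>g\<^sub>n\<close> of \<open>\<phi>\<^sub>n\<^sup>*\<close> are orthonormal bases of \<open>M \<ominus> wM\<close> and \<open>M \<ominus> zM\<close>, and the Szego recursion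
  gives \<open>P\<^sub>zP\<^sub>w = \<Sum> \<langle>f\<^sub>n, g\<^sub>n\<rangle> \<langle>\<cdot>, f\<^sub>n\<rangle> g\<^sub>n\<close> with \<open>|\<langle>f\<^sub>n\<^sub>+\<^sub>1, g\<^sub>n\<^sub>+\<^sub>1\<rangle>| = |\<alpha>\<^sub>n|\<close> and
  \<open>X = \<Sum> \<alpha>\<^sub>n \<langle>\<cdot>, g\<^sub>n\<rangle> f\<^sub>n\<close>. The core operator is \<open>P\<^sub>z - R\<^sub>wP\<^sub>zR\<^sub>w\<^sup>*\<close>: in degree \<open>n + 1\<close> it is the
  difference of the projections onto \<open>g\<^sub>n\<^sub>+\<^sub>1\<close> and \<open>wg\<^sub>n\<close>, two unit vectors with inner product
  \<open>(1 - |\<alpha>\<^sub>n|\<^sup>2)\<^sup>1\<^sup>/\<^sup>2\<close>, so its eigenvalues there are \<open>\<plusminus>|\<alpha>\<^sub>n|\<close>. Finally \<open>\<Sum> |\<alpha>\<^sub>n|\<^sup>2 < \<infinity>\<close>, since a monic \<open>A\<close>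
  satisfies \<open>\<parallel>qA\<parallel>\<^sub>2 \<ge> |lc q|\<close>.
\<close>

section \<open>The Hilbert space structure\<close>

text \<open>Homogeneity splits \<open>M\<close> orthogonally by degree, so everything reduces to one
  shift-invariant inner product on polynomials of one variable. In degree n the range of w is the
  space of polynomials of degree below n, and the range of z is \<zeta> times it. The wandering
  vectors are what is orthogonal to these. Compactness is not automatic, since it requires
  \<alpha>_n to tend to 0, which fails for general measures. Here the leading coefficient of qA is
  that of q and is one of the coefficients whose squares add up to the norm. The squared norm of the
  monic \<phi>_n is the product of the 1 - |\<alpha>_k|^2 with k < n, so these products stay away
  from 0. Two obstacles shape the proof. Some \<alpha>_n may vanish, and then no eigenvectors belong
  to them; families of vectors are therefore allowed to vanish exactly where their coefficients do.
  Moreover adjoints, singular values, orthonormal polynomials and Verblunsky coefficients are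
  definite descriptions, and the basis in the Hilbert-Schmidt norm is an arbitrary choice. Each is
  resolved by an explicit candidate with uniqueness, or by independence of the choice.\<close>

lemma cinner_summable: "(\<lambda>k. hcoeff f k * cnj (hcoeff g k)) summable_on UNIV"
  by (rule product_summable[OF hcoeff_summable hcoeff_summable])

lemma cinner_commute: "cinner f g = cnj (cinner g f)"
  unfolding cinner_def infsum_cnj[symmetric] by (simp add: mult.commute)

lemma cinner_add_left: "cinner (f + g) h = cinner f h + cinner g h"
  unfolding cinner_def plus_hardy2.rep_eq distrib_right
  by (rule infsum_add[OF cinner_summable cinner_summable])

lemma cinner_scale_left: "cinner (cscale c f) g = c * cinner f g"
  unfolding cinner_def cscale.rep_eq mult.assoc
  by (rule infsum_cmult_right) (rule cinner_summable)

lemma cinner_add_right: "cinner h (f + g) = cinner h f + cinner h g"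
  by (subst (1 2 3) cinner_commute) (simp add: cinner_add_left)

lemma cinner_scale_right: "cinner f (cscale c g) = cnj c * cinner f g"
  by (subst (1 2) cinner_commute) (simp add: cinner_scale_left)

lemma cinner_zero_left [simp]: "cinner 0 g = 0"
  using cinner_add_left[of 0 0 g] by simp

lemma cinner_zero_right [simp]: "cinner g 0 = 0"
  using cinner_add_right[of g 0 0] by simp

lemma cinner_minus_left: "cinner (- f) g = - cinner f g"
  using cinner_add_left[of f "- f" g] by (simp add: eq_neg_iff_add_eq_0 add.commute)

lemma cinner_minus_right: "cinner g (- f) = - cinner g f"
  using cinner_add_right[of g f "- f"] by (simp add: eq_neg_iff_add_eq_0 add.commute)

lemma cinner_diff_left: "cinner (f - g) h = cinner f h - cinner g h"
  using cinner_add_left[of f "- g" h] by (simp add: cinner_minus_left)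

lemma cinner_diff_right: "cinner h (f - g) = cinner h f - cinner h g"
  using cinner_add_right[of h f "- g"] by (simp add: cinner_minus_right)

lemma cinner_sum_left: "cinner (\<Sum>i\<in>A. f i) g = (\<Sum>i\<in>A. cinner (f i) g)"
  by (induction A rule: infinite_finite_induct) (auto simp: cinner_add_left)

lemma cinner_sum_right: "cinner g (\<Sum>i\<in>A. f i) = (\<Sum>i\<in>A. cinner g (f i))"
  by (induction A rule: infinite_finite_induct) (auto simp: cinner_add_right)

lemmas cinner_simps = cinner_add_left cinner_add_right cinner_diff_left cinner_diff_right
  cinner_minus_left cinner_minus_right cinner_scale_left cinner_scale_right

lemma cinner_self: "cinner f f = complex_of_real ((norm f)\<^sup>2)"
proof -
  have "Im (cinner f f) = 0"
    using cinner_commute[of f f] by (metis Reals_cnj_iff complex_is_Real_iff)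
  then show ?thesis
    by (simp add: complex_eq_iff power2_norm_eq_inner inner_hardy2_def)
qed

lemma norm_sq_hardy2: "(norm f)\<^sup>2 = Re (cinner f f)"
  by (simp add: cinner_self)

lemma norm_cscale: "norm (cscale c f) = cmod c * norm f"
proof -
  have "cinner (cscale c f) (cscale c f) = (c * cnj c) * cinner f f"
    by (simp add: cinner_simps)
  also have "\<dots> = complex_of_real ((cmod c * norm f)\<^sup>2)"
    by (simp only: cinner_self complex_norm_square[symmetric] power_mult_distrib of_real_mult of_real_power)
  finally have "(norm (cscale c f))\<^sup>2 = (cmod c * norm f)\<^sup>2"
    by (simp only: cinner_self of_real_eq_iff)
  then show ?thesis
    by (simp add: power2_eq_iff_nonneg)
qed

lemma cmod_cinner_le: "cmod (cinner f g) \<le> norm f * norm g"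
proof (cases "cinner f g = 0")
  case False
  \<comment> \<open>The class \<open>real_inner\<close> only bounds the real part, so
    \<open>f\<close> is rotated by the phase that makes \<open>cinner f g\<close> positive.\<close>
  define c where "c = cnj (cinner f g) / cmod (cinner f g)"
  have "cmod c = 1" using False by (simp add: c_def norm_divide)
  have "c * cinner f g = complex_of_real (cmod (cinner f g))"
    using False complex_norm_square[of "cinner f g"]
    by (simp add: c_def power2_eq_square field_simps)
  then have "cmod (cinner f g) = inner (cscale c f) g"
    by (simp add: inner_hardy2_def cinner_simps)
  also have "\<dots> \<le> norm (cscale c f) * norm g"
    by (rule norm_cauchy_schwarz)
  finally show ?thesis by (simp add: norm_cscale \<open>cmod c = 1\<close>)
qed simp

lemma scaleR_cscale: "scaleR r f = cscale (complex_of_real r) f"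
  by (rule scaleR_hardy2_def)

lemma bounded_linear_cinner_left: "bounded_linear (\<lambda>f. cinner f g)"
  by (rule bounded_linear_intro[where K = "norm g"])
    (auto simp: cinner_simps scaleR_cscale cmod_cinner_le scaleR_conv_of_real)

lemma bounded_linear_cinner_right: "bounded_linear (\<lambda>g. cinner f g)"
  by (rule bounded_linear_intro[where K = "norm f"])
    (use cmod_cinner_le[of f] in \<open>auto simp: cinner_simps scaleR_cscale mult.commute scaleR_conv_of_real\<close>)

lemma cscale_scaleR_commute: "cscale c (scaleR r f) = scaleR r (cscale c f)"
  by (simp add: scaleR_cscale mult.commute)

lemma bounded_linear_cscale: "bounded_linear (cscale c)"
  by (rule bounded_linear_intro[where K = "cmod c"])
    (auto simp: norm_cscale hardy2.scale_right_distrib cscale_scaleR_commute mult.commute)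

lemma bounded_linear_cscale_left: "bounded_linear (\<lambda>c. cscale c f)"
  by (rule bounded_linear_intro[where K = "norm f"])
    (auto simp: norm_cscale hardy2.scale_left_distrib scaleR_cscale scaleR_conv_of_real)

lemma norm_sq_infsum: "(norm f)\<^sup>2 = (\<Sum>\<^sub>\<infinity>k. (cmod (hcoeff f k))\<^sup>2)"
  unfolding norm_sq_hardy2 cinner_def infsum_Re[OF cinner_summable, symmetric]
  by (simp add: complex_norm_square[symmetric] flip: of_real_power)

lemma sum_coeff_le_norm:
  assumes "finite S" shows "(\<Sum>k\<in>S. (cmod (hcoeff f k))\<^sup>2) \<le> (norm f)\<^sup>2"
  unfolding norm_sq_infsum
  by (rule finite_sum_le_infsum[OF hcoeff_summable assms]) auto

lemma cmod_hcoeff_le: "cmod (hcoeff f k) \<le> norm f"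
  using sum_coeff_le_norm[of "{k}" f] by (simp add: power2_le_iff_abs_le)

text \<open>Coordinates converge, and the Cauchy estimates are kept on finite index sets, where
  limits may be taken termwise, before being extended to all indices. Orthogonal series and
  compactness by total boundedness both rest on this.\<close>

instance hardy2 :: complete_space
proof
  fix X :: "nat \<Rightarrow> hardy2"
  assume X: "Cauchy X"
  have conv: "convergent (\<lambda>n. hcoeff (X n) k)" for k
  proof (rule Cauchy_convergent, rule CauchyI)
    fix e :: real assume "e > 0"
    with X obtain N where N: "\<And>m n. m \<ge> N \<Longrightarrow> n \<ge> N \<Longrightarrow> norm (X m - X n) < e"
      by (meson CauchyD)
    show "\<exists>N. \<forall>m\<ge>N. \<forall>n\<ge>N. norm (hcoeff (X m) k - hcoeff (X n) k) < e"
    proof (intro exI allI impI)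
      fix m n assume "N \<le> m" "N \<le> n"
      then show "norm (hcoeff (X m) k - hcoeff (X n) k) < e"
        using N[of m n] cmod_hcoeff_le[of "X m - X n" k] by (simp add: minus_hardy2.rep_eq)
    qed
  qed
  define a where "a = (\<lambda>k. lim (\<lambda>n. hcoeff (X n) k))"
  have lim: "(\<lambda>n. hcoeff (X n) k) \<longlonglongrightarrow> a k" for k
    using conv[of k] by (simp add: a_def convergent_LIMSEQ_iff)
  have bnd: "\<exists>N. \<forall>n\<ge>N. \<forall>S. finite S \<longrightarrow> (\<Sum>k\<in>S. (cmod (hcoeff (X n) k - a k))\<^sup>2) \<le> e\<^sup>2"
    if "e > 0" for e :: real
  proof -
    from X that obtain N where N: "\<And>m n. m \<ge> N \<Longrightarrow> n \<ge> N \<Longrightarrow> norm (X m - X n) < e"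
      by (meson CauchyD)
    have "(\<Sum>k\<in>S. (cmod (hcoeff (X n) k - a k))\<^sup>2) \<le> e\<^sup>2" if "n \<ge> N" "finite S" for n S
    proof (rule LIMSEQ_le_const2)
      show "(\<lambda>m. \<Sum>k\<in>S. (cmod (hcoeff (X n) k - hcoeff (X m) k))\<^sup>2)
          \<longlonglongrightarrow> (\<Sum>k\<in>S. (cmod (hcoeff (X n) k - a k))\<^sup>2)"
        by (intro tendsto_intros lim)
      have "(\<Sum>k\<in>S. (cmod (hcoeff (X n) k - hcoeff (X m) k))\<^sup>2) \<le> e\<^sup>2" if "m \<ge> N" for m
      proof -
        have "(\<Sum>k\<in>S. (cmod (hcoeff (X n) k - hcoeff (X m) k))\<^sup>2) \<le> (norm (X n - X m))\<^sup>2"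
          using sum_coeff_le_norm[OF \<open>finite S\<close>, of "X n - X m"] by (simp add: minus_hardy2.rep_eq)
        also have "\<dots> \<le> e\<^sup>2"
          using N[OF \<open>n \<ge> N\<close> \<open>m \<ge> N\<close>] by (intro power_mono) auto
        finally show ?thesis .
      qed
      then show "\<exists>N. \<forall>m\<ge>N. (\<Sum>k\<in>S. (cmod (hcoeff (X n) k - hcoeff (X m) k))\<^sup>2) \<le> e\<^sup>2"
        by blast
    qed
    then show ?thesis by blast
  qed
  have diff_summable: "(\<lambda>k. (cmod (hcoeff (X n) k - a k))\<^sup>2) summable_on UNIV"
    if "\<forall>S. finite S \<longrightarrow> (\<Sum>k\<in>S. (cmod (hcoeff (X n) k - a k))\<^sup>2) \<le> e\<^sup>2" for n e
    by (rule nonneg_bdd_above_summable_on) (use that in \<open>auto intro!: bdd_aboveI[where M = "e\<^sup>2"]\<close>)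
  obtain n where "\<forall>S. finite S \<longrightarrow> (\<Sum>k\<in>S. (cmod (hcoeff (X n) k - a k))\<^sup>2) \<le> 1\<^sup>2"
    using bnd[of 1] by auto
  \<comment> \<open>The limit is \<open>X n\<close> minus a square-summable difference, hence itself
    square-summable.\<close>
  from square_summable_add[OF hcoeff_summable[of "X n"], of "\<lambda>k. - (hcoeff (X n) k - a k)"]
    diff_summable[OF this]
  have "(\<lambda>k. (cmod (a k))\<^sup>2) summable_on UNIV"
    by (simp add: norm_minus_commute)
  then have hc: "hcoeff (Abs_hardy2 a) = a"
    by (simp add: Abs_hardy2_inverse)
  have "X \<longlonglongrightarrow> Abs_hardy2 a"
  proof (rule LIMSEQ_I)
    fix e :: real assume "e > 0"
    then obtain N where
      N: "\<forall>n\<ge>N. \<forall>S. finite S \<longrightarrow> (\<Sum>k\<in>S. (cmod (hcoeff (X n) k - a k))\<^sup>2) \<le> (e/2)\<^sup>2"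
      using bnd[of "e/2"] by auto
    show "\<exists>N. \<forall>n\<ge>N. norm (X n - Abs_hardy2 a) < e"
    proof (intro exI allI impI)
      fix n assume "n \<ge> N"
      with N have b: "\<forall>S. finite S \<longrightarrow> (\<Sum>k\<in>S. (cmod (hcoeff (X n) k - a k))\<^sup>2) \<le> (e/2)\<^sup>2"
        by auto
      have "(norm (X n - Abs_hardy2 a))\<^sup>2 \<le> (e/2)\<^sup>2"
        unfolding norm_sq_infsum minus_hardy2.rep_eq hc
        by (rule infsum_le_finite_sums[OF diff_summable[OF b]]) (use b in auto)
      then have "norm (X n - Abs_hardy2 a) \<le> e/2"
        using \<open>e > 0\<close> by (simp add: power2_le_iff_abs_le)
      then show "norm (X n - Abs_hardy2 a) < e" using \<open>e > 0\<close> by simp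
    qed
  qed
  then show "convergent X" by (auto simp: convergent_def)
qed

instance hardy2 :: banach ..

section \<open>Closed subspaces and orthonormal families\<close>

lemma closure_hardy2_subspace:
  assumes "hardy2.subspace S" shows "hardy2.subspace (closure S)"
proof (rule hardy2.subspaceI)
  show "0 \<in> closure S"
    using assms closure_subset hardy2.subspace_0 by blast
  show "x + y \<in> closure S" if "x \<in> closure S" "y \<in> closure S" for x y
  proof -
    from that obtain X Y where "\<forall>n. X n \<in> S" "X \<longlonglongrightarrow> x" "\<forall>n. Y n \<in> S" "Y \<longlonglongrightarrow> y"
      unfolding closure_sequential by blast
    then show ?thesis
      unfolding closure_sequential
      by (intro exI[of _ "\<lambda>n. X n + Y n"]) (auto intro: tendsto_add hardy2.subspace_add[OF assms])
  qed
  show "cscale c x \<in> closure S" if "x \<in> closure S" for c x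
  proof -
    from that obtain X where "\<forall>n. X n \<in> S" "X \<longlonglongrightarrow> x"
      unfolding closure_sequential by blast
    then show ?thesis
      unfolding closure_sequential
      by (intro exI[of _ "\<lambda>n. cscale c (X n)"])
        (auto intro: bounded_linear.tendsto[OF bounded_linear_cscale] hardy2.subspace_scale[OF assms])
  qed
qed

text \<open>Orthonormality of the \<open>u n\<close> with \<open>n \<in> I\<close>; the other vectors are required to vanish.\<close>

definition ortho :: "nat set \<Rightarrow> (nat \<Rightarrow> hardy2) \<Rightarrow> bool" where
  "ortho I u \<longleftrightarrow> (\<forall>m n. cinner (u m) (u n) = (if m = n \<and> n \<in> I then 1 else 0))"

lemma orthoD: "ortho I u \<Longrightarrow> cinner (u m) (u n) = (if m = n \<and> n \<in> I then 1 else 0)"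
  by (simp add: ortho_def)

lemma norm_ortho: "ortho I u \<Longrightarrow> norm (u n) = (if n \<in> I then 1 else 0)"
proof -
  assume "ortho I u"
  then have "complex_of_real ((norm (u n))\<^sup>2) = complex_of_real (if n \<in> I then 1 else 0)"
    using orthoD[of I u n n] unfolding cinner_self by auto
  then have "(norm (u n))\<^sup>2 = (if n \<in> I then 1 else 0)"
    by (simp only: of_real_eq_iff)
  then show ?thesis
    by (metis norm_ge_zero one_power2 power2_eq_iff_nonneg zero_eq_power2 zero_le_one)
qed

lemma ortho_eq_0: "ortho I u \<Longrightarrow> n \<notin> I \<Longrightarrow> u n = 0"
  using norm_ortho[of I u n] by simp

lemma norm_sq_ortho_sum:
  assumes "ortho I u" "finite S" "\<And>n. n \<notin> I \<Longrightarrow> a n = 0"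
  shows "(norm (\<Sum>n\<in>S. cscale (a n) (u n)))\<^sup>2 = (\<Sum>n\<in>S. (cmod (a n))\<^sup>2)"
proof -
  have "cinner (\<Sum>n\<in>S. cscale (a n) (u n)) (\<Sum>n\<in>S. cscale (a n) (u n))
      = (\<Sum>m\<in>S. \<Sum>n\<in>S. if m = n then a n * cnj (a n) else 0)"
    unfolding cinner_sum_left cinner_sum_right
    by (intro sum.cong refl) (use assms in \<open>auto simp: cinner_simps orthoD[OF assms(1)]\<close>)
  also have "\<dots> = (\<Sum>n\<in>S. complex_of_real ((cmod (a n))\<^sup>2))"
    using assms(2) by (simp only: sum.delta complex_norm_square)(simp add: sum.delta)
  finally show ?thesis
    unfolding norm_sq_hardy2 by simp
qed

lemma ortho_bessel_sum:
  assumes "ortho I u" "finite S"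
  shows "(\<Sum>n\<in>S. (cmod (cinner F (u n)))\<^sup>2) \<le> (norm F)\<^sup>2"
proof -
  define s where "s = (\<Sum>n\<in>S. cscale (cinner F (u n)) (u n))"
  have z: "n \<notin> I \<Longrightarrow> cinner F (u n) = 0" for n
    using ortho_eq_0[OF assms(1)] by simp
  have "cinner F s = (\<Sum>n\<in>S. complex_of_real ((cmod (cinner F (u n)))\<^sup>2))"
    unfolding s_def cinner_sum_right complex_norm_square
    by (simp add: cinner_simps mult.commute)
  then have Fs: "cinner F s = complex_of_real (\<Sum>n\<in>S. (cmod (cinner F (u n)))\<^sup>2)" by simp
  have ss: "(norm s)\<^sup>2 = (\<Sum>n\<in>S. (cmod (cinner F (u n)))\<^sup>2)"
    unfolding s_def by (rule norm_sq_ortho_sum[OF assms z])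
  have "cinner (F - s) (F - s) = complex_of_real ((norm F)\<^sup>2 - (norm s)\<^sup>2)"
    by (simp add: cinner_diff_left cinner_diff_right cinner_commute[of s F] Fs)
      (simp add: cinner_self ss flip: of_real_power of_real_sum)
  then have "(norm (F - s))\<^sup>2 = (norm F)\<^sup>2 - (norm s)\<^sup>2"
    by (simp only: cinner_self of_real_eq_iff)
  moreover have "0 \<le> (norm (F - s))\<^sup>2" by simp
  ultimately show ?thesis using ss by simp
qed

lemma ortho_bessel:
  assumes "ortho I u"
  shows "summable (\<lambda>n. (cmod (cinner F (u n)))\<^sup>2)"
  by (rule summableI_nonneg_bounded[where x = "(norm F)\<^sup>2"])
   (auto simp: ortho_bessel_sum[OF assms])

lemma ortho_summable:
  assumes "ortho I u" "summable (\<lambda>n. (cmod (a n))\<^sup>2)"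
  shows "summable (\<lambda>n. cscale (a n) (u n))"
proof -
  \<comment> \<open>Coefficients off \<open>I\<close> multiply zero vectors; replacing them by 0
    makes Pythagoras exact for the partial sums.\<close>
  define b where "b = (\<lambda>n. if n \<in> I then a n else 0)"
  have eq: "(\<lambda>n. cscale (a n) (u n)) = (\<lambda>n. cscale (b n) (u n))"
    using ortho_eq_0[OF assms(1)] by (auto simp: b_def fun_eq_iff)
  have "summable (\<lambda>n. (cmod (b n))\<^sup>2)"
    by (rule summable_comparison_test'[OF assms(2)]) (auto simp: b_def)
  note sb = this[unfolded summable_Cauchy]
  show ?thesis unfolding eq summable_Cauchy
  proof (intro allI impI)
    fix e :: real assume "e > 0"
    then obtain N where N: "\<And>m n. m \<ge> N \<Longrightarrow> norm (\<Sum>k=m..<n. (cmod (b k))\<^sup>2) < e\<^sup>2"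
      using sb by (metis zero_less_power)
    have "norm (\<Sum>k=m..<n. cscale (b k) (u k)) < e" if "m \<ge> N" for m n
    proof -
      have "(norm (\<Sum>k=m..<n. cscale (b k) (u k)))\<^sup>2 < e\<^sup>2"
        using N[OF that, of n]
        by (subst norm_sq_ortho_sum[OF assms(1)]) (auto simp: b_def)
      then show ?thesis
        using \<open>e > 0\<close> by (simp add: power2_less_imp_less)
    qed
    then show "\<exists>N. \<forall>m\<ge>N. \<forall>n. norm (\<Sum>k=m..<n. cscale (b k) (u k)) < e" by blast
  qed
qed

lemma ortho_suminf_cinner:
  assumes "ortho I u" "summable (\<lambda>n. (cmod (a n))\<^sup>2)"
  shows "cinner (\<Sum>n. cscale (a n) (u n)) (u m) = (if m \<in> I then a m else 0)"
proof -
  have "(\<lambda>n. cinner (cscale (a n) (u n)) (u m)) sums cinner (\<Sum>n. cscale (a n) (u n)) (u m)"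
    by (rule bounded_linear.sums[OF bounded_linear_cinner_left summable_sums[OF ortho_summable[OF assms]]])
  moreover have "cinner (cscale (a n) (u n)) (u m) = (if n = m then (if m \<in> I then a m else 0) else 0)" for n
    by (auto simp: cinner_simps orthoD[OF assms(1)])
  ultimately show ?thesis
    using sums_single[of m "\<lambda>n. if m \<in> I then a m else 0"] by (auto dest!: sums_unique2)
qed

lemma ortho_suminf_norm:
  assumes "ortho I u" "summable (\<lambda>n. (cmod (a n))\<^sup>2)" "\<And>n. n \<notin> I \<Longrightarrow> a n = 0"
  shows "(\<lambda>n. (cmod (a n))\<^sup>2) sums (norm (\<Sum>n. cscale (a n) (u n)))\<^sup>2"
proof -
  have "(\<lambda>N. \<Sum>n<N. cscale (a n) (u n)) \<longlonglongrightarrow> (\<Sum>n. cscale (a n) (u n))"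
    using summable_sums[OF ortho_summable[OF assms(1,2)]] by (simp add: sums_def)
  then have "(\<lambda>N. (norm (\<Sum>n<N. cscale (a n) (u n)))\<^sup>2) \<longlonglongrightarrow> (norm (\<Sum>n. cscale (a n) (u n)))\<^sup>2"
    by (intro tendsto_intros)
  then show ?thesis
    by (subst (asm) norm_sq_ortho_sum[OF assms(1)]) (auto simp: sums_def assms(3))
qed

section \<open>Operators in Schmidt form\<close>

text \<open>Two candidates differ by a vector of \<open>M\<close> that is orthogonal to itself, so
  exhibiting one vector with the duality property settles the definite description. Every adjoint
  below is computed this way.\<close>

lemma adj_on_eqI:
  assumes "hardy2.subspace M" "g \<in> M" "\<And>h. h \<in> M \<Longrightarrow> cinner (T h) f = cinner h g"
  shows "adj_on M T f = g"
  unfolding adj_on_def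
proof (rule the_equality)
  fix g' assume g': "g' \<in> M \<and> (\<forall>h\<in>M. cinner (T h) f = cinner h g')"
  have d: "g' - g \<in> M"
    using assms g' hardy2.subspace_diff by blast
  then have "cinner (g' - g) g' = cinner (g' - g) g"
    using g' assms(3) by metis
  then have "cinner (g' - g) (g' - g) = 0" by (simp add: cinner_diff_right)
  then show "g' = g" by (simp add: cinner_self)
qed (use assms in auto)

lemma orthonormal_independent:
  assumes "finite B" "\<And>e e'. e \<in> B \<Longrightarrow> e' \<in> B \<Longrightarrow> cinner e e' = (if e = e' then 1 else 0)"
  shows "hardy2.independent B"
proof (rule hardy2.independent_if_scalars_zero[OF assms(1)])
  fix f x assume *: "(\<Sum>x\<in>B. cscale (f x) x) = 0" "x \<in> B"
  have "cinner (\<Sum>x\<in>B. cscale (f x) x) x = (\<Sum>y\<in>B. if y = x then f x else 0)"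
    unfolding cinner_sum_left by (intro sum.cong refl) (use assms(2) * in \<open>auto simp: cinner_simps\<close>)
  then show "f x = 0" using * assms(1) by simp
qed

text \<open>Completing the square. The choice \<open>c e = cinner w e\<close> gives Bessel's
  inequality; an arbitrary \<open>c\<close> compares \<open>w\<close> with any element of the
  span.\<close>

lemma norm_sq_diff_orthonormal_sum:
  assumes "finite F" "\<And>e e'. e \<in> F \<Longrightarrow> e' \<in> F \<Longrightarrow> cinner e e' = (if e = e' then 1 else 0)"
  shows "(norm (w - (\<Sum>e\<in>F. cscale (c e) e)))\<^sup>2
    = (norm w)\<^sup>2 + (\<Sum>e\<in>F. (cmod (c e - cinner w e))\<^sup>2) - (\<Sum>e\<in>F. (cmod (cinner w e))\<^sup>2)"
proof -
  define s where "s = (\<Sum>e\<in>F. cscale (c e) e)"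
  have ws: "cinner w s = (\<Sum>e\<in>F. cnj (c e) * cinner w e)"
    by (simp add: s_def cinner_sum_right cinner_simps)
  have sw: "cinner s w = (\<Sum>e\<in>F. c e * cnj (cinner w e))"
    unfolding cinner_commute[of s w] ws by simp
  have "cinner s s = (\<Sum>e\<in>F. \<Sum>e'\<in>F. if e = e' then c e * cnj (c e) else 0)"
    unfolding s_def cinner_sum_left cinner_sum_right
    by (intro sum.cong refl) (auto simp: cinner_simps assms(2))
  then have ss: "cinner s s = (\<Sum>e\<in>F. c e * cnj (c e))"
    using assms(1) by simp
  have "cinner (w - s) (w - s) = cinner w w + (\<Sum>e\<in>F. complex_of_real ((cmod (c e - cinner w e))\<^sup>2))
      - (\<Sum>e\<in>F. complex_of_real ((cmod (cinner w e))\<^sup>2))"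
    unfolding complex_norm_square cinner_diff_left cinner_diff_right ws sw ss
    by (simp add: algebra_simps sum.distrib sum_subtractf)
  also have "\<dots> = complex_of_real ((norm w)\<^sup>2 + (\<Sum>e\<in>F. (cmod (c e - cinner w e))\<^sup>2)
      - (\<Sum>e\<in>F. (cmod (cinner w e))\<^sup>2))"
    by (simp add: cinner_self)
  finally show ?thesis
    unfolding s_def by (simp only: cinner_self of_real_eq_iff)
qed

section \<open>Parseval's identity for an arbitrary orthonormal basis\<close>

lemma infsum_ennreal_SUP:
  fixes f :: "'a \<Rightarrow> ennreal"
  shows "infsum f A = (SUP F\<in>{F. finite F \<and> F \<subseteq> A}. sum f F)"
  by (rule nonneg_infsum_complete) simp

lemma infsum_suminf_swap_ennreal:
  fixes f :: "'a \<Rightarrow> nat \<Rightarrow> ennreal"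
  shows "(\<Sum>\<^sub>\<infinity>x\<in>B. \<Sum>n. f x n) = (\<Sum>n. \<Sum>\<^sub>\<infinity>x\<in>B. f x n)"
proof -
  have fin: "(\<Sum>\<^sub>\<infinity>x\<in>B. \<Sum>n<N. f x n) = (\<Sum>n<N. \<Sum>\<^sub>\<infinity>x\<in>B. f x n)" for N
  proof (induction N)
    case (Suc N)
    have "(\<Sum>\<^sub>\<infinity>x\<in>B. (\<Sum>n<N. f x n) + f x N) = (\<Sum>\<^sub>\<infinity>x\<in>B. \<Sum>n<N. f x n) + (\<Sum>\<^sub>\<infinity>x\<in>B. f x N)"
      by (rule infsum_add) (rule nonneg_summable_on_complete, simp)+
    then show ?case by (simp add: Suc)
  qed simp
  have "(\<Sum>\<^sub>\<infinity>x\<in>B. \<Sum>n. f x n) = (SUP F\<in>{F. finite F \<and> F \<subseteq> B}. \<Sum>n. \<Sum>x\<in>F. f x n)"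
    unfolding infsum_ennreal_SUP by (intro SUP_cong refl) (simp add: suminf_sum)
  also have "\<dots> = (SUP F\<in>{F. finite F \<and> F \<subseteq> B}. SUP N. \<Sum>n<N. \<Sum>x\<in>F. f x n)"
    by (simp add: suminf_eq_SUP)
  also have "\<dots> = (SUP N. SUP F\<in>{F. finite F \<and> F \<subseteq> B}. \<Sum>x\<in>F. \<Sum>n<N. f x n)"
    by (subst SUP_commute) (simp add: sum.swap[of _ "{..<_}"])
  also have "\<dots> = (SUP N. \<Sum>n<N. \<Sum>\<^sub>\<infinity>x\<in>B. f x n)"
    unfolding infsum_ennreal_SUP[symmetric] fin ..
  finally show ?thesis by (simp add: suminf_eq_SUP)
qed

text \<open>The basis inside \<open>hs_norm_sq\<close> is an arbitrary choice that comes without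
  enumeration, so the sum is a supremum over finite subsets: Bessel bounds it above, density of the
  span bounds it below.\<close>

lemma parseval:
  assumes "orthonormal_basis_on M B" "w \<in> M"
  shows "(\<Sum>\<^sub>\<infinity>e\<in>B. ennreal ((cmod (cinner e w))\<^sup>2)) = ennreal ((norm w)\<^sup>2)"
proof -
  have on: "\<And>e e'. e \<in> B \<Longrightarrow> e' \<in> B \<Longrightarrow> cinner e e' = (if e = e' then 1 else 0)"
    and cl: "closure (hardy2.span B) = M"
    using assms(1) by (auto simp: orthonormal_basis_on_def)
  have sw: "cmod (cinner e w) = cmod (cinner w e)" for e
    by (subst cinner_commute) simp
  have id: "(norm (w - (\<Sum>e\<in>F. cscale (c e) e)))\<^sup>2
    = (norm w)\<^sup>2 + (\<Sum>e\<in>F. (cmod (c e - cinner w e))\<^sup>2) - (\<Sum>e\<in>F. (cmod (cinner w e))\<^sup>2)"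
    if "finite F" "F \<subseteq> B" for F c
    using that by (intro norm_sq_diff_orthonormal_sum on) auto
  show ?thesis
    unfolding infsum_ennreal_SUP sw
  proof (rule antisym)
    show "(SUP F\<in>{F. finite F \<and> F \<subseteq> B}. \<Sum>e\<in>F. ennreal ((cmod (cinner w e))\<^sup>2)) \<le> ennreal ((norm w)\<^sup>2)"
    proof (rule SUP_least, clarify)
      fix F assume F: "finite F" "F \<subseteq> B"
      have "0 \<le> (norm (w - (\<Sum>e\<in>F. cscale (cinner w e) e)))\<^sup>2" by simp
      then show "(\<Sum>e\<in>F. ennreal ((cmod (cinner w e))\<^sup>2)) \<le> ennreal ((norm w)\<^sup>2)"
        unfolding id[OF F] by (subst sum_ennreal) (auto intro: ennreal_leI)
    qed
    show "ennreal ((norm w)\<^sup>2) \<le> (SUP F\<in>{F. finite F \<and> F \<subseteq> B}. \<Sum>e\<in>F. ennreal ((cmod (cinner w e))\<^sup>2))"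
      (is "_ \<le> ?S")
    proof (rule ennreal_le_epsilon)
      fix d :: real assume d: "d > 0"
      have "w \<in> closure (hardy2.span B)" using cl assms(2) by simp
      then obtain s where s: "s \<in> hardy2.span B" "dist s w < sqrt d"
        unfolding closure_approachable using d by (meson real_sqrt_gt_zero)
      then obtain F c where F: "finite F" "F \<subseteq> B" and sF: "s = (\<Sum>e\<in>F. cscale (c e) e)"
        unfolding hardy2.span_explicit by auto
      have "(norm (w - s))\<^sup>2 \<le> (sqrt d)\<^sup>2"
        using s(2) by (intro power_mono) (auto simp: dist_norm norm_minus_commute)
      then have "(norm w)\<^sup>2 \<le> (\<Sum>e\<in>F. (cmod (cinner w e))\<^sup>2) + d"
        using id[OF F, of c] d sum_nonneg[of F "\<lambda>e. (cmod (c e - cinner w e))\<^sup>2"] unfolding sF by simp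
      then have "ennreal ((norm w)\<^sup>2) \<le> ennreal ((\<Sum>e\<in>F. (cmod (cinner w e))\<^sup>2) + d)"
        by (rule ennreal_leI)
      also have "\<dots> = (\<Sum>e\<in>F. ennreal ((cmod (cinner w e))\<^sup>2)) + ennreal d"
        using d by (subst ennreal_plus) (auto intro: sum_nonneg simp: sum_ennreal)
      also have "\<dots> \<le> ?S + ennreal d"
        using F by (intro add_right_mono SUP_upper) auto
      finally show "ennreal ((norm w)\<^sup>2) \<le> ?S + ennreal d" .
    qed
  qed
qed

definition schmidt_op :: "(nat \<Rightarrow> complex) \<Rightarrow> (nat \<Rightarrow> hardy2) \<Rightarrow> (nat \<Rightarrow> hardy2) \<Rightarrow> hardy2 \<Rightarrow> hardy2" where
  "schmidt_op c u v F = (\<Sum>n. cscale (c n * cinner F (u n)) (v n))"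

text \<open>This is why norm limits of finite-rank operators are compact: a set that lies within
  every \<open>e\<close> of some compact set is totally bounded.\<close>

lemma compact_closure_if_approx_compact:
  fixes S :: "'a :: complete_space set"
  assumes "\<And>e. e > 0 \<Longrightarrow> \<exists>K. compact K \<and> (\<forall>x\<in>S. \<exists>y\<in>K. dist y x \<le> e)"
  shows "compact (closure S)"
  unfolding compact_eq_totally_bounded
proof (intro conjI allI impI)
  show "complete (closure S)" by (simp add: complete_eq_closed)
  fix e :: real assume "e > 0"
  then obtain K where K: "compact K" "\<forall>x\<in>S. \<exists>y\<in>K. dist y x \<le> e/4"
    using assms[of "e/4"] by auto
  from K(1) \<open>e > 0\<close> obtain k where k: "finite k" "K \<subseteq> (\<Union>x\<in>k. ball x (e/4))"
    unfolding compact_eq_totally_bounded by (meson divide_pos_pos zero_less_numeral)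
  have "closure S \<subseteq> (\<Union>x\<in>k. ball x e)"
  proof
    fix x assume "x \<in> closure S"
    then obtain y where y: "y \<in> S" "dist y x < e/4"
      using \<open>e > 0\<close> unfolding closure_approachable by (meson divide_pos_pos zero_less_numeral)
    with K(2) obtain z where z: "z \<in> K" "dist z y \<le> e/4" by auto
    with k(2) obtain t where t: "t \<in> k" "dist t z < e/4" by auto
    have "dist t x \<le> dist t z + dist z y + dist y x"
      using dist_triangle[of t x z] dist_triangle[of z x y] by simp
    also have "\<dots> < e" using y z t \<open>e > 0\<close> by simp
    finally show "x \<in> (\<Union>x\<in>k. ball x e)" using t by auto
  qed
  then show "\<exists>k. finite k \<and> closure S \<subseteq> (\<Union>x\<in>k. ball x e)" using k by blast
qed

text \<open>Provides the compact set containing the image of the unit ball under a finite-rank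
  truncation: one disc of multiples per vector, added one vector at a time.\<close>

lemma compact_coefficient_box:
  fixes N :: nat and v :: "nat \<Rightarrow> hardy2"
  shows "compact {\<Sum>n<N. cscale (a n) (v n) |a. \<forall>n. cmod (a n) \<le> K}"
proof (induction N)
  case 0
  have "finite {\<Sum>n<(0::nat). cscale (a n) (v n) |a. \<forall>n. cmod (a n) \<le> K}"
    by (rule finite_subset[of _ "{0}"]) auto
  then show ?case by (rule finite_imp_compact)
next
  case (Suc N)
  have "{\<Sum>n<Suc N. cscale (a n) (v n) |a. \<forall>n. cmod (a n) \<le> K}
    = {x + y |x y. x \<in> {\<Sum>n<N. cscale (a n) (v n) |a. \<forall>n. cmod (a n) \<le> K} \<and>
        y \<in> (\<lambda>b. cscale b (v N)) ` cball 0 K}" (is "?L = ?R")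
  proof
    show "?L \<subseteq> ?R"
    proof clarify
      fix a :: "nat \<Rightarrow> complex" assume "\<forall>n. cmod (a n) \<le> K"
      then show "\<exists>x y. (\<Sum>n<Suc N. cscale (a n) (v n)) = x + y \<and>
          x \<in> {\<Sum>n<N. cscale (a n) (v n) |a. \<forall>n. cmod (a n) \<le> K} \<and>
          y \<in> (\<lambda>b. cscale b (v N)) ` cball 0 K"
        by (intro exI[of _ "\<Sum>n<N. cscale (a n) (v n)"] exI[of _ "cscale (a N) (v N)"]) auto
    qed
    show "?R \<subseteq> ?L"
    proof clarify
      fix a :: "nat \<Rightarrow> complex" and b :: complex assume ab: "\<forall>n. cmod (a n) \<le> K" "b \<in> cball 0 K"
      have "(\<Sum>n<N. cscale (a n) (v n)) = (\<Sum>n<N. cscale ((a(N := b)) n) (v n))"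
        by (intro sum.cong) auto
      then show "\<exists>a'. (\<Sum>n<N. cscale (a n) (v n)) + cscale b (v N)
          = (\<Sum>n<Suc N. cscale (a' n) (v n)) \<and> (\<forall>n. cmod (a' n) \<le> K)"
        using ab by (intro exI[of _ "a(N := b)"]) auto
    qed
  qed
  moreover have "compact ((\<lambda>b. cscale b (v N)) ` cball 0 K)"
    by (intro compact_continuous_image compact_cball
        linear_continuous_on bounded_linear_cscale_left)
  ultimately show ?case
    by (simp only:) (rule compact_sums[OF Suc])
qed

text \<open>The vectors vanish exactly where \<open>c n = 0\<close>. The sequence may thus have zero
  terms, even all but finitely many, and these contribute no directions to the eigenspaces. The
  limit \<open>c0\<close> makes the operator compact.\<close>

locale schmidt =
  fixes M :: "hardy2 set" and c :: "nat \<Rightarrow> complex" and u v :: "nat \<Rightarrow> hardy2"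
  assumes subM: "hardy2.subspace M" and closedM: "closed M"
    and ou: "ortho {n. c n \<noteq> 0} u" and ov: "ortho {n. c n \<noteq> 0} v"
    and c0: "c \<longlonglongrightarrow> 0" and uM: "\<And>n. u n \<in> M" and vM: "\<And>n. v n \<in> M"
begin

lemma bound: "\<exists>K\<ge>0. \<forall>n. cmod (c n) \<le> K"
proof -
  have "Bseq c" using c0 convergentI convergent_imp_Bseq by blast
  then obtain K where "K > 0" "\<forall>n. cmod (c n) \<le> K" unfolding Bseq_def by blast
  then show ?thesis by (intro exI[of _ K]) simp
qed

lemma square_summable_coeff: "summable (\<lambda>n. (cmod (c n * cinner F (u n)))\<^sup>2)"
proof -
  obtain K where K: "K \<ge> 0" "\<And>n. cmod (c n) \<le> K" using bound by blast
  have "summable (\<lambda>n. K\<^sup>2 * (cmod (cinner F (u n)))\<^sup>2)"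
    by (intro summable_mult ortho_bessel[OF ou])
  then show ?thesis
    by (rule summable_comparison_test')
      (use K in \<open>auto simp: norm_mult power_mult_distrib intro!: mult_right_mono power_mono\<close>)
qed

lemma op_sums: "(\<lambda>n. cscale (c n * cinner F (u n)) (v n)) sums schmidt_op c u v F"
  unfolding schmidt_op_def
  by (rule summable_sums[OF ortho_summable[OF ov square_summable_coeff]])

lemma op_in: "schmidt_op c u v F \<in> M"
proof (rule closed_sequentially[OF closedM])
  show "(\<lambda>N. \<Sum>n<N. cscale (c n * cinner F (u n)) (v n)) \<longlonglongrightarrow> schmidt_op c u v F"
    using op_sums by (simp add: sums_def)
  show "(\<Sum>n<N. cscale (c n * cinner F (u n)) (v n)) \<in> M" for N
    by (intro hardy2.subspace_sum[OF subM] hardy2.subspace_scale[OF subM] vM)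
qed

lemma op_add: "schmidt_op c u v (F + G) = schmidt_op c u v F + schmidt_op c u v G"
proof (rule sums_unique2[OF op_sums])
  show "(\<lambda>n. cscale (c n * cinner (F + G) (u n)) (v n)) sums (schmidt_op c u v F + schmidt_op c u v G)"
    using sums_add[OF op_sums[of F] op_sums[of G]]
    by (simp add: cinner_simps distrib_left hardy2.scale_left_distrib)
qed

lemma op_scale: "schmidt_op c u v (cscale a F) = cscale a (schmidt_op c u v F)"
proof (rule sums_unique2[OF op_sums])
  show "(\<lambda>n. cscale (c n * cinner (cscale a F) (u n)) (v n)) sums cscale a (schmidt_op c u v F)"
    using bounded_linear.sums[OF bounded_linear_cscale[of a] op_sums[of F]]
    by (simp add: cinner_simps mult_ac)
qed

lemma norm_op_sums: "(\<lambda>n. (cmod (c n * cinner F (u n)))\<^sup>2) sums (norm (schmidt_op c u v F))\<^sup>2"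
  unfolding schmidt_op_def by (rule ortho_suminf_norm[OF ov square_summable_coeff]) simp

lemma norm_op_le:
  assumes "K \<ge> 0" "\<And>n. cmod (c n) \<le> K"
  shows "norm (schmidt_op c u v F) \<le> K * norm F"
proof -
  have "(norm (schmidt_op c u v F))\<^sup>2 \<le> K\<^sup>2 * (norm F)\<^sup>2"
  proof (rule LIMSEQ_le_const2[OF norm_op_sums[unfolded sums_def]], intro exI allI impI)
    fix N :: nat
    have "(\<Sum>n<N. (cmod (c n * cinner F (u n)))\<^sup>2) \<le> (\<Sum>n<N. K\<^sup>2 * (cmod (cinner F (u n)))\<^sup>2)"
      using assms by (intro sum_mono) (auto simp: norm_mult power_mult_distrib intro!: mult_right_mono power_mono)
    also have "\<dots> \<le> K\<^sup>2 * (norm F)\<^sup>2"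
      unfolding sum_distrib_left[symmetric]
      by (intro mult_left_mono ortho_bessel_sum[OF ou]) auto
    finally show "(\<Sum>n<N. (cmod (c n * cinner F (u n)))\<^sup>2) \<le> K\<^sup>2 * (norm F)\<^sup>2" .
  qed
  then show ?thesis
    using assms(1) by (simp flip: power_mult_distrib)
qed

lemma cinner_op_sums: "(\<lambda>n. c n * cinner F (u n) * cinner (v n) h) sums cinner (schmidt_op c u v F) h"
  using bounded_linear.sums[OF bounded_linear_cinner_left op_sums, of F h]
  by (simp add: cinner_simps)

lemma cinner_op: "cinner (schmidt_op c u v F) (v m) = c m * cinner F (u m)"
  unfolding schmidt_op_def
  by (subst ortho_suminf_cinner[OF ov square_summable_coeff]) auto

lemma bounded_op:
  assumes T: "\<And>F. F \<in> M \<Longrightarrow> T F = schmidt_op c u v F"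
  shows "bounded_op_on M T"
proof -
  obtain K where K: "K \<ge> 0" "\<And>n. cmod (c n) \<le> K" using bound by blast
  show ?thesis
    unfolding bounded_op_on_def
    using T norm_op_le[OF K] op_in op_add op_scale
    by (auto simp: hardy2.subspace_add[OF subM] hardy2.subspace_scale[OF subM])
qed

lemma compact_op:
  assumes T: "\<And>F. F \<in> M \<Longrightarrow> T F = schmidt_op c u v F"
  shows "compact_op_on M T"
  unfolding compact_op_on_def
proof (intro conjI bounded_op[OF T] compact_closure_if_approx_compact)
  fix e :: real assume "e > 0"
  with c0 obtain N where N: "\<And>n. n \<ge> N \<Longrightarrow> cmod (c n) < e"
    by (auto simp: LIMSEQ_iff)
  obtain K where K: "K \<ge> 0" "\<And>n. cmod (c n) \<le> K" using bound by blast
  let ?K = "{\<Sum>n<N. cscale (a n) (v n) |a. \<forall>n. cmod (a n) \<le> K}"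
  \<comment> \<open>The tail from \<open>N\<close> on is again in Schmidt form with coefficients of
    modulus at most \<open>e\<close>, so the truncation is within \<open>e\<close> of the operator
    on the unit ball.\<close>
  define c' where "c' = (\<lambda>n. if n < N then 0 else c n)"
  define u' where "u' = (\<lambda>n. if n < N then 0 else u n)"
  define v' where "v' = (\<lambda>n. if n < N then 0 else v n)"
  interpret c': schmidt M c' u' v'
  proof
    show "ortho {n. c' n \<noteq> 0} u'" "ortho {n. c' n \<noteq> 0} v'"
      using ou ov by (auto simp: ortho_def c'_def u'_def v'_def)
    have "\<forall>\<^sub>F n in sequentially. c n = c' n"
      using eventually_ge_at_top[of N] by eventually_elim (auto simp: c'_def)
    then show "c' \<longlonglongrightarrow> 0"
      using c0 by (rule Lim_transform_eventually[rotated])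
  qed (use subM closedM uM vM in \<open>auto simp: u'_def v'_def hardy2.subspace_0\<close>)
  have c'e: "cmod (c' n) \<le> e" for n
    using N[of n] \<open>e > 0\<close> by (auto simp: c'_def)
  show "\<exists>K. compact K \<and> (\<forall>x\<in>T ` {f \<in> M. norm f \<le> 1}. \<exists>y\<in>K. dist y x \<le> e)"
  proof (intro exI[of _ ?K] conjI compact_coefficient_box ballI)
    fix x assume "x \<in> T ` {f \<in> M. norm f \<le> 1}"
    then obtain F where F: "F \<in> M" "norm F \<le> 1" "x = schmidt_op c u v F" using T by auto
    define y where "y = (\<Sum>n<N. cscale (c n * cinner F (u n)) (v n))"
    have "cmod (c n * cinner F (u n)) \<le> K" for n
    proof -
      have "cmod (cinner F (u n)) \<le> norm F * norm (u n)" by (rule cmod_cinner_le)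
      also have "\<dots> \<le> 1 * 1"
        using F norm_ortho[OF ou] by (intro mult_mono) auto
      finally have "cmod (c n) * cmod (cinner F (u n)) \<le> K * 1"
        using K by (intro mult_mono) auto
      then show ?thesis by (simp add: norm_mult)
    qed
    then have "y \<in> ?K" unfolding y_def by (intro CollectI exI[of _ "\<lambda>n. c n * cinner F (u n)"]) auto
    moreover have "dist y x \<le> e"
    proof -
      have "(\<lambda>n. cscale (c n * cinner F (u n)) (v n) - cscale (c' n * cinner F (u' n)) (v' n))
          sums (x - schmidt_op c' u' v' F)"
        unfolding F(3) by (rule sums_diff[OF op_sums c'.op_sums])
      moreover have "(\<lambda>n. cscale (c n * cinner F (u n)) (v n) - cscale (c' n * cinner F (u' n)) (v' n)) sums y"
      proof -
        have "(\<Sum>n<N. cscale (c n * cinner F (u n)) (v n) - cscale (c' n * cinner F (u' n)) (v' n)) = y"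
          unfolding y_def by (intro sum.cong) (auto simp: c'_def)
        then show ?thesis
          using sums_finite[of "{..<N}" "\<lambda>n. cscale (c n * cinner F (u n)) (v n) - cscale (c' n * cinner F (u' n)) (v' n)"]
          by (auto simp: c'_def u'_def v'_def)
      qed
      ultimately have "x - schmidt_op c' u' v' F = y" by (rule sums_unique2)
      then have "norm (y - x) = norm (schmidt_op c' u' v' F)"
        by (metis add_diff_cancel_left' diff_add_cancel norm_minus_commute)
      also have "\<dots> \<le> e * norm F"
        using \<open>e > 0\<close> by (intro c'.norm_op_le c'e) auto
      also have "\<dots> \<le> e" using \<open>e > 0\<close> F(2) by simp
      finally show ?thesis by (simp add: dist_norm)
    qed
    ultimately show "\<exists>y\<in>?K. dist y x \<le> e" by blast
  qed
qed

lemma adjoint: "schmidt M (\<lambda>n. cnj (c n)) v u"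
  using subM closedM ou ov c0 uM vM tendsto_cnj[OF c0] by unfold_locales auto

lemma adj_on_op:
  assumes T: "\<And>F. F \<in> M \<Longrightarrow> T F = schmidt_op c u v F"
  shows "adj_on M T f = schmidt_op (\<lambda>n. cnj (c n)) v u f"
proof (rule adj_on_eqI[OF subM])
  interpret a: schmidt M "\<lambda>n. cnj (c n)" v u by (rule adjoint)
  show "schmidt_op (\<lambda>n. cnj (c n)) v u f \<in> M" by (rule a.op_in)
  fix h assume "h \<in> M"
  have "(\<lambda>n. c n * cinner h (u n) * cinner (v n) f) sums cinner (T h) f"
    using cinner_op_sums T[OF \<open>h \<in> M\<close>] by simp
  moreover have "(\<lambda>n. cnj (cnj (c n) * cinner f (v n) * cinner (u n) h)) sums
      cnj (cinner (schmidt_op (\<lambda>n. cnj (c n)) v u f) h)"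
    by (rule sums_cnj[THEN iffD2, OF a.cinner_op_sums])
  moreover have "cnj (cnj (c n) * cinner f (v n) * cinner (u n) h) = c n * cinner h (u n) * cinner (v n) f" for n
    using cinner_commute[of "v n" f] cinner_commute[of h "u n"] by simp
  ultimately show "cinner (T h) f = cinner h (schmidt_op (\<lambda>n. cnj (c n)) v u f)"
    using sums_unique2 by (simp add: cinner_commute[of h] del: complex_cnj_mult) blast
qed

lemma square: "schmidt M (\<lambda>n. complex_of_real ((cmod (c n))\<^sup>2)) u u"
proof
  show "(\<lambda>n. complex_of_real ((cmod (c n))\<^sup>2)) \<longlonglongrightarrow> 0"
    using tendsto_of_real[OF tendsto_power[OF tendsto_norm[OF c0], of 2], where 'a = complex] by simp
qed (use subM closedM ou uM in auto)

text \<open>Orthonormality of \<open>v\<close> makes the product of the adjoint with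
  \<open>T\<close> diagonal in \<open>u\<close>.\<close>

lemma adj_on_op_op:
  assumes T: "\<And>F. F \<in> M \<Longrightarrow> T F = schmidt_op c u v F" and F: "F \<in> M"
  shows "adj_on M T (T F) = schmidt_op (\<lambda>n. complex_of_real ((cmod (c n))\<^sup>2)) u u F"
proof -
  have "adj_on M T (T F) = (\<Sum>n. cscale (cnj (c n) * (c n * cinner F (u n))) (u n))"
    by (subst adj_on_op) (simp_all add: T F schmidt_op_def[of "\<lambda>n. cnj (c n)"] cinner_op)
  then show ?thesis
    unfolding schmidt_op_def complex_norm_square by (simp add: mult_ac)
qed

lemma finite_level:
  assumes "a \<noteq> 0" shows "finite {n. c n = a}"
proof -
  obtain N where N: "\<And>n. n \<ge> N \<Longrightarrow> cmod (c n) < cmod a"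
    using c0 assms by (auto simp: LIMSEQ_iff) (metis zero_less_norm_iff)
  have "{n. c n = a} \<subseteq> {..<N}" using N by (force simp: not_less[symmetric])
  then show ?thesis using finite_subset by blast
qed

text \<open>Pairing the eigenvalue equation with \<open>u n\<close> kills every coefficient with
  \<open>c n \<noteq> a\<close>. The series for \<open>cscale a F\<close> becomes a finite sum, and
  \<open>a \<noteq> 0\<close> allows division.\<close>

lemma eigenspace:
  assumes uv: "u = v" and T: "\<And>F. F \<in> M \<Longrightarrow> T F = schmidt_op c u v F" and a: "a \<noteq> 0"
  shows "has_cdim (eigenspace_on M T a) (card {n. c n = a})"
proof -
  let ?A = "{n. c n = a}"
  have fin: "finite ?A" by (rule finite_level[OF a])
  have uu: "cinner (u m) (u n) = (if m = n then 1 else 0)" if "m \<in> ?A" "n \<in> ?A" for m n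
    using orthoD[OF ou, of m n] that a by auto
  have inj: "inj_on u ?A"
    by (rule inj_onI) (metis uu zero_neq_one)
  have Tu: "T (u m) = cscale (c m) (u m)" for m
  proof -
    have "cscale (c n * cinner (u m) (u n)) (u n) = (if n = m then cscale (c m) (u m) else 0)" for n
      by (auto simp: orthoD[OF ou])
    then have "(\<lambda>n. if n = m then cscale (c m) (u m) else 0) sums T (u m)"
      using op_sums[of "u m"] T[OF uM, of m] unfolding uv[symmetric] by simp
    then show ?thesis using sums_unique2 sums_single[of m "\<lambda>_. cscale (c m) (u m)"] by blast
  qed
  have sub: "hardy2.subspace (eigenspace_on M T a)"
    unfolding eigenspace_on_def
    using subM T op_add op_scale
    by (intro hardy2.subspaceI)
      (auto simp: hardy2.subspace_0 hardy2.subspace_add hardy2.subspace_scale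
        hardy2.scale_right_distrib mult.commute op_scale[of 0, simplified])
  have "eigenspace_on M T a = hardy2.span (u ` ?A)"
  proof
    show "hardy2.span (u ` ?A) \<subseteq> eigenspace_on M T a"
      by (rule hardy2.span_minimal[OF _ sub]) (auto simp: eigenspace_on_def uM Tu)
    show "eigenspace_on M T a \<subseteq> hardy2.span (u ` ?A)"
    proof
      fix F assume "F \<in> eigenspace_on M T a"
      then have F: "F \<in> M" "schmidt_op c u v F = cscale a F"
        using T by (auto simp: eigenspace_on_def)
      have "c n * cinner F (u n) = a * cinner F (u n)" for n
        using cinner_op[of F n, unfolded F(2)] unfolding uv by (auto simp: cinner_simps)
      then have z: "n \<notin> ?A \<Longrightarrow> cinner F (u n) = 0" for n
        by auto
      have "(\<lambda>n. cscale (c n * cinner F (u n)) (v n)) sums (\<Sum>n\<in>?A. cscale (c n * cinner F (u n)) (v n))"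
        by (rule sums_finite[OF fin]) (use z in auto)
      then have "cscale a F = (\<Sum>n\<in>?A. cscale (c n * cinner F (u n)) (v n))"
        using sums_unique2[OF op_sums[of F]] F(2) by simp
      then have "cscale a F \<in> hardy2.span (u ` ?A)"
        unfolding uv by (simp only:) (intro hardy2.span_sum hardy2.span_scale hardy2.span_base imageI)
      then have "cscale (1 / a) (cscale a F) \<in> hardy2.span (u ` ?A)"
        by (rule hardy2.span_scale)
      then show "F \<in> hardy2.span (u ` ?A)" using a by simp
    qed
  qed
  moreover have "hardy2.independent (u ` ?A)"
  proof (rule orthonormal_independent)
    fix e e' assume "e \<in> u ` ?A" "e' \<in> u ` ?A"
    then obtain m n where "m \<in> ?A" "n \<in> ?A" "e = u m" "e' = u n" by blast
    then show "cinner e e' = (if e = e' then 1 else 0)"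
      using uu[of m n] inj by (auto simp: inj_on_eq_iff)
  qed (use fin in simp)
  ultimately show ?thesis
    unfolding has_cdim_def using fin card_image[OF inj] by (intro exI[of _ "u ` ?A"]) auto
qed

lemma eigenvalues:
  assumes "u = v" "\<And>F. F \<in> M \<Longrightarrow> T F = schmidt_op c u v F"
  shows "lists_nonzero_eigenvalues M T c"
  unfolding lists_nonzero_eigenvalues_def using eigenspace[OF assms] finite_level by blast

lemma singular_values:
  assumes T: "\<And>F. F \<in> M \<Longrightarrow> T F = schmidt_op c u v F"
  shows "lists_nonzero_singular_values M T (\<lambda>n. cmod (c n))"
  unfolding lists_nonzero_singular_values_def
proof (intro conjI compact_op[OF T] allI impI)
  interpret s: schmidt M "\<lambda>n. complex_of_real ((cmod (c n))\<^sup>2)" u u by (rule square)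
  fix t :: real assume t: "t > 0"
  have eq: "{n. complex_of_real ((cmod (c n))\<^sup>2) = complex_of_real (t\<^sup>2)} = {n. cmod (c n) = t}"
    using t by (simp only: of_real_eq_iff) (auto simp: power2_eq_iff_nonneg)
  show "finite {n. cmod (c n) = t}"
    using s.finite_level[of "complex_of_real (t\<^sup>2)"] t unfolding eq by simp
  show "has_cdim (eigenspace_on M (\<lambda>f. adj_on M T (T f)) (complex_of_real (t\<^sup>2))) (card {n. cmod (c n) = t})"
    using s.eigenspace[OF refl adj_on_op_op[OF T], of "complex_of_real (t\<^sup>2)"] t
    unfolding eq by simp
qed

text \<open>A double sum over basis and index is summed over the basis first, where Parseval yields
  the norms of the \<open>u n\<close>. The result does not see the basis, but one must exist for the
  choice in \<open>hs_norm_sq\<close> to be a basis.\<close>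

lemma hs_norm:
  assumes T: "\<And>F. F \<in> M \<Longrightarrow> T F = schmidt_op c u v F" and ex: "orthonormal_basis_on M B0"
  shows "hs_norm_sq M T = (\<Sum>n. ennreal ((cmod (c n))\<^sup>2))"
proof -
  define B where "B = (SOME B. orthonormal_basis_on M B)"
  have B: "orthonormal_basis_on M B"
    unfolding B_def using ex by (rule someI)
  have BM: "B \<subseteq> M"
    using B hardy2.span_superset closure_subset unfolding orthonormal_basis_on_def by blast
  have "hs_norm_sq M T = (\<Sum>\<^sub>\<infinity>e\<in>B. \<Sum>n. ennreal ((cmod (c n))\<^sup>2) * ennreal ((cmod (cinner e (u n)))\<^sup>2))"
    unfolding hs_norm_sq_def B_def[symmetric]
  proof (rule infsum_cong)
    fix e assume "e \<in> B"
    then have "T e = schmidt_op c u v e" using BM T by blast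
    then have "ennreal ((norm (T e))\<^sup>2) = (\<Sum>n. ennreal ((cmod (c n * cinner e (u n)))\<^sup>2))"
      by (simp only:) (rule suminf_ennreal_eq[OF _ norm_op_sums, symmetric], rule zero_le_power2)
    then show "ennreal ((norm (T e))\<^sup>2) = (\<Sum>n. ennreal ((cmod (c n))\<^sup>2) * ennreal ((cmod (cinner e (u n)))\<^sup>2))"
      by (simp add: norm_mult power_mult_distrib ennreal_mult)
  qed
  also have "\<dots> = (\<Sum>n. \<Sum>\<^sub>\<infinity>e\<in>B. ennreal ((cmod (c n))\<^sup>2) * ennreal ((cmod (cinner e (u n)))\<^sup>2))"
    by (rule infsum_suminf_swap_ennreal)
  also have "\<dots> = (\<Sum>n. ennreal ((cmod (c n))\<^sup>2) * ennreal ((norm (u n))\<^sup>2))"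
    unfolding parseval[OF B uM, symmetric] infsum_ennreal_SUP SUP_mult_left_ennreal sum_distrib_left ..
  \<comment> \<open>Where \<open>u n\<close> is 0, the factor \<open>c n\<close> is 0 as
    well.\<close>
  also have "\<dots> = (\<Sum>n. ennreal ((cmod (c n))\<^sup>2))"
    by (intro suminf_cong) (auto simp: norm_ortho[OF ou])
  finally show ?thesis .
qed

end

section \<open>Decreasing rearrangement of singular values\<close>

text \<open>Level sets of distinct values are disjoint, so bijections chosen level by level glue
  together.\<close>

lemma level_bijection:
  fixes a b :: "nat \<Rightarrow> real"
  assumes "\<And>x. x > 0 \<Longrightarrow> finite {n. a n = x} \<and> finite {n. b n = x} \<and> card {n. a n = x} = card {n. b n = x}"
  obtains h where "bij_betw h {n. a n > 0} {n. b n > 0}" "\<And>n. a n > 0 \<Longrightarrow> b (h n) = a n"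
proof -
  have "\<exists>g. bij_betw g {n. a n = x} {n. b n = x}" if "x > 0" for x
    using assms[OF that] finite_same_card_bij by blast
  then obtain g where g: "\<And>x. x > 0 \<Longrightarrow> bij_betw (g x) {n. a n = x} {n. b n = x}"
    by metis
  define h where "h = (\<lambda>n. g (a n) n)"
  have h: "b (h n) = a n" if "a n > 0" for n
    using bij_betwE[OF g[OF that]] by (auto simp: h_def)
  have "bij_betw h {n. a n > 0} {n. b n > 0}"
    unfolding bij_betw_def
  proof
    show "inj_on h {n. a n > 0}"
    proof (rule inj_onI)
      fix m n assume mn: "m \<in> {n. a n > 0}" "n \<in> {n. a n > 0}" "h m = h n"
      then have "a m = a n" using h by (metis mem_Collect_eq)
      then show "m = n"
        using mn bij_betw_imp_inj_on[OF g[of "a n"]] by (auto simp: h_def inj_on_def)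
    qed
    show "h ` {n. a n > 0} = {n. b n > 0}"
    proof
      show "h ` {n. a n > 0} \<subseteq> {n. b n > 0}" using h by auto
      show "{n. b n > 0} \<subseteq> h ` {n. a n > 0}"
      proof
        fix n assume "n \<in> {n. b n > 0}"
        then have "b n > 0" by simp
        have "n \<in> g (b n) ` {m. a m = b n}"
          unfolding bij_betw_imp_surj_on[OF g[OF \<open>b n > 0\<close>]] by simp
        then obtain m where "n = g (b n) m" "m \<in> {m. a m = b n}" by (rule imageE)
        then have "a m = b n" "g (b n) m = n" by simp_all
        then show "n \<in> h ` {n. a n > 0}"
          using \<open>b n > 0\<close> by (auto simp: h_def intro!: image_eqI[of _ _ m])
      qed
    qed
  qed
  with h that show ?thesis by blast
qed

text \<open>The sets \<open>{n. s n \<ge> x}\<close> of a decreasing sequence are initial segments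
  once they are finite, hence determined by their size. The glued bijection shows that the sizes
  agree, and carries finiteness from \<open>t\<close>, which tends to 0, over to
  \<open>s\<close>.\<close>

lemma decseq_eq_if_level_cards_eq:
  fixes s t :: "nat \<Rightarrow> real"
  assumes s: "decseq s" "\<And>j. 0 \<le> s j" and t: "decseq t" "\<And>j. 0 \<le> t j" "t \<longlonglongrightarrow> 0"
    and lev: "\<And>x. x > 0 \<Longrightarrow> finite {n. s n = x} \<and> finite {n. t n = x} \<and> card {n. s n = x} = card {n. t n = x}"
  shows "s = t"
proof -
  obtain h where h: "bij_betw h {n. s n > 0} {n. t n > 0}" "\<And>n. s n > 0 \<Longrightarrow> t (h n) = s n"
    using level_bijection[OF lev] by blast
  have initial: "\<exists>N. {n. r n \<ge> x} = {..<N}" if r: "decseq r" "finite {n. r n \<ge> x}" for r :: "nat \<Rightarrow> real" and x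
  proof -
    obtain N where N: "r N < x"
      using ex_new_if_finite[OF infinite_UNIV_nat r(2)] by (auto simp: not_le)
    define L where "L = (LEAST N. r N < x)"
    have "r L < x" unfolding L_def using N by (rule LeastI)
    then have "{n. r n \<ge> x} = {..<L}"
      using r(1) not_less_Least[of _ "\<lambda>N. r N < x"]
      by (auto simp: L_def[symmetric] not_less decseq_def) (meson leD leI order.strict_trans1)
    then show ?thesis by blast
  qed
  have eq: "{n. s n \<ge> x} = {n. t n \<ge> x}" if "x > 0" for x
  proof -
    have fin: "finite {n. t n \<ge> x}"
    proof -
      obtain N where "\<And>n. n \<ge> N \<Longrightarrow> t n < x"
        using order_tendstoD(2)[OF t(3), of x] \<open>x > 0\<close> unfolding eventually_sequentially by blast
      then have "{n. t n \<ge> x} \<subseteq> {..<N}" by (force simp: not_less[symmetric])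
      then show ?thesis using finite_subset by blast
    qed
    have "bij_betw h {n. s n \<ge> x} {n. t n \<ge> x}"
    proof (rule bij_betw_subset[OF h(1)])
      show "{n. s n \<ge> x} \<subseteq> {n. s n > 0}" using that by auto
      show "h ` {n. s n \<ge> x} = {n. t n \<ge> x}"
      proof
        show "h ` {n. s n \<ge> x} \<subseteq> {n. t n \<ge> x}" using h(2) that by fastforce
        show "{n. t n \<ge> x} \<subseteq> h ` {n. s n \<ge> x}"
        proof
          fix n assume n: "n \<in> {n. t n \<ge> x}"
          then have "n \<in> {n. t n > 0}" using that by simp
          then have "n \<in> h ` {n. s n > 0}" using bij_betw_imp_surj_on[OF h(1)] by simp
          then obtain m where "s m > 0" "h m = n" by auto
          then show "n \<in> h ` {n. s n \<ge> x}" using h(2)[of m] n by auto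
        qed
      qed
    qed
    then have "finite {n. s n \<ge> x}" "card {n. s n \<ge> x} = card {n. t n \<ge> x}"
      using fin bij_betw_finite[of h] bij_betw_same_card[of h] by simp_all
    moreover from this obtain K L where "{n. s n \<ge> x} = {..<K}" "{n. t n \<ge> x} = {..<L}"
      using initial[OF s(1), of x] initial[OF t(1) fin] by blast
    ultimately show ?thesis by simp
  qed
  show ?thesis
  proof (rule ext, rule antisym)
    fix n
    show "s n \<le> t n" using eq[of "s n"] s(2)[of n] t(2)[of n] by (cases "s n > 0") auto
    show "t n \<le> s n" using eq[of "t n"] s(2)[of n] t(2)[of n] by (cases "t n > 0") auto
  qed
qed

text \<open>Greedy selection: remove an index with maximal value at each step.\<close>

lemma decreasing_rearrangement_exists:
  fixes a :: "nat \<Rightarrow> real"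
  assumes a: "\<And>n. 0 \<le> a n" "a \<longlonglongrightarrow> 0"
  obtains s where "decseq s" "\<And>j. 0 \<le> s j" "s \<longlonglongrightarrow> 0"
    "\<And>x. x > 0 \<Longrightarrow> finite {n. s n = x} \<and> card {n. s n = x} = card {n. a n = x}"
proof -
  have fin: "finite {n. a n \<ge> x}" if "x > 0" for x
  proof -
    obtain N where "\<And>n. n \<ge> N \<Longrightarrow> a n < x"
      using order_tendstoD(2)[OF a(2), of x] \<open>x > 0\<close> unfolding eventually_sequentially by blast
    then have "{n. a n \<ge> x} \<subseteq> {..<N}" by (force simp: not_less[symmetric])
    then show ?thesis using finite_subset by blast
  qed
  \<comment> \<open>Only finitely many indices reach the value at \<open>k\<close>, so the maximum
    over \<open>S\<close> is attained even if \<open>S\<close> is infinite.\<close>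
  have mx: "\<exists>n\<in>S. \<forall>m\<in>S. a m \<le> a n" if S: "S \<noteq> {}" "S \<subseteq> {n. a n > 0}" for S
  proof -
    obtain k where k: "k \<in> S" using S by blast
    let ?F = "{n\<in>S. a n \<ge> a k}"
    have F: "finite ?F" "?F \<noteq> {}" using fin[of "a k"] S k by auto
    from F have "Max (a ` ?F) \<in> a ` ?F" by (intro Max_in) auto
    then obtain n where "n \<in> ?F" "a n = Max (a ` ?F)" by force
    moreover have "\<forall>m\<in>?F. a m \<le> Max (a ` ?F)" using F(1) by auto
    ultimately have "n \<in> S" "\<forall>m\<in>?F. a m \<le> a n" "a n \<ge> a k" by auto
    then show ?thesis by (intro bexI[of _ n]) force+
  qed
  define pick where "pick = (\<lambda>S. SOME n. n \<in> S \<and> (\<forall>m\<in>S. a m \<le> a n))"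
  have pick: "pick S \<in> S" "\<And>m. m \<in> S \<Longrightarrow> a m \<le> a (pick S)" if "S \<noteq> {}" "S \<subseteq> {n. a n > 0}" for S
  proof -
    have "\<exists>n. n \<in> S \<and> (\<forall>m\<in>S. a m \<le> a n)" using mx[OF that] by blast
    from someI_ex[OF this] show "pick S \<in> S" "\<And>m. m \<in> S \<Longrightarrow> a m \<le> a (pick S)"
      unfolding pick_def by auto
  qed
  \<comment> \<open>\<open>R j\<close> holds the indices left after \<open>j\<close> picks. Once it
    is empty, \<open>s\<close> takes the default value 0.\<close>
  define R where "R = (\<lambda>j. ((\<lambda>S. S - {pick S}) ^^ j) {n. a n > 0})"
  have R0: "R 0 = {n. a n > 0}" and RS: "R (Suc j) = R j - {pick (R j)}" for j
    by (auto simp: R_def)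
  have Rdec: "R k \<subseteq> R j" if "j \<le> k" for j k
    using that by (induction k rule: dec_induct) (auto simp: RS)
  have Rsub: "R j \<subseteq> {n. a n > 0}" for j using Rdec[of 0 j] R0 by simp
  define s where "s = (\<lambda>j. if R j = {} then 0 else a (pick (R j)))"
  define J where "J = {j. R j \<noteq> {}}"
  have s0: "0 \<le> s j" for j using a by (simp add: s_def)
  have spos: "s j > 0 \<longleftrightarrow> j \<in> J" for j
    using pick(1)[of "R j"] Rsub[of j] by (auto simp: s_def J_def)
  have dec: "decseq s"
  proof (rule decseq_SucI)
    fix j show "s (Suc j) \<le> s j"
    proof (cases "R (Suc j) = {}")
      case False
      then have "pick (R (Suc j)) \<in> R j" using pick(1)[OF False Rsub] RS by auto
      then have "R j \<noteq> {}" "a (pick (R (Suc j))) \<le> a (pick (R j))"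
        using pick(2)[of "R j"] Rsub[of j] by auto
      then show ?thesis using False by (simp add: s_def)
    qed (simp add: s_def[of] s0[unfolded s_def] a)
  qed
  have inj: "inj_on (\<lambda>j. pick (R j)) J"
  proof -
    have "pick (R j) \<noteq> pick (R k)" if "j < k" "k \<in> J" for j k
      using pick(1)[of "R k"] Rsub[of k] Rdec[of "Suc j" k] that RS[of j] by (auto simp: J_def)
    note ne = this
    show ?thesis
    proof (rule inj_onI)
      fix j k assume "j \<in> J" "k \<in> J" "pick (R j) = pick (R k)"
      then show "j = k" using ne[of j k] ne[of k j] by (cases j k rule: linorder_cases) auto
    qed
  qed
  have surj: "(\<lambda>j. pick (R j)) ` J = {n. a n > 0}"
  proof
    show "(\<lambda>j. pick (R j)) ` J \<subseteq> {n. a n > 0}"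
    proof (rule image_subsetI)
      fix j assume "j \<in> J"
      then show "pick (R j) \<in> {n. a n > 0}"
        using pick(1)[of "R j"] Rsub[of j] by (auto simp: J_def)
    qed
    show "{n. a n > 0} \<subseteq> (\<lambda>j. pick (R j)) ` J"
    \<comment> \<open>An index that is never picked keeps every \<open>R j\<close> non-empty; the
      picks are then infinitely many indices with values at least \<open>a n\<close>, contradicting
      finiteness.\<close>
    proof (rule ccontr)
      assume "\<not> ?thesis"
      then obtain n where n: "a n > 0" "n \<notin> (\<lambda>j. pick (R j)) ` J" by auto
      have "n \<in> R j" for j
        by (induction j) (use n in \<open>auto simp: R0 RS J_def\<close>)
      then have ne: "R j \<noteq> {}" for j by blast
      then have "J = UNIV" by (simp add: J_def)
      moreover have "a n \<le> a (pick (R j))" for j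
        by (rule pick(2)[OF ne Rsub]) fact
      ultimately have "range (\<lambda>j. pick (R j)) \<subseteq> {m. a m \<ge> a n}" "inj (\<lambda>j. pick (R j))" using inj by auto
      then show False
        using fin[OF n(1)] by (meson finite_subset range_inj_infinite)
    qed
  qed
  have lev: "bij_betw (\<lambda>j. pick (R j)) {j. s j = x} {n. a n = x}" if "x > 0" for x
  proof (rule bij_betw_subset[where A = J and A' = "{n. a n > 0}"])
    show "bij_betw (\<lambda>j. pick (R j)) J {n. a n > 0}" using inj surj by (simp add: bij_betw_def)
    show "{j. s j = x} \<subseteq> J" using spos that by auto
    show "(\<lambda>j. pick (R j)) ` {j. s j = x} = {n. a n = x}"
    proof
      show "(\<lambda>j. pick (R j)) ` {j. s j = x} \<subseteq> {n. a n = x}" using that by (auto simp: s_def split: if_splits)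
      show "{n. a n = x} \<subseteq> (\<lambda>j. pick (R j)) ` {j. s j = x}"
      proof
        fix n assume "n \<in> {n. a n = x}"
        then have "n \<in> (\<lambda>j. pick (R j)) ` J" "a n = x" unfolding surj using that by auto
        then show "n \<in> (\<lambda>j. pick (R j)) ` {j. s j = x}" by (auto simp: s_def J_def)
      qed
    qed
  qed
  have lim: "s \<longlonglongrightarrow> 0"
  proof (rule LIMSEQ_I)
    fix e :: real assume "e > 0"
    have "\<exists>N. s N < e"
    proof (rule ccontr)
      assume "\<not> ?thesis"
      then have ge: "s N \<ge> e" for N by (simp add: not_less)
      then have J: "J = UNIV" using spos \<open>e > 0\<close> by (metis UNIV_eq_I less_le_trans)
      then have "a (pick (R j)) = s j" for j by (auto simp: s_def J_def)
      then have "range (\<lambda>j. pick (R j)) \<subseteq> {m. a m \<ge> e}" "inj (\<lambda>j. pick (R j))"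
        using inj ge J by auto
      then show False
        using fin[OF \<open>e > 0\<close>] by (meson finite_subset range_inj_infinite)
    qed
    then obtain N where "s N < e" by blast
    then show "\<exists>N. \<forall>n\<ge>N. norm (s n - 0) < e"
      using s0 decseqD[OF dec] by (intro exI[of _ N]) (auto simp: intro: le_less_trans)
  qed
  show ?thesis
  proof (rule that[OF dec s0 lim])
    fix x :: real assume x: "x > 0"
    have "finite {n. a n = x}" by (rule finite_subset[OF _ fin[OF x]]) auto
    then show "finite {n. s n = x} \<and> card {n. s n = x} = card {n. a n = x}"
      using bij_betw_finite[OF lev[OF x]] bij_betw_same_card[OF lev[OF x]] by simp
  qed
qed

text \<open>Sums in \<open>ennreal\<close> are integrals for counting measure, which bijections
  transport; zero values drop out because \<open>\<phi> 0 = 0\<close>.\<close>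

lemma suminf_ennreal_level_cards_eq:
  fixes s a :: "nat \<Rightarrow> real" and \<phi> :: "real \<Rightarrow> ennreal"
  assumes "\<And>j. 0 \<le> s j" "\<And>n. 0 \<le> a n" "\<phi> 0 = 0"
    and lev: "\<And>x. x > 0 \<Longrightarrow> finite {n. s n = x} \<and> finite {n. a n = x} \<and> card {n. s n = x} = card {n. a n = x}"
  shows "(\<Sum>j. \<phi> (s j)) = (\<Sum>n. \<phi> (a n))"
proof -
  obtain h where h: "bij_betw h {n. s n > 0} {n. a n > 0}" "\<And>n. s n > 0 \<Longrightarrow> a (h n) = s n"
    using level_bijection[OF lev] by blast
  have supp: "(\<Sum>j. \<phi> (r j)) = (\<integral>\<^sup>+j. \<phi> (r j) \<partial>count_space {j. r j > 0})" if "\<And>j. 0 \<le> r j" for r :: "nat \<Rightarrow> real"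
  proof -
    have "(\<Sum>j. \<phi> (r j)) = (\<integral>\<^sup>+j. \<phi> (r j) \<partial>count_space UNIV)"
      by (rule nn_integral_count_space_nat[symmetric])
    also have "\<dots> = (\<integral>\<^sup>+j. \<phi> (r j) \<partial>count_space {j. r j > 0})"
    proof (rule nn_integral_count_space_eq)
      fix j assume "j \<in> UNIV - {j. r j > 0}"
      then have "r j = 0" using that[of j] by auto
      then show "\<phi> (r j) = 0" using assms(3) by simp
    qed auto
    finally show ?thesis .
  qed
  have "(\<Sum>j. \<phi> (s j)) = (\<integral>\<^sup>+j. \<phi> (a (h j)) \<partial>count_space {j. s j > 0})"
    unfolding supp[OF assms(1)] by (rule nn_integral_cong) (simp add: h(2))
  also have "\<dots> = (\<integral>\<^sup>+j. \<phi> (a j) \<partial>count_space {j. a j > 0})"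
    by (rule nn_integral_bij_count_space[OF h(1)])
  finally show ?thesis unfolding supp[OF assms(2)] .
qed

lemma has_cdim_unique: "has_cdim V m \<Longrightarrow> has_cdim V n \<Longrightarrow> m = n"
  unfolding has_cdim_def by (metis hardy2.dim_span_eq_card_independent)

text \<open>For the definite description \<open>singular_value\<close>, the decreasing rearrangement
  of \<open>a\<close> gives existence and comparison of level sets gives uniqueness. Afterwards an
  unordered list of singular values may be summed instead.\<close>

lemma suminf_singular_value:
  fixes \<phi> :: "real \<Rightarrow> ennreal"
  assumes a: "lists_nonzero_singular_values M T a" "\<And>n. 0 \<le> a n" "a \<longlonglongrightarrow> 0" and "\<phi> 0 = 0"
  shows "(\<Sum>j. \<phi> (singular_value M T j)) = (\<Sum>n. \<phi> (a n))"
proof -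
  obtain s where s: "decseq s" "\<And>j. 0 \<le> s j" "s \<longlonglongrightarrow> 0"
    "\<And>x. x > 0 \<Longrightarrow> finite {n. s n = x} \<and> card {n. s n = x} = card {n. a n = x}"
    using decreasing_rearrangement_exists[OF a(2,3)] by blast
  have ls: "lists_nonzero_singular_values M T s"
    using a(1) s(4) unfolding lists_nonzero_singular_values_def by auto
  have "singular_value M T = s"
    unfolding singular_value_def
  proof (rule the_equality)
    fix t assume t: "decseq t \<and> (\<forall>j. 0 \<le> t j) \<and> lists_nonzero_singular_values M T t"
    show "t = s"
    proof (rule decseq_eq_if_level_cards_eq[OF _ _ s(1,2,3)])
      fix x :: real assume "x > 0"
      then have "finite {n. t n = x}" "finite {n. s n = x}"
        and "has_cdim (eigenspace_on M (\<lambda>f. adj_on M T (T f)) (complex_of_real (x\<^sup>2))) (card {n. t n = x})"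
        and "has_cdim (eigenspace_on M (\<lambda>f. adj_on M T (T f)) (complex_of_real (x\<^sup>2))) (card {n. s n = x})"
        using t ls unfolding lists_nonzero_singular_values_def by simp_all
      then show "finite {n. t n = x} \<and> finite {n. s n = x} \<and> card {n. t n = x} = card {n. s n = x}"
        using has_cdim_unique by simp
    qed (use t in auto)
  qed (use s ls in auto)
  then show ?thesis
    using suminf_ennreal_level_cards_eq[OF s(2) a(2), of \<phi>] s(4) a(1) assms(4)
    unfolding lists_nonzero_singular_values_def by auto
qed

section \<open>Orthogonal polynomials on the unit circle\<close>

text \<open>Degree less than \<open>n\<close>, phrased so that \<open>below 0\<close> leaves only
  the zero polynomial. A condition on \<open>degree\<close>, which is 0 at the zero polynomial,
  would treat \<open>n = 0\<close> wrongly.\<close>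

definition below :: "nat \<Rightarrow> complex poly \<Rightarrow> bool" where
  "below n A \<longleftrightarrow> (\<forall>k\<ge>n. coeff A k = 0)"

lemma below_simps [simp]:
  "below n 0" "below 0 A \<longleftrightarrow> A = 0" "below (Suc n) (pCons c A) \<longleftrightarrow> below n A"
  by (auto simp: below_def poly_eq_iff coeff_pCons Suc_le_eq split: nat.splits)

lemma below_1: "below (Suc n) 1"
  by (simp add: below_def coeff_1)

lemma below_diff: "below n A \<Longrightarrow> below n B \<Longrightarrow> below n (A - B)"
  and below_smult: "below n A \<Longrightarrow> below n (smult c A)"
  by (auto simp: below_def)

lemma below_mono: "below m A \<Longrightarrow> m \<le> n \<Longrightarrow> below n A"
  by (auto simp: below_def)

lemma below_Suc_degree: "below (Suc n) A \<longleftrightarrow> degree A \<le> n"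
  by (auto simp: below_def Suc_le_eq intro: degree_le coeff_eq_0)

text \<open>The inner product of a probability measure on the circle, restricted to polynomials:
  \<open>ip_shift\<close> expresses |\<zeta>| = 1 and \<open>ip_1\<close> total mass 1. The
  recursion is thereby developed without integrals.\<close>

locale szego =
  fixes ip :: "complex poly \<Rightarrow> complex poly \<Rightarrow> complex"
  assumes ip_add_left: "ip (A + B) C = ip A C + ip B C"
    and ip_smult_left: "ip (smult c A) C = c * ip A C"
    and ip_commute: "ip A B = cnj (ip B A)"
    and ip_pos: "A \<noteq> 0 \<Longrightarrow> 0 < Re (ip A A)"
    and ip_shift: "ip (pCons 0 A) (pCons 0 B) = ip A B"
    and ip_1: "ip 1 1 = 1"
begin

lemma ip_add_right: "ip C (A + B) = ip C A + ip C B"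
  by (subst (1 2 3) ip_commute) (simp add: ip_add_left)

lemma ip_smult_right: "ip C (smult c A) = cnj c * ip C A"
  by (subst (1 2) ip_commute) (simp add: ip_smult_left)

lemma ip_diff_left: "ip (A - B) C = ip A C - ip B C"
  using ip_add_left[of A "smult (-1) B" C] ip_smult_left[of "-1" B C] by simp

lemma ip_diff_right: "ip C (A - B) = ip C A - ip C B"
  using ip_add_right[of C A "smult (-1) B"] ip_smult_right[of C "-1" B] by simp

lemma ip_0 [simp]: "ip 0 A = 0" "ip A 0 = 0"
  using ip_smult_left[of 0 0 A] ip_smult_right[of A 0 0] by auto

lemmas ip_simps = ip_add_left ip_add_right ip_diff_left ip_diff_right ip_smult_left ip_smult_right

text \<open>The components are \<open>\<phi>\<^sub>n\<close> and \<open>\<phi>\<^sub>n\<^sup>*\<close>.\<close>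

primrec szego_pair :: "nat \<Rightarrow> complex poly \<times> complex poly" where
  "szego_pair 0 = (1, 1)"
| "szego_pair (Suc n) = (let f = fst (szego_pair n); g = snd (szego_pair n); b = ip (pCons 0 f) g;
     r = complex_of_real (1 / sqrt (1 - (cmod b)\<^sup>2))
     in (smult r (pCons 0 f - smult b g), smult r (g - smult (cnj b) (pCons 0 f))))"

definition "phi n = fst (szego_pair n)"
definition "psi n = snd (szego_pair n)"
text \<open>Pairing the Szego recursion with \<open>psi n\<close> removes the term in
  \<open>phi (Suc n)\<close> and leaves this value.\<close>

definition "alpha n = cnj (ip (pCons 0 (phi n)) (psi n))"
definition "rho n = sqrt (1 - (cmod (alpha n))\<^sup>2)"

lemma phi_0 [simp]: "phi 0 = 1" and psi_0 [simp]: "psi 0 = 1"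
  by (simp_all add: phi_def psi_def)

lemma phi_Suc: "phi (Suc n) = smult (complex_of_real (1 / rho n)) (pCons 0 (phi n) - smult (cnj (alpha n)) (psi n))"
  and psi_Suc: "psi (Suc n) = smult (complex_of_real (1 / rho n)) (psi n - smult (alpha n) (pCons 0 (phi n)))"
  by (simp_all add: phi_def psi_def alpha_def rho_def Let_def)

text \<open>\<open>1 - |alpha n|^2\<close> is the squared norm of the unnormalised next polynomial,
  which is non-zero by its top coefficient. The hypotheses are spelled out because the bound is used
  inside the induction that proves them.\<close>

lemma alpha_less_1_aux:
  assumes "below (Suc n) (psi n)" "coeff (phi n) n \<noteq> 0" "ip (phi n) (phi n) = 1" "ip (psi n) (psi n) = 1"
  shows "cmod (alpha n) < 1"
proof -
  define B where "B = pCons 0 (phi n) - smult (cnj (alpha n)) (psi n)"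
  have "coeff B (Suc n) = coeff (phi n) n"
    using assms by (simp add: B_def below_def)
  then have "B \<noteq> 0" using assms by auto
  have "ip (psi n) (pCons 0 (phi n)) = alpha n"
    by (subst ip_commute) (simp add: alpha_def)
  moreover have "ip (pCons 0 (phi n)) (psi n) = cnj (alpha n)" by (simp add: alpha_def)
  ultimately have "ip B B = 1 - alpha n * cnj (alpha n)"
    using assms by (simp add: B_def ip_diff_left ip_diff_right ip_smult_left ip_smult_right ip_shift)
  also have "\<dots> = complex_of_real (1 - (cmod (alpha n))\<^sup>2)"
    using complex_norm_square[of "alpha n"] by simp
  finally have "0 < 1 - (cmod (alpha n))\<^sup>2"
    using ip_pos[OF \<open>B \<noteq> 0\<close>] by simp
  then show ?thesis by (simp add: abs_square_less_1)
qed

text \<open>The clauses depend on each other and go through one induction. The leading coefficient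
  of \<open>phi n\<close> equals the constant coefficient of \<open>psi n\<close> because each step
  divides both by \<open>rho n\<close>; being non-zero, they can be used to strip coefficients from
  other polynomials.\<close>

lemma szego_invariant:
  "below (Suc n) (phi n) \<and> below (Suc n) (psi n) \<and>
   (\<exists>k>0. coeff (phi n) n = complex_of_real k \<and> coeff (psi n) 0 = complex_of_real k) \<and>
   ip (phi n) (phi n) = 1 \<and> ip (psi n) (psi n) = 1 \<and>
   (\<forall>A. below n A \<longrightarrow> ip (phi n) A = 0) \<and> (\<forall>A. below n A \<longrightarrow> ip (psi n) (pCons 0 A) = 0)"
proof (induction n)
  case 0
  show ?case using ip_1 below_1[of 0]
    by (auto simp: coeff_1 intro!: exI[of _ "1::real"])
next
  case (Suc n)
  note inv = Suc.IH
  have lt: "cmod (alpha n) < 1" by (rule alpha_less_1_aux) (use inv in auto)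
  from inv obtain k where k: "k > 0" "coeff (phi n) n = complex_of_real k" "coeff (psi n) 0 = complex_of_real k"
    by blast
  have rho: "rho n > 0"
    unfolding rho_def using lt by (simp add: power_less_one_iff abs_square_less_1)
  have rho2: "complex_of_real (rho n) * complex_of_real (rho n) = 1 - alpha n * cnj (alpha n)"
  proof -
    have "(rho n)\<^sup>2 = 1 - (cmod (alpha n))\<^sup>2"
      unfolding rho_def using lt by (simp add: power_le_one)
    then have "complex_of_real ((rho n)\<^sup>2) = complex_of_real (1 - (cmod (alpha n))\<^sup>2)" by simp
    then show ?thesis using complex_norm_square[of "alpha n"] by (simp add: power2_eq_square)
  qed
  let ?B = "pCons 0 (phi n) - smult (cnj (alpha n)) (psi n)"
  let ?C = "psi n - smult (alpha n) (pCons 0 (phi n))"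
  have a1: "ip (psi n) (pCons 0 (phi n)) = alpha n"
    by (subst ip_commute) (simp add: alpha_def)
  have a2: "ip (pCons 0 (phi n)) (psi n) = cnj (alpha n)"
    by (simp add: alpha_def)
  have BB: "ip ?B ?B = complex_of_real (rho n) * complex_of_real (rho n)"
    and CC: "ip ?C ?C = complex_of_real (rho n) * complex_of_real (rho n)"
    unfolding rho2 using inv by (simp_all add: ip_simps ip_shift a1 a2 algebra_simps del: smult_pCons)
  \<comment> \<open>Removing the constant coefficient with \<open>psi n\<close> leaves a multiple of
    \<zeta>. The pairing of \<open>?B\<close> with \<open>psi n\<close> vanishes by the choice of
    \<open>alpha n\<close>, that with the multiple of \<zeta> by shift invariance and the induction
    hypothesis.\<close>
  have Borth: "ip ?B A = 0" if "below (Suc n) A" for A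
  proof -
    define c where "c = coeff A 0 / complex_of_real k"
    obtain x A' where A': "A - smult c (psi n) = pCons x A'" by (rule pCons_cases)
    have "coeff (A - smult c (psi n)) 0 = 0" using k by (simp add: c_def)
    then have "x = 0" unfolding A' by simp
    have "below (Suc n) (A - smult c (psi n))"
      using inv that by (intro below_diff below_smult) auto
    then have "below n A'" unfolding A' by simp
    have A: "A = smult c (psi n) + pCons 0 A'" using A' \<open>x = 0\<close> by (simp add: algebra_simps)
    show ?thesis
      unfolding A using inv \<open>below n A'\<close> by (simp add: ip_simps ip_shift a2)
  qed
  \<comment> \<open>Dually, the top coefficient is removed with \<open>phi n\<close>, and the
    remainder is below \<open>n\<close>.\<close>
  have Corth: "ip ?C (pCons 0 A) = 0" if "below (Suc n) A" for A
  proof -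
    define c where "c = coeff A n / complex_of_real k"
    define A' where "A' = A - smult c (phi n)"
    have "coeff A' n = 0" "below (Suc n) A'"
      using k inv that by (auto simp: A'_def c_def intro!: below_diff below_smult)
    then have "below n A'" unfolding below_def by (metis le_antisym not_less_eq_eq)
    have A: "pCons 0 A = smult c (pCons 0 (phi n)) + pCons 0 A'" by (simp add: A'_def)
    show ?thesis
      unfolding A using inv \<open>below n A'\<close>
      by (simp add: ip_simps ip_shift a1 del: smult_pCons add_pCons)
  qed
  have orth: "\<forall>A. below (Suc n) A \<longrightarrow> ip (phi (Suc n)) A = 0"
    "\<forall>A. below (Suc n) A \<longrightarrow> ip (psi (Suc n)) (pCons 0 A) = 0"
    unfolding phi_Suc psi_Suc using Borth Corth by (simp_all add: ip_smult_left)
  have nrm: "ip (phi (Suc n)) (phi (Suc n)) = 1" "ip (psi (Suc n)) (psi (Suc n)) = 1"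
    unfolding phi_Suc psi_Suc ip_smult_left ip_smult_right BB CC using rho by simp_all
  have blw: "below (Suc (Suc n)) (phi (Suc n))" "below (Suc (Suc n)) (psi (Suc n))"
    unfolding phi_Suc psi_Suc using inv
    by (auto intro!: below_smult below_diff intro: below_mono)
  have "\<exists>k>0. coeff (phi (Suc n)) (Suc n) = complex_of_real k \<and> coeff (psi (Suc n)) 0 = complex_of_real k"
    using rho k inv by (intro exI[of _ "k / rho n"]) (simp add: phi_Suc psi_Suc below_def)
  with orth nrm blw show ?case by blast
qed

lemma alpha_less_1: "cmod (alpha n) < 1"
  by (rule alpha_less_1_aux) (use szego_invariant[of n] in auto)

lemma rho_pos: "rho n > 0"
  unfolding rho_def using alpha_less_1[of n] by (simp add: abs_square_less_1)

lemma rho_sq: "(rho n)\<^sup>2 = 1 - (cmod (alpha n))\<^sup>2"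
  unfolding rho_def using alpha_less_1[of n] by (simp add: power_le_one)

lemma below_phi: "below (Suc n) (phi n)" and below_psi: "below (Suc n) (psi n)"
  and ip_phi_phi: "ip (phi n) (phi n) = 1" and ip_psi_psi: "ip (psi n) (psi n) = 1"
  and ip_phi_below: "below n A \<Longrightarrow> ip (phi n) A = 0"
  and ip_psi_below: "below n A \<Longrightarrow> ip (psi n) (pCons 0 A) = 0"
  using szego_invariant[of n] by auto

definition "kappa n = Re (coeff (phi n) n)"

lemma coeff_phi: "coeff (phi n) n = complex_of_real (kappa n)"
  and coeff_psi: "coeff (psi n) 0 = complex_of_real (kappa n)"
  and kappa_pos: "kappa n > 0"
  using szego_invariant[of n] unfolding kappa_def by auto

lemma kappa_Suc: "kappa (Suc n) = kappa n / rho n"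
  using below_psi[of n] unfolding kappa_def phi_Suc by (simp add: below_def)

lemma szego_phi: "pCons 0 (phi n) = smult (complex_of_real (rho n)) (phi (Suc n)) + smult (cnj (alpha n)) (psi n)"
  and szego_psi: "psi n = smult (complex_of_real (rho n)) (psi (Suc n)) + smult (alpha n) (pCons 0 (phi n))"
  unfolding phi_Suc psi_Suc using rho_pos[of n] by simp_all

text \<open>\<open>psi (Suc n)\<close> combines \<open>psi n\<close>, orthogonal to
  \<open>phi (Suc n)\<close> by degree, with \<open>pCons 0 (phi n)\<close>, whose component along
  \<open>phi (Suc n)\<close> is \<open>rho n\<close>. The value is the inner product of the two
  wandering vectors in degree n + 1.\<close>

lemma ip_phi_psi_Suc: "ip (phi (Suc n)) (psi (Suc n)) = - cnj (alpha n)"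
proof -
  have "ip (phi (Suc n)) (pCons 0 (phi n)) = complex_of_real (rho n)"
    unfolding szego_phi by (simp add: ip_simps ip_phi_phi ip_phi_below below_psi)
  moreover have "ip (phi (Suc n)) (psi n) = 0" by (rule ip_phi_below[OF below_psi])
  ultimately show ?thesis
    unfolding psi_Suc ip_smult_right ip_diff_right using rho_pos[of n] by simp
qed

text \<open>\<open>psi (Suc n)\<close> is orthogonal to \<open>pCons 0 (phi n)\<close>, so only the
  first summand of \<open>szego_psi\<close> counts. This becomes the inner product of
  \<open>Mw (g n)\<close> and \<open>g (Suc n)\<close>, which governs the core operator.\<close>

lemma ip_psi_psi_Suc: "ip (psi n) (psi (Suc n)) = complex_of_real (rho n)"
proof -
  have "ip (psi (Suc n)) (pCons 0 (phi n)) = 0"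
    by (rule ip_psi_below[OF below_phi])
  then have "ip (pCons 0 (phi n)) (psi (Suc n)) = 0"
    by (subst ip_commute) simp
  then show ?thesis
    by (subst szego_psi) (simp only: ip_add_left ip_smult_left ip_psi_psi, simp)
qed

lemma psi_reversed: "z \<noteq> 0 \<Longrightarrow> poly (psi n) z = z ^ n * cnj (poly (phi n) (1 / cnj z))"
proof (induction n arbitrary: z)
  case (Suc n)
  \<comment> \<open>The induction hypothesis at the reflected point inverts the relation: reversal
    is an involution that exchanges the two lines of the recursion.\<close>
  have "cnj (poly (psi n) (1 / cnj z)) = poly (phi n) z / z ^ n"
    using Suc.IH[of "1 / cnj z"] Suc.prems by (simp add: power_divide)
  then show ?case
    unfolding phi_Suc psi_Suc using Suc.IH[OF Suc.prems] Suc.prems rho_pos[of n]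
    by (simp add: field_simps)
qed simp

text \<open>Cancelling leading coefficients leaves a polynomial that is below \<open>n\<close> and
  so orthogonal to itself. Unit norms and positive leading coefficients force the proportionality
  factor to be 1.\<close>

lemma orthogonal_lower_unique:
  assumes "degree f = n" "degree g = n" "lead_coeff f = complex_of_real a" "lead_coeff g = complex_of_real b"
    and "a > 0" "b > 0" "ip f f = 1" "ip g g = 1"
    and "\<And>A. below n A \<Longrightarrow> ip f A = 0" "\<And>A. below n A \<Longrightarrow> ip g A = 0"
  shows "f = g"
proof -
  define c where "c = complex_of_real (a / b)"
  define D where "D = f - smult c g"
  have "coeff D n = 0" using assms by (simp add: D_def c_def)
  moreover have "below (Suc n) D"
    unfolding D_def using assms by (intro below_diff below_smult) (auto simp: below_Suc_degree)
  ultimately have "below n D" unfolding below_def by (metis le_antisym not_less_eq_eq)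
  then have "ip D D = 0" using assms by (simp add: D_def ip_diff_left ip_smult_left)
  then have "D = 0" using ip_pos[of D] by fastforce
  then have f: "f = smult c g" by (simp add: D_def)
  have "c * cnj c = 1" using assms(7,8) unfolding f by (simp add: ip_simps mult.commute)
  then have "complex_of_real ((a / b) * (a / b)) = complex_of_real 1" by (simp add: c_def)
  then have "(a / b)\<^sup>2 = 1" by (simp only: of_real_eq_iff power2_eq_square)
  then have "a / b = 1" using divide_pos_pos[OF assms(5,6)] unfolding power2_eq_1_iff by linarith
  then show ?thesis unfolding f c_def by simp
qed

lemma degree_phi: "degree (phi n) = n"
  using below_phi[of n] coeff_phi[of n] kappa_pos[of n]
  by (intro antisym le_degree) (auto simp: below_Suc_degree)

text \<open>Exact degrees allow \<open>A\<close> to be stripped, top coefficient first, by the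
  earlier members of the sequence.\<close>

lemma orthonormal_sequence_orthogonal_below:
  assumes deg: "\<And>n. degree (\<eta> n) = n" and orth: "\<And>m n. ip (\<eta> m) (\<eta> n) = (if m = n then 1 else 0)"
    and "below n A" "n \<le> m"
  shows "ip (\<eta> m) A = 0"
  using assms(3,4)
proof (induction n arbitrary: A)
  case (Suc n)
  have "\<eta> n \<noteq> 0" using orth[of n n] by force
  then have ne: "coeff (\<eta> n) n \<noteq> 0" using deg[of n] leading_coeff_0_iff[of "\<eta> n"] by simp
  define c where "c = coeff A n / coeff (\<eta> n) n"
  define A' where "A' = A - smult c (\<eta> n)"
  have "below (Suc n) (\<eta> n)" using deg[of n] by (simp add: below_Suc_degree)
  then have "coeff A' n = 0" "below (Suc n) A'"
    using ne Suc.prems by (auto simp: A'_def c_def intro!: below_diff below_smult)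
  then have "below n A'" unfolding below_def by (metis le_antisym not_less_eq_eq)
  then have "ip (\<eta> m) A' = 0" using Suc by auto
  then show ?case using orth[of m n] Suc.prems by (simp add: A'_def ip_simps)
qed simp

lemma phi_orthonormal: "ip (phi m) (phi n) = (if m = n then 1 else 0)"
proof (cases m n rule: linorder_cases)
  case less
  then have "ip (phi n) (phi m) = 0"
    using below_mono[OF below_phi[of m]] by (intro ip_phi_below) auto
  then show ?thesis using less ip_commute[of "phi m" "phi n"] by simp
next
  case greater
  then show ?thesis
    using below_mono[OF below_phi[of n], of m] by (simp add: ip_phi_below)
qed (simp add: ip_phi_phi)

lemma orthonormal_sequence_unique:
  assumes deg: "\<And>n. degree (\<eta> n) = n" and orth: "\<And>m n. ip (\<eta> m) (\<eta> n) = (if m = n then 1 else 0)"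
    and lc: "\<And>n. lead_coeff (\<eta> n) \<in> \<real> \<and> Re (lead_coeff (\<eta> n)) > 0"
  shows "\<eta> = phi"
proof
  fix n
  show "\<eta> n = phi n"
  proof (rule orthogonal_lower_unique[of _ n])
    show "lead_coeff (\<eta> n) = complex_of_real (Re (lead_coeff (\<eta> n)))"
      using lc[of n] by (simp add: complex_is_Real_iff complex_eq_iff)
    show "lead_coeff (phi n) = complex_of_real (kappa n)" by (simp add: degree_phi coeff_phi)
    show "\<And>A. below n A \<Longrightarrow> ip (\<eta> n) A = 0"
      by (rule orthonormal_sequence_orthogonal_below[OF deg orth _ order_refl])
  qed (use deg orth lc in \<open>auto simp: degree_phi kappa_pos ip_phi_phi ip_phi_below\<close>)
qed

text \<open>Pairing with \<open>psi n\<close> annihilates \<open>phi (Suc n)\<close>, so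
  \<open>a\<close> is determined whatever \<open>r\<close> is.\<close>

lemma szego_coefficient_unique:
  assumes "\<And>z. z \<noteq> 0 \<Longrightarrow> r * poly (phi (Suc n)) z = z * poly (phi n) z - cnj a * (z ^ n * cnj (poly (phi n) (1 / cnj z)))"
  shows "a = alpha n"
proof -
  define D where "D = smult r (phi (Suc n)) - (pCons 0 (phi n) - smult (cnj a) (psi n))"
  \<comment> \<open>The extra factor \<zeta> makes the identity hold at 0 too, where the recursion
    is not imposed.\<close>
  have "poly (pCons 0 D) z = 0" for z
    using assms[of z] by (cases "z = 0") (auto simp: D_def psi_reversed)
  then have "D = 0" using poly_all_0_iff_0[of "pCons 0 D"] by simp
  then have "ip D (psi n) = 0" by simp
  then have "cnj a = cnj (alpha n)"
    by (simp add: D_def ip_simps ip_phi_below below_psi ip_psi_psi alpha_def)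
  then show ?thesis by simp
qed

text \<open>The reciprocals of the squared leading coefficients are the partial products of \<open>1 - |\<alpha>\<^sub>k|\<^sup>2\<close>,
  so a lower bound for monic polynomials bounds \<open>\<Sum>|\<alpha>\<^sub>k|\<^sup>2\<close>.\<close>

lemma alpha_square_summable:
  assumes c: "c > 0" "\<And>n A. degree A = n \<Longrightarrow> lead_coeff A = 1 \<Longrightarrow> c \<le> Re (ip A A)"
  shows "summable (\<lambda>n. (cmod (alpha n))\<^sup>2)"
proof (rule summableI_nonneg_bounded)
  fix n
  have prod: "1 / (kappa n)\<^sup>2 = (\<Prod>k<n. 1 - (cmod (alpha k))\<^sup>2)"
  proof (induction n)
    case (Suc n)
    have "1 / (kappa (Suc n))\<^sup>2 = (rho n)\<^sup>2 * (1 / (kappa n)\<^sup>2)"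
      by (simp add: kappa_Suc power_divide)
    then show ?case unfolding Suc.IH rho_sq by simp
  qed (simp add: kappa_def)
  \<comment> \<open>The monic multiple of \<open>phi n\<close>; its squared norm is the product
    computed above.\<close>
  define A where "A = smult (complex_of_real (1 / kappa n)) (phi n)"
  have "degree A = n" "lead_coeff A = 1"
    using kappa_pos[of n] by (simp_all add: A_def degree_phi coeff_phi)
  then have "c \<le> Re (ip A A)" by (rule c(2))
  also have "\<dots> = 1 / (kappa n)\<^sup>2"
    by (simp add: A_def ip_simps ip_phi_phi power2_eq_square)
  \<comment> \<open>Since 1 - x is at most exp(-x), the lower bound \<open>c\<close> on the product
    becomes the upper bound \<open>- ln c\<close> on the sum.\<close>
  also have "\<dots> \<le> (\<Prod>k<n. exp (- (cmod (alpha k))\<^sup>2))"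
    unfolding prod
  proof (rule prod_mono, intro conjI)
    fix k
    show "0 \<le> 1 - (cmod (alpha k))\<^sup>2" using rho_sq[of k] by (metis zero_le_power2)
    show "1 - (cmod (alpha k))\<^sup>2 \<le> exp (- (cmod (alpha k))\<^sup>2)"
      using exp_ge_add_one_self[of "- (cmod (alpha k))\<^sup>2"] by simp
  qed
  also have "\<dots> = exp (- (\<Sum>k<n. (cmod (alpha k))\<^sup>2))"
    by (simp add: exp_sum sum_negf[symmetric])
  finally have "ln c \<le> ln (exp (- (\<Sum>k<n. (cmod (alpha k))\<^sup>2)))"
    using c(1) by (subst ln_le_cancel_iff) auto
  then show "(\<Sum>k<n. (cmod (alpha k))\<^sup>2) \<le> - ln c" by simp
qed simp

end

section \<open>Weights given by polynomials on the circle\<close>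

lemma circle_haar_alt:
  "circle_haar = distr (density lborel (\<lambda>x. ennreal (indicator {0..<2 * pi} x / (2 * pi)))) borel cis"
proof -
  have "indicator {0..<2 * pi} x / emeasure lborel {0..<2 * pi} = ennreal (indicator {0..<2 * pi} x / (2 * pi))"
    for x :: real
    by (simp add: divide_ennreal[symmetric] ennreal_indicator split: split_indicator)
  then show ?thesis
    unfolding circle_haar_def uniform_measure_def by simp
qed

lemma sets_circle_haar [measurable_cong, simp]: "sets circle_haar = sets borel"
  by (simp add: circle_haar_def)

lemma cis_measurable [measurable]: "cis \<in> borel_measurable borel"
  by (intro borel_measurable_continuous_onI continuous_intros)

text \<open>The half-open parameter interval is closed up by a null set; on the compact interval
  continuity gives integrability and the fundamental theorem of calculus becomes available.\<close>

lemma
  fixes f :: "complex \<Rightarrow> complex"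
  assumes "continuous_on UNIV f"
  shows integrable_circle_haar: "integrable circle_haar f"
    and integral_circle_haar:
      "(\<integral>\<zeta>. f \<zeta> \<partial>circle_haar) = (\<integral>t. indicator {0..2 * pi} t *\<^sub>R (f (cis t) / (2 * pi)) \<partial>lborel)"
proof -
  have fm [measurable]: "f \<in> borel_measurable borel"
    by (rule borel_measurable_continuous_onI[OF assms])
  have cont: "continuous_on {0..2 * pi} (\<lambda>t. f (cis t) / (2 * pi))"
    by (intro continuous_intros continuous_on_compose2[OF assms]) auto
  have int: "integrable lborel (\<lambda>t. indicator {0..2 * pi} t *\<^sub>R (f (cis t) / (2 * pi)))"
    by (rule borel_integrable_compact[OF compact_Icc cont])
  have AE: "AE t in lborel. (indicator {0..<2 * pi} t / (2 * pi)) *\<^sub>R f (cis t)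
      = indicator {0..2 * pi} t *\<^sub>R (f (cis t) / (2 * pi))"
    using AE_lborel_singleton[of "2 * pi"]
    by eventually_elim (auto simp: scaleR_conv_of_real split: split_indicator)
  have m [measurable]: "(\<lambda>x. indicator {0..<2 * pi} x / (2 * pi) :: real) \<in> borel_measurable lborel"
    by measurable
  have nn: "AE x in lborel. 0 \<le> (indicator {0..<2 * pi} x / (2 * pi) :: real)" by simp
  have fc [measurable]: "(\<lambda>t. f (cis t)) \<in> borel_measurable lborel" by measurable
  have m1: "(\<lambda>t. (indicator {0..<2 * pi} t / (2 * pi)) *\<^sub>R f (cis t)) \<in> borel_measurable lborel" by measurable
  have m2: "(\<lambda>t. indicator {0..2 * pi} t *\<^sub>R (f (cis t) / (2 * pi))) \<in> borel_measurable lborel" by measurable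
  have cm: "cis \<in> measurable (density lborel (\<lambda>x. ennreal (indicator {0..<2 * pi} x / (2 * pi)))) borel"
    by measurable
  show "integrable circle_haar f"
    unfolding circle_haar_alt integrable_distr_eq[OF cm fm] integrable_density[OF fc m nn]
      integrable_cong_AE[OF m1 m2 AE] by (rule int)
  show "(\<integral>\<zeta>. f \<zeta> \<partial>circle_haar) = (\<integral>t. indicator {0..2 * pi} t *\<^sub>R (f (cis t) / (2 * pi)) \<partial>lborel)"
    unfolding circle_haar_alt integral_distr[OF cm fm] integral_density[OF fc m nn]
      integral_cong_AE[OF m1 m2 AE] ..
qed

lemma circle_moment: "(\<integral>\<zeta>. \<zeta> ^ i * cnj \<zeta> ^ j \<partial>circle_haar) = (if i = j then 1 else 0)"
proof -
  define k where "k = real i - real j"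
  have cis: "cis t ^ i * cnj (cis t) ^ j = cis (k * t)" for t
  proof -
    have "cis t ^ i * cnj (cis t) ^ j = cis (real i * t + real j * (- t))"
      by (simp only: cis_cnj Complex.DeMoivre cis_mult)
    also have "real i * t + real j * (- t) = k * t" by (simp add: k_def algebra_simps)
    finally show ?thesis .
  qed
  have "(\<integral>\<zeta>. \<zeta> ^ i * cnj \<zeta> ^ j \<partial>circle_haar)
      = (\<integral>t. indicator {0..2 * pi} t *\<^sub>R (cis (k * t) / (2 * pi)) \<partial>lborel)"
    by (subst integral_circle_haar) (auto simp: cis intro!: continuous_intros)
  also have "\<dots> = (if i = j then 1 else 0)"
  proof (cases "i = j")
    case True
    have "((\<lambda>t. t *\<^sub>R (1 / (2 * pi) :: complex)) has_vector_derivative cis (k * t) / (2 * pi)) (at t within {0..2 * pi})" for t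
      unfolding has_vector_derivative_def
      by (rule derivative_eq_intros refl)+ (simp add: True k_def)
    then have "(\<integral>t. indicator {0..2 * pi} t *\<^sub>R (cis (k * t) / (2 * pi)) \<partial>lborel)
        = (2 * pi) *\<^sub>R (1 / (2 * pi) :: complex) - 0 *\<^sub>R (1 / (2 * pi) :: complex)"
      by (intro integral_FTC_atLeastAtMost continuous_intros) auto
    also have "\<dots> = 1" by (simp add: scaleR_conv_of_real)
    finally have "(\<integral>t. indicator {0..2 * pi} t *\<^sub>R (cis (k * t) / (2 * pi)) \<partial>lborel) = 1" .
    then show ?thesis using True by simp
  next
    case False
    then have k: "k \<noteq> 0" by (simp add: k_def)
    have "cis (k * (2 * pi)) = 1"
    proof -
      have "k * (2 * pi) = 2 * pi * real_of_int (int i - int j)" by (simp add: k_def)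
      then show ?thesis by (metis cis_multiple_2pi Ints_of_int)
    qed
    moreover have "(\<integral>t. indicator {0..2 * pi} t *\<^sub>R (cis (k * t) / (2 * pi)) \<partial>lborel)
        = cis (k * (2 * pi)) / (\<i> * k * (2 * pi)) - cis (k * 0) / (\<i> * k * (2 * pi))"
    proof (rule integral_FTC_atLeastAtMost)
      fix t
      have "((\<lambda>t. cis (k * t) / (\<i> * k * (2 * pi))) has_vector_derivative
          (k *\<^sub>R (\<i> * cis (k * t))) / (\<i> * k * (2 * pi))) (at t within {0..2 * pi})"
        unfolding has_vector_derivative_def
        by (auto intro!: derivative_eq_intros simp: scaleR_conv_of_real mult_ac)
      then show "((\<lambda>t. cis (k * t) / (\<i> * k * (2 * pi))) has_vector_derivative
          cis (k * t) / (2 * pi)) (at t within {0..2 * pi})"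
        using k by (simp add: scaleR_conv_of_real field_simps)
    qed (auto intro!: continuous_intros)
    ultimately show ?thesis using False by simp
  qed
  finally show ?thesis .
qed

text \<open>The inner product of L^2(T, m) on polynomials, by orthonormality of the powers of
  \<zeta>. Stopping at \<open>degree A\<close> loses nothing, since later coefficients of
  \<open>A\<close> vanish.\<close>

definition coeff_ip :: "complex poly \<Rightarrow> complex poly \<Rightarrow> complex" where
  "coeff_ip A B = (\<Sum>k\<le>degree A. coeff A k * cnj (coeff B k))"

lemma coeff_ip_atMost:
  assumes "degree A \<le> n" shows "coeff_ip A B = (\<Sum>k\<le>n. coeff A k * cnj (coeff B k))"
  unfolding coeff_ip_def using assms
  by (intro sum.mono_neutral_left) (auto simp: coeff_eq_0)

lemma coeff_ip_commute: "coeff_ip A B = cnj (coeff_ip B A)"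
  using coeff_ip_atMost[of A "max (degree A) (degree B)" B] coeff_ip_atMost[of B "max (degree A) (degree B)" A]
  by (simp add: mult.commute)

lemma coeff_ip_add_left: "coeff_ip (A + B) C = coeff_ip A C + coeff_ip B C"
proof -
  let ?n = "max (degree A) (degree B)"
  have "degree (A + B) \<le> ?n" by (rule degree_add_le_max)
  then show ?thesis
    by (simp add: coeff_ip_atMost[of _ ?n] distrib_right sum.distrib)
qed

lemma coeff_ip_smult_left: "coeff_ip (smult c A) C = c * coeff_ip A C"
  using degree_smult_le[of c A]
  by (simp add: coeff_ip_atMost[of _ "degree A"] sum_distrib_left mult.assoc)

lemma coeff_ip_self: "coeff_ip A A = complex_of_real (\<Sum>k\<le>degree A. (cmod (coeff A k))\<^sup>2)"
  unfolding coeff_ip_def of_real_sum complex_norm_square ..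

lemma coeff_ip_ge_coeff: "(cmod (coeff A k))\<^sup>2 \<le> Re (coeff_ip A A)"
proof (cases "k \<le> degree A")
  case True
  then show ?thesis
    unfolding coeff_ip_self Re_complex_of_real
    by (intro member_le_sum[where f = "\<lambda>k. (cmod (coeff A k))\<^sup>2"]) auto
next
  case False
  then show ?thesis by (simp add: coeff_ip_self coeff_eq_0 sum_nonneg del: of_real_sum)
qed

lemma coeff_ip_pos: "A \<noteq> 0 \<Longrightarrow> 0 < Re (coeff_ip A A)"
  using coeff_ip_ge_coeff[of A "degree A"]
  by (metis leading_coeff_0_iff less_le_trans zero_less_norm_iff zero_less_power)

lemma coeff_ip_pCons: "coeff_ip (pCons 0 A) (pCons 0 B) = coeff_ip A B"
  using coeff_ip_atMost[of "pCons 0 A" "Suc (degree A)" "pCons 0 B"]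
  by (simp add: degree_pCons_le sum.atMost_Suc_shift coeff_ip_def del: sum.atMost_Suc)

lemma poly_atMost:
  fixes A :: "complex poly"
  assumes "degree A \<le> n" shows "poly A z = (\<Sum>k\<le>n. coeff A k * z ^ k)"
  unfolding poly_altdef using assms
  by (intro sum.mono_neutral_left) (auto simp: coeff_eq_0)

lemma integral_circle_haar_poly:
  "(\<integral>\<zeta>. poly A \<zeta> * cnj (poly B \<zeta>) \<partial>circle_haar) = coeff_ip A B"
proof -
  let ?n = "max (degree A) (degree B)"
  have "poly A \<zeta> * cnj (poly B \<zeta>) = (\<Sum>i\<le>?n. \<Sum>j\<le>?n. (coeff A i * cnj (coeff B j)) * (\<zeta> ^ i * cnj \<zeta> ^ j))" for \<zeta>
    by (simp add: poly_atMost[of _ ?n] sum_product mult_ac)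
  moreover have "integrable circle_haar (\<lambda>\<zeta>. c * (\<zeta> ^ i * cnj \<zeta> ^ j))" for c i j
    by (intro integrable_circle_haar continuous_intros)
  ultimately have "(\<integral>\<zeta>. poly A \<zeta> * cnj (poly B \<zeta>) \<partial>circle_haar)
      = (\<Sum>i\<le>?n. \<Sum>j\<le>?n. (coeff A i * cnj (coeff B j)) * (if i = j then 1 else 0))"
    by (simp add: circle_moment)
  also have "\<dots> = (\<Sum>i\<le>?n. \<Sum>j\<le>?n. if i = j then coeff A i * cnj (coeff B i) else 0)"
    by (intro sum.cong) auto
  also have "\<dots> = coeff_ip A B"
    by (simp add: coeff_ip_atMost[of A ?n])
  finally show ?thesis .
qed

lemma l2norm_circle_poly: "(l2norm_circle (poly Q))\<^sup>2 = Re (coeff_ip Q Q)"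
proof -
  have "complex_of_real (\<integral>\<zeta>. (cmod (poly Q \<zeta>))\<^sup>2 \<partial>circle_haar) = coeff_ip Q Q"
    unfolding integral_circle_haar_poly[symmetric] integral_complex_of_real[symmetric] complex_norm_square ..
  then have "(\<integral>\<zeta>. (cmod (poly Q \<zeta>))\<^sup>2 \<partial>circle_haar) = Re (coeff_ip Q Q)"
    by (metis Re_complex_of_real)
  then show ?thesis
    unfolding l2norm_circle_def by (simp add: coeff_ip_self sum_nonneg del: of_real_sum)
qed

text \<open>With \<open>Q\<close> as q, this is the inner product of \<mu>_p, expressed through
  coefficients alone.\<close>

definition weighted_ip :: "complex poly \<Rightarrow> complex poly \<Rightarrow> complex poly \<Rightarrow> complex" where
  "weighted_ip Q A B = coeff_ip (Q * A) (Q * B) / coeff_ip Q Q"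

lemma weighted_ip_szego:
  assumes "Q \<noteq> 0" shows "szego (weighted_ip Q)"
proof
  have QQ: "coeff_ip Q Q = complex_of_real (Re (coeff_ip Q Q))" by (simp add: coeff_ip_self)
  fix A B C :: "complex poly" and c :: complex
  show "weighted_ip Q (A + B) C = weighted_ip Q A C + weighted_ip Q B C"
    by (simp add: weighted_ip_def distrib_left coeff_ip_add_left add_divide_distrib)
  show "weighted_ip Q (smult c A) C = c * weighted_ip Q A C"
    by (simp add: weighted_ip_def coeff_ip_smult_left)
  show "weighted_ip Q A B = cnj (weighted_ip Q B A)"
    unfolding weighted_ip_def complex_cnj_divide
    by (metis coeff_ip_commute)
  show "weighted_ip Q (pCons 0 A) (pCons 0 B) = weighted_ip Q A B"
    by (simp add: weighted_ip_def coeff_ip_pCons)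
  show "weighted_ip Q 1 1 = 1"
    using coeff_ip_pos[OF assms] by (auto simp: weighted_ip_def)
  show "0 < Re (weighted_ip Q A A)" if "A \<noteq> 0"
  proof -
    have "Q * A \<noteq> 0" using assms that by simp
    then show ?thesis
      unfolding weighted_ip_def
      by (subst QQ) (use coeff_ip_pos[of "Q * A"] coeff_ip_pos[OF assms] in \<open>simp add: Re_divide_of_real\<close>)
  qed
qed

text \<open>The top coefficient of \<open>Q * A\<close> is that of \<open>Q\<close>, and one
  coefficient is bounded by the norm. The bound is uniform in the degree of \<open>A\<close>, as
  \<open>alpha_square_summable\<close> requires.\<close>

lemma weighted_ip_monic_ge:
  assumes "Q \<noteq> 0" "lead_coeff A = 1"
  shows "(cmod (lead_coeff Q))\<^sup>2 / Re (coeff_ip Q Q) \<le> Re (weighted_ip Q A A)"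
proof -
  have QQ: "coeff_ip Q Q = complex_of_real (Re (coeff_ip Q Q))" by (simp add: coeff_ip_self)
  have "(cmod (lead_coeff Q))\<^sup>2 \<le> Re (coeff_ip (Q * A) (Q * A))"
    using coeff_ip_ge_coeff[of "Q * A" "degree (Q * A)"] assms(2) by (simp add: lead_coeff_mult)
  then have "(cmod (lead_coeff Q))\<^sup>2 / Re (coeff_ip Q Q) \<le> Re (coeff_ip (Q * A) (Q * A)) / Re (coeff_ip Q Q)"
    using coeff_ip_pos[OF assms(1)] by (simp add: divide_right_mono)
  also have "\<dots> = Re (weighted_ip Q A A)"
    unfolding weighted_ip_def by (subst (2) QQ) (simp add: Re_divide_of_real)
  finally show ?thesis .
qed

lemma integral_mu:
  assumes Q: "\<And>\<zeta>. eval2 p \<zeta> 1 = poly Q \<zeta>"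
  shows "(\<integral>\<zeta>. poly A \<zeta> * cnj (poly B \<zeta>) \<partial>mu p) = weighted_ip Q A B"
proof -
  have QQ: "coeff_ip Q Q = complex_of_real (Re (coeff_ip Q Q))" by (simp add: coeff_ip_self)
  have pm [measurable]: "poly A \<in> borel_measurable borel" for A :: "complex poly"
    by (intro borel_measurable_continuous_onI continuous_intros)
  have [measurable]: "cnj \<in> borel_measurable borel"
    by (intro borel_measurable_continuous_onI continuous_intros)
  have "(\<integral>\<zeta>. poly A \<zeta> * cnj (poly B \<zeta>) \<partial>mu p)
      = (\<integral>\<zeta>. ((cmod (poly Q \<zeta>))\<^sup>2 / Re (coeff_ip Q Q)) *\<^sub>R (poly A \<zeta> * cnj (poly B \<zeta>)) \<partial>circle_haar)"
    unfolding mu_def Let_def Q l2norm_circle_poly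
    by (rule integral_density) (auto simp: coeff_ip_self sum_nonneg simp del: of_real_sum)
  also have "\<dots> = (\<integral>\<zeta>. poly (Q * A) \<zeta> * cnj (poly (Q * B) \<zeta>) / Re (coeff_ip Q Q) \<partial>circle_haar)"
    by (rule Bochner_Integration.integral_cong[OF refl])
      (simp only: scaleR_conv_of_real of_real_divide complex_norm_square poly_mult complex_cnj_mult, simp)
  also have "\<dots> = weighted_ip Q A B"
    unfolding weighted_ip_def integral_divide_zero integral_circle_haar_poly
    by (subst (2) QQ) simp
  finally show ?thesis .
qed

text \<open>Settles both definite descriptions inside \<open>verblunsky\<close>: that of the
  orthonormal polynomials and that of the coefficient.\<close>

lemma verblunsky_mu:
  assumes Q: "\<And>\<zeta>. eval2 p \<zeta> 1 = poly Q \<zeta>" and "Q \<noteq> 0"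
  shows "verblunsky (mu p) = szego.alpha (weighted_ip Q)"
proof
  interpret szego "weighted_ip Q" by (rule weighted_ip_szego[OF assms(2)])
  have "orthonormal_polys (mu p) = phi"
    unfolding orthonormal_polys_def
  proof (rule the_equality)
    show "orthonormal_polys_pred (mu p) phi"
      by (auto simp: orthonormal_polys_pred_def integral_mu[OF Q] phi_orthonormal degree_phi coeff_phi kappa_pos)
    show "\<eta> = phi" if "orthonormal_polys_pred (mu p) \<eta>" for \<eta>
      using that unfolding orthonormal_polys_pred_def integral_mu[OF Q]
      by (intro orthonormal_sequence_unique) blast+
  qed
  fix n
  show "verblunsky (mu p) n = alpha n"
    unfolding verblunsky_def Let_def \<open>orthonormal_polys (mu p) = phi\<close>
  proof (rule the_equality)
    have "complex_of_real (sqrt (1 - (cmod (alpha n))\<^sup>2)) * poly (phi (Suc n)) \<zeta> =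
          \<zeta> * poly (phi n) \<zeta> - cnj (alpha n) * (\<zeta> ^ n * cnj (poly (phi n) (1 / cnj \<zeta>)))" if "\<zeta> \<noteq> 0" for \<zeta>
      using arg_cong[OF szego_phi[of n], of "\<lambda>A. poly A \<zeta>"]
      unfolding psi_reversed[OF that, symmetric] rho_def by simp
    then show "cmod (alpha n) < 1 \<and> (\<forall>\<zeta>. \<zeta> \<noteq> 0 \<longrightarrow>
        complex_of_real (sqrt (1 - (cmod (alpha n))\<^sup>2)) * poly (phi (Suc n)) \<zeta> =
        \<zeta> * poly (phi n) \<zeta> - cnj (alpha n) * (\<zeta> ^ n * cnj (poly (phi n) (1 / cnj \<zeta>))))"
      using alpha_less_1 by blast
  qed (use szego_coefficient_unique in blast)
qed

lemma weighted_alpha_square_summable: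
  assumes "Q \<noteq> 0"
  shows "summable (\<lambda>n. (cmod (szego.alpha (weighted_ip Q) n))\<^sup>2)"
proof -
  interpret szego "weighted_ip Q" by (rule weighted_ip_szego[OF assms])
  show ?thesis
    by (rule alpha_square_summable[where c = "(cmod (lead_coeff Q))\<^sup>2 / Re (coeff_ip Q Q)"])
      (use assms coeff_ip_pos[OF assms] weighted_ip_monic_ge[OF assms] in auto)
qed

section \<open>The Wold decomposition\<close>

text \<open>For orthonormal \<open>u\<close>, the orthogonal projection onto its closed
  span.\<close>

definition expand :: "(nat \<Rightarrow> hardy2) \<Rightarrow> hardy2 \<Rightarrow> hardy2" where
  "expand u F = (\<Sum>n. cscale (cinner F (u n)) (u n))"

lemma expand_sums: "ortho I u \<Longrightarrow> (\<lambda>n. cscale (cinner F (u n)) (u n)) sums expand u F"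
  unfolding expand_def by (intro summable_sums ortho_summable ortho_bessel)

lemma expand_add: "ortho I u \<Longrightarrow> expand u (F + G) = expand u F + expand u G"
  using sums_add[OF expand_sums[of I u F] expand_sums[of I u G]]
  by (intro sums_unique2[OF expand_sums]) (auto simp: cinner_simps hardy2.scale_left_distrib)

lemma expand_scale: "ortho I u \<Longrightarrow> expand u (cscale a F) = cscale a (expand u F)"
  using bounded_linear.sums[OF bounded_linear_cscale[of a] expand_sums[of I u F]]
  by (intro sums_unique2[OF expand_sums]) (auto simp: cinner_simps)

lemma norm_expand_le:
  assumes "ortho I u" shows "norm (expand u F) \<le> norm F"
proof -
  have "(\<lambda>n. (cmod (cinner F (u n)))\<^sup>2) sums (norm (expand u F))\<^sup>2"
    unfolding expand_def
    by (rule ortho_suminf_norm[OF assms ortho_bessel[OF assms]]) (simp add: ortho_eq_0[OF assms])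
  then have "(norm (expand u F))\<^sup>2 \<le> (norm F)\<^sup>2"
    unfolding sums_def by (rule LIMSEQ_le_const2) (auto intro: ortho_bessel_sum[OF assms])
  then show ?thesis by simp
qed

lemma bounded_linear_expand: "ortho I u \<Longrightarrow> bounded_linear (expand u)"
  by (rule bounded_linear_intro[where K = 1])
    (auto simp: expand_add expand_scale scaleR_cscale norm_expand_le)

lemma expand_in:
  assumes "ortho I u" "hardy2.subspace M" "closed M" "\<And>n. u n \<in> M"
  shows "expand u F \<in> M"
proof (rule closed_sequentially[OF assms(3)])
  show "(\<lambda>N. \<Sum>n<N. cscale (cinner F (u n)) (u n)) \<longlonglongrightarrow> expand u F"
    using expand_sums[OF assms(1)] by (simp add: sums_def)
  show "(\<Sum>n<N. cscale (cinner F (u n)) (u n)) \<in> M" for N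
    by (intro hardy2.subspace_sum[OF assms(2)] hardy2.subspace_scale[OF assms(2)] assms(4))
qed

lemma expand_base:
  assumes "ortho I u" shows "expand u (u m) = u m"
proof -
  have "cscale (cinner (u m) (u n)) (u n) = (if n = m then u m else 0)" for n
    by (auto simp: orthoD[OF assms] ortho_eq_0[OF assms])
  then show ?thesis
    using sums_unique2[OF expand_sums[OF assms, of "u m"]] sums_single[of m "\<lambda>_. u m"] by simp
qed

lemma expand_span:
  assumes "ortho I u" "F \<in> hardy2.span (range u)" shows "expand u F = F"
proof -
  have "hardy2.subspace {F. expand u F = F}"
    using bounded_linear.linear[OF bounded_linear_expand[OF assms(1)]]
    by (intro hardy2.subspaceI) (auto simp: expand_add[OF assms(1)] expand_scale[OF assms(1)] linear_0)
  then have "hardy2.span (range u) \<subseteq> {F. expand u F = F}"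
    by (intro hardy2.span_minimal) (auto simp: expand_base[OF assms(1)])
  then show ?thesis using assms(2) by auto
qed

lemma cinner_expand_eq_0:
  assumes "ortho I u" "\<And>n. cinner G (u n) = 0"
  shows "expand u G = 0" "cinner G (expand u F) = 0"
proof -
  show "expand u G = 0" unfolding expand_def by (simp add: assms(2))
  have "(\<lambda>n. cinner G (cscale (cinner F (u n)) (u n))) sums cinner G (expand u F)"
    by (rule bounded_linear.sums[OF bounded_linear_cinner_right expand_sums[OF assms(1)]])
  then show "cinner G (expand u F) = 0"
    using sums_unique2[OF _ sums_zero] by (simp add: cinner_simps assms(2))
qed

text \<open>\<open>M\<close> is the orthogonal sum of the range of \<open>V\<close> and the closed
  span of the \<open>u n\<close>, so \<open>V\<close> times its adjoint is the identity minus
  \<open>expand u\<close>. The adjoint appears as the explicit \<open>A\<close> in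
  \<open>F = expand u F + V A\<close>.\<close>

lemma wold:
  assumes M: "hardy2.subspace M" "closed M" and D: "M = closure D"
    and V: "\<And>F G. V (F + G) = V F + V G" "\<And>c F. V (cscale c F) = cscale c (V F)"
      "\<And>F G. cinner (V F) (V G) = cinner F G" "\<And>F. F \<in> M \<Longrightarrow> V F \<in> M"
    and u: "ortho I u" "\<And>n. u n \<in> M" "\<And>n F. F \<in> M \<Longrightarrow> cinner (V F) (u n) = 0"
    and gen: "\<And>F. F \<in> D \<Longrightarrow> \<exists>A\<in>M. F - V A \<in> hardy2.span (range u)"
    and F: "F \<in> M"
  shows "adj_on M V F \<in> M" and "V (adj_on M V F) = F - expand u F"
    and "\<And>h. h \<in> M \<Longrightarrow> cinner (V h) F = cinner h (adj_on M V F)"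
proof -
  have nV: "norm (V F) = norm F" for F
    using V(3)[of F F] unfolding cinner_self of_real_eq_iff by simp
  have blV: "bounded_linear V"
    by (rule bounded_linear_intro[where K = 1]) (auto simp: V scaleR_cscale nV)
  \<comment> \<open>The isometric image of \<open>M\<close> is closed, which lets the decomposition
    pass from the dense \<open>D\<close> to all of \<open>M\<close>.\<close>
  have "complete (V ` M)"
    by (rule complete_isometric_image[OF _ _ blV, where e = 1])
      (use M in \<open>auto simp: nV complete_eq_closed subspace_def scaleR_cscale
        hardy2.subspace_0 hardy2.subspace_add hardy2.subspace_scale\<close>)
  then have "closed (V ` M)" by (simp add: complete_eq_closed)
  moreover have "continuous_on UNIV (\<lambda>F. F - expand u F)"
    by (intro continuous_intros linear_continuous_on bounded_linear_expand[OF u(1)])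
  ultimately have cl: "closed {F. F - expand u F \<in> V ` M}"
    using continuous_closed_vimage[of "V ` M" "\<lambda>F. F - expand u F"]
    by (simp add: vimage_def continuous_on_eq_continuous_at)
  have "D \<subseteq> {F. F - expand u F \<in> V ` M}"
  proof
    fix F assume "F \<in> D"
    then obtain A where A: "A \<in> M" "F - V A \<in> hardy2.span (range u)" using gen by blast
    have "expand u (V A) = 0"
      using cinner_expand_eq_0[OF u(1)] u(3)[OF A(1)] by blast
    then have "expand u F = F - V A"
      using expand_add[OF u(1), of "F - V A" "V A"] expand_span[OF u(1) A(2)] by simp
    then show "F \<in> {F. F - expand u F \<in> V ` M}" using A(1) by simp
  qed
  then have "closure D \<subseteq> {F. F - expand u F \<in> V ` M}"
    by (rule closure_minimal[OF _ cl])
  then obtain A where A: "A \<in> M" "F - expand u F = V A" using F D by blast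
  have dual: "cinner (V h) F = cinner h A" if "h \<in> M" for h
  proof -
    have "F = expand u F + V A" using A(2) by (simp add: algebra_simps)
    then have "cinner (V h) F = cinner (V h) (expand u F) + cinner (V h) (V A)"
      by (metis cinner_add_right)
    then show ?thesis
      using cinner_expand_eq_0(2)[OF u(1) u(3)[OF that]] by (simp add: V)
  qed
  then have "adj_on M V F = A"
    using A(1) by (intro adj_on_eqI[OF M(1)]) auto
  then show "adj_on M V F \<in> M" "V (adj_on M V F) = F - expand u F"
    "\<And>h. h \<in> M \<Longrightarrow> cinner (V h) F = cinner h (adj_on M V F)"
    using A dual by auto
qed

section \<open>The coordinate multiplications as commuting isometries\<close>

lemma Mz_add: "Mz (F + G) = Mz F + Mz G" and Mz_scale: "Mz (cscale c F) = cscale c (Mz F)"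
  and Mw_add: "Mw (F + G) = Mw F + Mw G" and Mw_scale: "Mw (cscale c F) = cscale c (Mw F)"
  and Mz_Mw: "Mz (Mw F) = Mw (Mz F)"
  by (transfer, auto simp: fun_eq_iff split: nat.splits)+

lemma cinner_shift:
  assumes "inj s" "\<And>k. hcoeff F' (s k) = hcoeff F k" "\<And>k. k \<notin> range s \<Longrightarrow> hcoeff F' k = 0"
    "\<And>k. hcoeff G' (s k) = hcoeff G k"
  shows "cinner F' G' = cinner F G"
proof -
  have "cinner F' G' = (\<Sum>\<^sub>\<infinity>k\<in>range s. hcoeff F' k * cnj (hcoeff G' k))"
    unfolding cinner_def by (rule infsum_cong_neutral) (auto simp: assms(3))
  also have "\<dots> = cinner F G"
    unfolding cinner_def by (subst infsum_reindex[OF assms(1)]) (simp add: o_def assms)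
  finally show ?thesis .
qed

lemma cinner_Mz: "cinner (Mz F) (Mz G) = cinner F G"
proof (rule cinner_shift[where s = "\<lambda>(i, j). (Suc i, j)"])
  fix k assume k: "k \<notin> range (\<lambda>(i, j). (Suc i, j) :: nat \<times> nat)"
  obtain i j where ij: "k = (i, j)" by (cases k)
  have "i = 0"
  proof (cases i)
    case (Suc i')
    then have "k = (\<lambda>(i, j). (Suc i, j)) (i', j)" using ij by simp
    then show ?thesis using k by blast
  qed
  then show "hcoeff (Mz F) k = 0" by (simp add: ij Mz.rep_eq)
next
  show "inj (\<lambda>(i, j). (Suc i, j) :: nat \<times> nat)" by (rule injI) (simp split: prod.splits)
  show "hcoeff (Mz F) (case k of (i, j) \<Rightarrow> (Suc i, j)) = hcoeff F k" for F k
    by (cases k) (simp add: Mz.rep_eq)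
  then show "hcoeff (Mz G) (case k of (i, j) \<Rightarrow> (Suc i, j)) = hcoeff G k" for k .
qed

lemma cinner_Mw: "cinner (Mw F) (Mw G) = cinner F G"
proof (rule cinner_shift[where s = "\<lambda>(i, j). (i, Suc j)"])
  fix k assume k: "k \<notin> range (\<lambda>(i, j). (i, Suc j) :: nat \<times> nat)"
  obtain i j where ij: "k = (i, j)" by (cases k)
  have "j = 0"
  proof (cases j)
    case (Suc j')
    then have "k = (\<lambda>(i, j). (i, Suc j)) (i, j')" using ij by simp
    then show ?thesis using k by blast
  qed
  then show "hcoeff (Mw F) k = 0" by (simp add: ij Mw.rep_eq)
next
  show "inj (\<lambda>(i, j). (i, Suc j) :: nat \<times> nat)" by (rule injI) (simp split: prod.splits)
  show "hcoeff (Mw F) (case k of (i, j) \<Rightarrow> (i, Suc j)) = hcoeff F k" for F k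
    by (cases k) (simp add: Mw.rep_eq)
  then show "hcoeff (Mw G) (case k of (i, j) \<Rightarrow> (i, Suc j)) = hcoeff G k" for k .
qed

lemma bounded_linear_isometry:
  assumes "\<And>F G. V (F + G) = V F + V G" "\<And>c F. V (cscale c F) = cscale c (V F)"
      "\<And>F G. cinner (V F) (V G) = cinner F G"
  shows "bounded_linear V"
proof -
  have "norm (V F) = norm F" for F
    using assms(3)[of F F] unfolding cinner_self of_real_eq_iff by simp
  then show ?thesis
    by (intro bounded_linear_intro[where K = 1]) (auto simp: assms scaleR_cscale)
qed

lemmas bounded_linear_Mw = bounded_linear_isometry[OF Mw_add Mw_scale cinner_Mw]

text \<open>\<open>schmidt\<close> asks for zero vectors where \<open>c\<close> vanishes, while the
  wandering vectors are unit vectors throughout. Cutting them reconciles the two without changing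
  the operator.\<close>

definition cut :: "(nat \<Rightarrow> complex) \<Rightarrow> (nat \<Rightarrow> hardy2) \<Rightarrow> nat \<Rightarrow> hardy2" where
  "cut c u n = (if c n = 0 then 0 else u n)"

lemma ortho_cut: "ortho UNIV u \<Longrightarrow> ortho {n. c n \<noteq> 0} (cut c u)"
  by (auto simp: ortho_def cut_def)

lemma schmidt_op_cut: "schmidt_op c (cut c u) (cut c v) = schmidt_op c u v"
  unfolding schmidt_op_def cut_def by (intro ext suminf_cong) auto

text \<open>\<open>s\<close> and \<open>t\<close> are the coordinates of \<open>a\<close> and \<open>b\<close> in the orthonormal eigenbasis \<open>e, e'\<close>.\<close>

lemma projection_difference:
  fixes a b :: hardy2
  assumes ab: "cinner a a = 1" "cinner b b = 1" "cinner b a = complex_of_real r"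
    and r: "r\<^sup>2 = 1 - l\<^sup>2" "0 < l" "l \<le> 1" "0 \<le> r"
  defines "s \<equiv> sqrt ((1 + l) / 2)" and "t \<equiv> sqrt ((1 - l) / 2)"
  defines "e \<equiv> cscale (complex_of_real (1 / l)) (cscale (complex_of_real s) a - cscale (complex_of_real t) b)"
    and "e' \<equiv> cscale (complex_of_real (1 / l)) (cscale (complex_of_real s) b - cscale (complex_of_real t) a)"
  shows "cinner e e = 1" "cinner e' e' = 1" "cinner e e' = 0"
    and "cscale (cinner F a) a - cscale (cinner F b) b
      = cscale (complex_of_real l * cinner F e) e + cscale (- complex_of_real l * cinner F e') e'"
proof -
  \<comment> \<open>For \<open>a = s e + t e'\<close> and \<open>b = t e + s e'\<close>, unit length
    and inner product \<open>r\<close> mean \<open>s^2 + t^2 = 1\<close> and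
    \<open>2 s t = r\<close>. Then \<open>s^2 - t^2 = l\<close>, which explains the factor
    \<open>1 / l\<close> when solving for \<open>e\<close> and \<open>e'\<close>.\<close>
  have s2: "s * s = (1 + l) / 2" and t2: "t * t = (1 - l) / 2"
    unfolding s_def t_def using r by simp_all
  have "(2 * (s * t))\<^sup>2 = 4 * ((s * s) * (t * t))" by (simp add: power2_eq_square)
  also have "\<dots> = r\<^sup>2" unfolding s2 t2 r(1) by (simp add: power2_eq_square field_simps)
  finally have "(2 * (s * t))\<^sup>2 = r\<^sup>2" .
  moreover have "0 \<le> 2 * (s * t)" unfolding s_def t_def using r by simp
  ultimately have st: "2 * (s * t) = r"
    using r(4) by (simp only: power2_eq_iff_nonneg)
  have ab': "cinner a b = complex_of_real r" using cinner_commute[of a b] ab(3) by simp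
  have "cinner e e = complex_of_real ((s * s + t * t - 2 * (s * t) * r) / (l * l))"
    unfolding e_def cinner_simps ab ab' using r(2) by (simp add: field_simps)
  also have "s * s + t * t - 2 * (s * t) * r = l * l"
    unfolding st s2 t2 using r(1) by (simp add: power2_eq_square field_simps)
  finally show "cinner e e = 1" using r(2) by simp
  have "cinner e' e' = complex_of_real ((s * s + t * t - 2 * (s * t) * r) / (l * l))"
    unfolding e'_def cinner_simps ab ab' using r(2) by (simp add: field_simps)
  also have "s * s + t * t - 2 * (s * t) * r = l * l"
    unfolding st s2 t2 using r(1) by (simp add: power2_eq_square field_simps)
  finally show "cinner e' e' = 1" using r(2) by simp
  have "cinner e e' = complex_of_real (((s * s + t * t) * r - 2 * (s * t)) / (l * l))"
    unfolding e_def e'_def cinner_simps ab ab' using r(2) by (simp add: field_simps)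
  also have "(s * s + t * t) * r - 2 * (s * t) = 0"
    unfolding st s2 t2 by (simp add: field_simps)
  finally show "cinner e e' = 0" by simp
  define x y where "x = cinner F a" and "y = cinner F b"
  have sl: "complex_of_real s * complex_of_real s - complex_of_real t * complex_of_real t = complex_of_real l"
    using s2 t2 by (simp flip: of_real_mult of_real_diff)
  show "cscale (cinner F a) a - cscale (cinner F b) b
      = cscale (complex_of_real l * cinner F e) e + cscale (- complex_of_real l * cinner F e') e'"
  proof (rule hardy2_eqI)
    fix k
    define A B where "A = hcoeff a k" and "B = hcoeff b k"
    define S T L where "S = complex_of_real s" and "T = complex_of_real t" and "L = complex_of_real l"
    have L: "L \<noteq> 0" "S * S - T * T = L" using r(2) sl by (simp_all add: L_def S_def T_def)
    have "L * (1 / L * (S * x - T * y)) * (1 / L * (S * A - T * B))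
        + - L * (1 / L * (S * y - T * x)) * (1 / L * (S * B - T * A))
        = (S * S - T * T) * (x * A - y * B) / L"
      using L(1) by (simp add: field_simps)
    also have "\<dots> = x * A - y * B" using L by simp
    finally show "hcoeff (cscale (cinner F a) a - cscale (cinner F b) b) k
      = hcoeff (cscale (complex_of_real l * cinner F e) e + cscale (- complex_of_real l * cinner F e') e') k"
      by (simp add: minus_hardy2.rep_eq plus_hardy2.rep_eq cscale.rep_eq e_def e'_def cinner_simps
          x_def y_def A_def B_def S_def T_def L_def)
  qed
qed

section \<open>Graded submodules\<close>

text \<open>\<open>H n A\<close> is the degree n element described by \<open>A\<close>. The bound
  \<open>below (Suc n) A\<close> guards against coefficients that do not fit into degree n.
  Summability is an assumption because the axioms of \<open>szego\<close> do not force it.\<close>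

locale graded_module = szego ip for ip +
  fixes H :: "nat \<Rightarrow> complex poly \<Rightarrow> hardy2" and M :: "hardy2 set"
  assumes H_add: "H n (A + B) = H n A + H n B"
    and H_smult: "H n (smult c A) = cscale c (H n A)"
    and cinner_H: "below (Suc m) A \<Longrightarrow> below (Suc n) B \<Longrightarrow>
      cinner (H m A) (H n B) = (if m = n then ip A B else 0)"
    and Mz_H: "Mz (H n A) = H (Suc n) (pCons 0 A)"
    and Mw_H: "below (Suc n) A \<Longrightarrow> Mw (H n A) = H (Suc n) A"
    and M_eq: "M = closure (hardy2.span {H n A |n A. below (Suc n) A})"
    and alpha_summable: "summable (\<lambda>n. (cmod (alpha n))\<^sup>2)"
begin

abbreviation "D \<equiv> hardy2.span {H n A |n A. below (Suc n) A}"

lemma subM: "hardy2.subspace M"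
  unfolding M_eq by (intro closure_hardy2_subspace hardy2.subspace_span)

lemma closedM: "closed M" unfolding M_eq by simp

lemma D_subset: "D \<subseteq> M" unfolding M_eq by (rule closure_subset)

lemma H_in_M: "below (Suc n) A \<Longrightarrow> H n A \<in> M"
  by (rule subsetD[OF D_subset], rule hardy2.span_base) blast

lemma M_subset_closed_subspace:
  assumes "hardy2.subspace S" "closed S" "\<And>n A. below (Suc n) A \<Longrightarrow> H n A \<in> S"
  shows "M \<subseteq> S"
  unfolding M_eq using assms by (intro closure_minimal hardy2.span_minimal) auto

lemma isometry_in_M:
  assumes V: "\<And>F G. V (F + G) = V F + V G" "\<And>c F. V (cscale c F) = cscale c (V F)"
      "\<And>F G. cinner (V F) (V G) = cinner F G"
    and "\<And>n A. below (Suc n) A \<Longrightarrow> V (H n A) \<in> M" and "F \<in> M"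
  shows "V F \<in> M"
proof -
  have bl: "bounded_linear V" by (rule bounded_linear_isometry[OF V])
  have "closed (V -` M)"
    using closed_vimage[OF closedM] linear_continuous_on[OF bl] by blast
  moreover have "hardy2.subspace (V -` M)"
    using subM linear_0[OF bounded_linear.linear[OF bl]]
    by (intro hardy2.subspaceI) (auto simp: V hardy2.subspace_0 hardy2.subspace_add hardy2.subspace_scale)
  ultimately have "M \<subseteq> V -` M" using assms(4) by (intro M_subset_closed_subspace) auto
  then show ?thesis using \<open>F \<in> M\<close> by auto
qed

lemma Mz_in_M: "F \<in> M \<Longrightarrow> Mz F \<in> M"
  by (rule isometry_in_M[OF Mz_add Mz_scale cinner_Mz]) (auto simp: Mz_H intro!: H_in_M)

lemma Mw_in_M: "F \<in> M \<Longrightarrow> Mw F \<in> M"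
  by (rule isometry_in_M[OF Mw_add Mw_scale cinner_Mw])
    (auto simp: Mw_H intro!: H_in_M intro: below_mono)

section \<open>Wandering vectors of the two shifts\<close>

definition "f n = H n (phi n)"
definition "g n = H n (psi n)"

lemma f_in_M: "f n \<in> M" and g_in_M: "g n \<in> M"
  by (simp_all add: f_def g_def H_in_M below_phi below_psi)

text \<open>Different degrees are orthogonal by the grading, so only unit norms matter here; the
  \<open>psi n\<close> themselves are not mutually orthogonal for \<open>ip\<close>.\<close>

lemma ortho_f: "ortho UNIV f" and ortho_g: "ortho UNIV g"
  by (auto simp: ortho_def f_def g_def cinner_H below_phi below_psi ip_phi_phi ip_psi_psi)

lemma cinner_orthogonal_closed_subspace:
  assumes V: "\<And>F G. V (F + G) = V F + V G" "\<And>c F. V (cscale c F) = cscale c (V F)"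
      "\<And>F G. cinner (V F) (V G) = cinner F G"
    and "\<And>n A. below (Suc n) A \<Longrightarrow> cinner (V (H n A)) h = 0" and "F \<in> M"
  shows "cinner (V F) h = 0"
proof -
  have bl: "bounded_linear V" by (rule bounded_linear_isometry[OF V])
  have "closed ((\<lambda>F. cinner (V F) h) -` {0})"
    by (intro closed_vimage closed_singleton linear_continuous_on
        bounded_linear_compose[OF bounded_linear_cinner_left bl])
  moreover have "hardy2.subspace ((\<lambda>F. cinner (V F) h) -` {0})"
    using linear_0[OF bounded_linear.linear[OF bl]]
    by (intro hardy2.subspaceI) (auto simp: V cinner_simps)
  ultimately have "M \<subseteq> (\<lambda>F. cinner (V F) h) -` {0}"
    using assms(4) by (intro M_subset_closed_subspace) auto
  then show ?thesis using \<open>F \<in> M\<close> by auto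
qed

text \<open>In degree \<open>n\<close> the range of \<open>Mw\<close> consists of polynomials below
  \<open>n\<close>.\<close>

lemma cinner_Mw_f:
  assumes "F \<in> M" shows "cinner (Mw F) (f n) = 0"
proof (rule cinner_orthogonal_closed_subspace[OF Mw_add Mw_scale cinner_Mw _ assms])
  fix m A assume A: "below (Suc m) A"
  have "ip A (phi n) = 0" if "Suc m = n"
    using ip_phi_below[of n A] A that ip_commute[of A "phi n"] by simp
  then show "cinner (Mw (H m A)) (f n) = 0"
    using below_mono[OF A, of "Suc (Suc m)"] A by (simp add: Mw_H f_def cinner_H below_phi)
qed

text \<open>In degree \<open>n\<close> the range of \<open>Mz\<close> consists of \<zeta> times
  polynomials below \<open>n\<close>.\<close>

lemma cinner_Mz_g:
  assumes "F \<in> M" shows "cinner (Mz F) (g n) = 0"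
proof (rule cinner_orthogonal_closed_subspace[OF Mz_add Mz_scale cinner_Mz _ assms])
  fix m A assume A: "below (Suc m) A"
  have "ip (pCons 0 A) (psi n) = 0" if "Suc m = n"
    using ip_psi_below[of n A] A that ip_commute[of "pCons 0 A" "psi n"] by simp
  then show "cinner (Mz (H m A)) (g n) = 0"
    using A by (simp add: Mz_H g_def cinner_H below_psi)
qed

lemma wandering_decomposition:
  assumes V: "\<And>F G. V (F + G) = V F + V G" "\<And>c F. V (cscale c F) = cscale c (V F)"
    and gen: "\<And>n A. below (Suc n) A \<Longrightarrow> \<exists>B\<in>M. H n A - V B \<in> hardy2.span (range u)"
    and F: "F \<in> D"
  shows "\<exists>B\<in>M. F - V B \<in> hardy2.span (range u)"
proof -
  let ?S = "{F. \<exists>B\<in>M. F - V B \<in> hardy2.span (range u)}"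
  have "V 0 = 0" using V(1)[of 0 0] by simp
  have "hardy2.subspace ?S"
  proof (rule hardy2.subspaceI)
    show "0 \<in> ?S"
      using \<open>V 0 = 0\<close> hardy2.subspace_0[OF subM] by (auto intro!: bexI[of _ 0] hardy2.span_zero)
  next
    fix F G assume "F \<in> ?S" "G \<in> ?S"
    then obtain B C where "B \<in> M" "F - V B \<in> hardy2.span (range u)" "C \<in> M" "G - V C \<in> hardy2.span (range u)"
      by blast
    moreover from this have "(F - V B) + (G - V C) \<in> hardy2.span (range u)" by (intro hardy2.span_add)
    ultimately show "F + G \<in> ?S"
      by (auto intro!: bexI[of _ "B + C"] simp: V hardy2.subspace_add[OF subM] algebra_simps)
  next
    fix c F assume "F \<in> ?S"
    then obtain B where "B \<in> M" "F - V B \<in> hardy2.span (range u)" by blast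
    moreover from this have "cscale c (F - V B) \<in> hardy2.span (range u)" by (intro hardy2.span_scale)
    ultimately show "cscale c F \<in> ?S"
      by (auto intro!: bexI[of _ "cscale c B"]
          simp: V hardy2.subspace_scale[OF subM] hardy2.scale_right_diff_distrib)
  qed
  then have "D \<subseteq> ?S" using gen by (intro hardy2.span_minimal) auto
  then show ?thesis using F by auto
qed

lemma H_0: "H n 0 = 0"
  using H_smult[of n 0 0] by simp

text \<open>Once \<open>phi n\<close> has removed the top coefficient, the rest already occurs one
  degree lower and is w times it. In degree 0 the rest is 0.\<close>

lemma decompose_Mw:
  assumes A: "below (Suc n) A"
  shows "\<exists>B\<in>M. H n A - Mw B \<in> hardy2.span (range f)"
proof -
  define c where "c = coeff A n / complex_of_real (kappa n)"
  define A' where "A' = A - smult c (phi n)"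
  have "coeff A' n = 0" "below (Suc n) A'"
    using kappa_pos[of n] A below_phi[of n]
    by (auto simp: A'_def c_def coeff_phi intro!: below_diff below_smult)
  then have A': "below n A'" unfolding below_def by (metis le_antisym not_less_eq_eq)
  have "A = smult c (phi n) + A'" by (simp add: A'_def)
  then have H: "H n A = cscale c (f n) + H n A'" by (metis H_add H_smult f_def)
  have cf: "cscale c (f n) \<in> hardy2.span (range f)"
    by (intro hardy2.span_scale hardy2.span_base) simp
  show ?thesis
  proof (cases n)
    case 0
    then have "H n A = cscale c (f n)" using H A' H_0 by simp
    then show ?thesis
      using cf Mw_scale[of 0 0] hardy2.subspace_0[OF subM] by (intro bexI[of _ 0]) auto
  next
    case (Suc m)
    then have "H n A - Mw (H m A') = cscale c (f n)" using H A' by (simp add: Mw_H)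
    then show ?thesis using cf A' Suc by (intro bexI[of _ "H m A'"] H_in_M) auto
  qed
qed

text \<open>Once \<open>psi n\<close> has removed the constant coefficient, the rest is divisible by
  \<zeta>.\<close>

lemma decompose_Mz:
  assumes A: "below (Suc n) A"
  shows "\<exists>B\<in>M. H n A - Mz B \<in> hardy2.span (range g)"
proof -
  define c where "c = coeff A 0 / complex_of_real (kappa n)"
  obtain x A' where A': "A - smult c (psi n) = pCons x A'" by (rule pCons_cases)
  have "coeff (A - smult c (psi n)) 0 = 0" using kappa_pos[of n] by (simp add: c_def coeff_psi)
  then have "x = 0" unfolding A' by simp
  have "below (Suc n) (A - smult c (psi n))"
    using A below_psi by (intro below_diff below_smult) auto
  then have A'n: "below n A'" unfolding A' by simp
  have "A = smult c (psi n) + pCons 0 A'" using A' \<open>x = 0\<close> by (simp add: algebra_simps)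
  then have H: "H n A = cscale c (g n) + H n (pCons 0 A')" by (metis H_add H_smult g_def)
  have cg: "cscale c (g n) \<in> hardy2.span (range g)"
    by (intro hardy2.span_scale hardy2.span_base) simp
  show ?thesis
  proof (cases n)
    case 0
    then have "H n A = cscale c (g n)" using H A'n H_0 by simp
    then show ?thesis
      using cg Mz_scale[of 0 0] hardy2.subspace_0[OF subM] by (intro bexI[of _ 0]) auto
  next
    case (Suc m)
    then have "H n A - Mz (H m A') = cscale c (g n)" using H by (simp add: Mz_H)
    then show ?thesis using cg A'n Suc by (intro bexI[of _ "H m A'"] H_in_M) auto
  qed
qed

lemma
  assumes "F \<in> M"
  shows adj_Mw_in_M: "adj_on M Mw F \<in> M"
    and Mw_adj_Mw: "Mw (adj_on M Mw F) = F - expand f F"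
    and cinner_adj_Mw: "\<And>h. h \<in> M \<Longrightarrow> cinner (Mw h) F = cinner h (adj_on M Mw F)"
  using wold[OF subM closedM M_eq Mw_add Mw_scale cinner_Mw Mw_in_M ortho_f f_in_M cinner_Mw_f
      wandering_decomposition[OF Mw_add Mw_scale decompose_Mw] assms] by blast+

lemma
  assumes "F \<in> M"
  shows adj_Mz_in_M: "adj_on M Mz F \<in> M"
    and Mz_adj_Mz: "Mz (adj_on M Mz F) = F - expand g F"
  using wold[OF subM closedM M_eq Mz_add Mz_scale cinner_Mz Mz_in_M ortho_g g_in_M cinner_Mz_g
      wandering_decomposition[OF Mz_add Mz_scale decompose_Mz] assms] by blast+

lemma Pw_eq: "F \<in> M \<Longrightarrow> Pw M F = expand f F"
  by (simp add: Pw_def Mw_adj_Mw)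

lemma Pz_eq: "F \<in> M \<Longrightarrow> Pz M F = expand g F"
  by (simp add: Pz_def Mz_adj_Mz)

lemma alpha_lim: "alpha \<longlonglongrightarrow> 0"
  using tendsto_real_sqrt[OF summable_LIMSEQ_zero[OF alpha_summable]]
  by (simp add: tendsto_norm_zero_iff)

lemma schmidt_cut:
  assumes "ortho UNIV u" "ortho UNIV v" "c \<longlonglongrightarrow> 0" "\<And>n. u n \<in> M" "\<And>n. v n \<in> M"
  shows "schmidt M c (cut c u) (cut c v)"
  using assms subM closedM
  by unfold_locales (auto simp: ortho_cut cut_def hardy2.subspace_0)

section \<open>The product of the two defect projections\<close>

definition "c0 n = cinner (f n) (g n)"

text \<open>In degree 0 both wandering vectors coincide, which is the origin of the extra singular
  value 1 and of the index shift.\<close>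

lemma c0_0: "c0 0 = 1" and c0_Suc: "c0 (Suc n) = - cnj (alpha n)"
  unfolding c0_def f_def g_def using ip_phi_psi_Suc[of n] ip_1 below_1[of 0]
  by (simp_all add: cinner_H below_phi below_psi)

lemma cmod_c0: "(\<lambda>n. cmod (c0 n)) = case_nat 1 (\<lambda>n. cmod (alpha n))"
  by (rule ext) (simp add: c0_0 c0_Suc split: nat.split)

lemma schmidt_PzPw: "schmidt M c0 (cut c0 f) (cut c0 g)"
proof (rule schmidt_cut[OF ortho_f ortho_g _ f_in_M g_in_M])
  have "(\<lambda>n. c0 (Suc n)) \<longlonglongrightarrow> - cnj 0"
    unfolding c0_Suc by (intro tendsto_intros alpha_lim)
  then show "c0 \<longlonglongrightarrow> 0" by (simp add: filterlim_sequentially_Suc)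
qed

text \<open>The grading makes \<open>f m\<close> orthogonal to \<open>g n\<close> for distinct
  degrees, so the product of the projections is diagonal.\<close>

lemma PzPw_eq:
  assumes "F \<in> M" shows "Pz M (Pw M F) = schmidt_op c0 (cut c0 f) (cut c0 g) F"
proof -
  have fg: "cinner (f m) (g n) = (if m = n then c0 n else 0)" for m n
    by (auto simp: c0_def f_def g_def cinner_H below_phi below_psi)
  have "cinner (expand f F) (g n) = c0 n * cinner F (f n)" for n
  proof -
    have "(\<lambda>m. cinner (cscale (cinner F (f m)) (f m)) (g n)) sums cinner (expand f F) (g n)"
      by (rule bounded_linear.sums[OF bounded_linear_cinner_left expand_sums[OF ortho_f]])
    moreover have "cinner (cscale (cinner F (f m)) (f m)) (g n) = (if m = n then c0 n * cinner F (f n) else 0)" for m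
      by (simp add: cinner_simps fg)
    ultimately show ?thesis
      using sums_unique2 sums_single[of n "\<lambda>_. c0 n * cinner F (f n)"] by simp
  qed
  then have "expand g (expand f F) = schmidt_op c0 f g F"
    unfolding expand_def[of g] schmidt_op_def by simp
  moreover have "expand f F \<in> M" by (rule expand_in[OF ortho_f subM closedM f_in_M])
  ultimately show ?thesis using assms by (simp add: Pw_eq Pz_eq schmidt_op_cut)
qed

section \<open>The cross commutator\<close>

lemma schmidt_cross: "schmidt M alpha (cut alpha g) (cut alpha f)"
  by (rule schmidt_cut[OF ortho_g ortho_f alpha_lim g_in_M f_in_M])

text \<open>The recursion for \<open>psi\<close>, carried to degree n + 1. As
  \<open>g (Suc n)\<close> is orthogonal to the range of \<open>Mz\<close>, the adjoint of
  \<open>Mz\<close> sends this vector to \<open>cscale (alpha n) (f n)\<close>.\<close>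

lemma Mw_g: "Mw (g n) = cscale (complex_of_real (rho n)) (g (Suc n)) + cscale (alpha n) (Mz (f n))"
  using arg_cong[OF szego_psi[of n], of "H (Suc n)"] below_psi[of n]
  by (simp add: g_def f_def Mw_H Mz_H H_add H_smult del: smult_pCons)

text \<open>Write \<open>F = expand g F + Mz A\<close>. On \<open>Mz A\<close> the two terms of the
  commutator cancel because the shifts commute, so only the expansion along the \<open>g n\<close>
  contributes, through \<open>Mw_g\<close>.\<close>

lemma cross_commutator_eq:
  assumes F: "F \<in> M"
  shows "cross_commutator M F = schmidt_op alpha (cut alpha g) (cut alpha f) F" (is "_ = ?S")
proof -
  interpret X: schmidt M alpha "cut alpha g" "cut alpha f" by (rule schmidt_cross)
  define A where "A = adj_on M Mz F"
  have A: "A \<in> M" "F = expand g F + Mz A"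
    using adj_Mz_in_M[OF F] Mz_adj_Mz[OF F] by (simp_all add: A_def)
  have S: "?S \<in> M" by (rule X.op_in)
  have dual: "cinner (Mz h) (Mw (expand g F)) = cinner h ?S" if h: "h \<in> M" for h
  proof -
    have "(\<lambda>n. cinner (Mz h) (Mw (cscale (cinner F (g n)) (g n)))) sums cinner (Mz h) (Mw (expand g F))"
      by (intro bounded_linear.sums[OF bounded_linear_cinner_right]
          bounded_linear.sums[OF bounded_linear_Mw] expand_sums[OF ortho_g])
    moreover have "cinner (Mz h) (Mw (cscale (cinner F (g n)) (g n)))
        = cnj (cinner F (g n)) * (cnj (alpha n) * cinner h (f n))" for n
      using cinner_Mz_g[OF h, of "Suc n"] by (simp add: Mw_scale Mw_g cinner_simps cinner_Mz)
    moreover have "(\<lambda>n. cinner h (cscale (alpha n * cinner F (cut alpha g n)) (cut alpha f n))) sums cinner h ?S"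
      by (rule bounded_linear.sums[OF bounded_linear_cinner_right X.op_sums])
    moreover have "cinner h (cscale (alpha n * cinner F (cut alpha g n)) (cut alpha f n))
        = cnj (cinner F (g n)) * (cnj (alpha n) * cinner h (f n))" for n
      by (simp add: cinner_simps cut_def)
    ultimately show ?thesis using sums_unique2 by simp
  qed
  have "adj_on M Mz (Mw F) = ?S + Mw A"
  proof (rule adj_on_eqI[OF subM])
    show "?S + Mw A \<in> M" using S A by (intro hardy2.subspace_add[OF subM] Mw_in_M)
    fix h assume h: "h \<in> M"
    have "cinner (Mz h) (Mw F) = cinner (Mz h) (Mw (expand g F)) + cinner (Mz h) (Mw (Mz A))"
      by (subst A(2)) (simp add: Mw_add cinner_add_right)
    also have "cinner (Mz h) (Mw (Mz A)) = cinner h (Mw A)"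
      by (simp add: Mz_Mw[symmetric] cinner_Mz)
    finally show "cinner (Mz h) (Mw F) = cinner h (?S + Mw A)"
      by (simp add: dual[OF h] cinner_add_right)
  qed
  then show ?thesis by (simp add: cross_commutator_def A_def)
qed

section \<open>The core operator\<close>

lemma core_operator_sums:
  assumes F: "F \<in> M"
  shows "(\<lambda>n. cscale (cinner F (g (Suc n))) (g (Suc n)) - cscale (cinner F (Mw (g n))) (Mw (g n)))
    sums (core_operator M F - cscale (cinner F (g 0)) (g 0))"
proof -
  define B where "B = adj_on M Mw F"
  have B: "B \<in> M" using adj_Mw_in_M[OF F] by (simp add: B_def)
  have dual: "cinner B (g n) = cinner F (Mw (g n))" for n
    using cinner_adj_Mw[OF F g_in_M, of n] cinner_commute[of F] cinner_commute[of B]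
    by (simp add: B_def)
  \<comment> \<open>Since the shifts commute, the last two terms combine to \<open>Mw\<close> of the
    z-defect of \<open>B\<close>, which is again a projection \<open>expand g\<close>.\<close>
  have "core_operator M F = expand g F - Mw (B - Mz (adj_on M Mz B))"
    using Mz_adj_Mz[OF F]
    by (simp add: core_operator_def B_def[symmetric] Mz_Mw linear_diff[OF bounded_linear.linear[OF bounded_linear_Mw]])
  also have "\<dots> = expand g F - Mw (expand g B)"
    using Mz_adj_Mz[OF B] by simp
  finally have C: "core_operator M F = expand g F - Mw (expand g B)" .
  have b: "(\<lambda>n. cscale (cinner F (Mw (g n))) (Mw (g n))) sums Mw (expand g B)"
    using bounded_linear.sums[OF bounded_linear_Mw expand_sums[OF ortho_g, of B]] by (simp add: Mw_scale dual)
  \<comment> \<open>Splitting off degree 0 shifts this series by one, so that the \<open>n\<close>th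
    terms of both series lie in degree n + 1.\<close>
  have a: "(\<lambda>n. cscale (cinner F (g (Suc n))) (g (Suc n))) sums (expand g F - cscale (cinner F (g 0)) (g 0))"
    using expand_sums[OF ortho_g, of F]
    by (intro sums_Suc_iff[THEN iffD2, of "\<lambda>n. cscale (cinner F (g n)) (g n)"]) simp
  have "core_operator M F - cscale (cinner F (g 0)) (g 0)
      = expand g F - cscale (cinner F (g 0)) (g 0) - Mw (expand g B)"
    unfolding C by simp
  with sums_diff[OF a b] show ?thesis by (simp only:)
qed

text \<open>The vectors \<open>e\<close> and \<open>e'\<close> of
  \<open>projection_difference\<close> for \<open>a = g (Suc n)\<close>,
  \<open>b = Mw (g n)\<close>, \<open>l = |alpha n|\<close> and \<open>r = rho n\<close>.\<close>

definition "core_plus n = (let l = cmod (alpha n) in cscale (complex_of_real (1 / l))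
  (cscale (complex_of_real (sqrt ((1 + l) / 2))) (g (Suc n)) - cscale (complex_of_real (sqrt ((1 - l) / 2))) (Mw (g n))))"
definition "core_minus n = (let l = cmod (alpha n) in cscale (complex_of_real (1 / l))
  (cscale (complex_of_real (sqrt ((1 + l) / 2))) (Mw (g n)) - cscale (complex_of_real (sqrt ((1 - l) / 2))) (g (Suc n))))"

lemma cinner_g: "cinner (g m) (g n) = (if m = n then 1 else 0)"
  using orthoD[OF ortho_g, of m n] by simp

lemma cinner_Mw_g: "cinner (Mw (g m)) (g n) = (if Suc m = n then complex_of_real (rho m) else 0)"
proof -
  have "Mw (g m) = H (Suc m) (psi m)" by (simp add: g_def Mw_H below_psi)
  then show ?thesis
    using below_mono[OF below_psi[of m], of "Suc (Suc m)"]
    by (auto simp: g_def cinner_H below_psi ip_psi_psi_Suc)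
qed

lemma cinner_g_Mw: "cinner (g n) (Mw (g m)) = (if Suc m = n then complex_of_real (rho m) else 0)"
  using cinner_commute[of "g n" "Mw (g m)"] by (simp add: cinner_Mw_g)

lemma core_pair:
  assumes "alpha n \<noteq> 0"
  shows "cinner (core_plus n) (core_plus n) = 1" "cinner (core_minus n) (core_minus n) = 1"
    "cinner (core_plus n) (core_minus n) = 0"
    "cscale (cinner F (g (Suc n))) (g (Suc n)) - cscale (cinner F (Mw (g n))) (Mw (g n))
      = cscale (complex_of_real (cmod (alpha n)) * cinner F (core_plus n)) (core_plus n)
        + cscale (- complex_of_real (cmod (alpha n)) * cinner F (core_minus n)) (core_minus n)"
  unfolding core_plus_def core_minus_def Let_def
  by (rule projection_difference[where r = "rho n"],
      (use assms alpha_less_1[of n] rho_pos[of n] rho_sq[of n] in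
        \<open>auto simp: cinner_g cinner_Mw cinner_Mw_g less_imp_le\<close>)[7])+

text \<open>With \<open>rho n = 1\<close> the vectors \<open>Mw (g n)\<close> and
  \<open>g (Suc n)\<close> coincide and their projections cancel.\<close>

lemma core_trivial_pair:
  assumes "alpha n = 0"
  shows "cscale (cinner F (g (Suc n))) (g (Suc n)) - cscale (cinner F (Mw (g n))) (Mw (g n)) = 0"
proof -
  have "rho n = 1" using assms by (simp add: rho_def)
  then have "Mw (g n) = g (Suc n)" using assms by (simp add: Mw_g)
  then show ?thesis by simp
qed

text \<open>After the 1, interleaving puts the pair of opposite values of level n at indices 2n + 1
  and 2n + 2, so consecutive pairs account for one degree each.\<close>

definition core_eigenvalue :: "nat \<Rightarrow> complex" where
  "core_eigenvalue = case_nat 1 (\<lambda>k. (-1) ^ k * complex_of_real (cmod (alpha (k div 2))))"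

definition core_eigenvector :: "nat \<Rightarrow> hardy2" where
  "core_eigenvector = case_nat (g 0) (\<lambda>k. if alpha (k div 2) = 0 then 0
     else if even k then core_plus (k div 2) else core_minus (k div 2))"

text \<open>Level n lies in degree n + 1, and \<open>g 0\<close> in degree 0.\<close>

lemma core_orthogonal_levels:
  assumes "m \<noteq> n"
  shows "cinner (core_plus m) (core_plus n) = 0" "cinner (core_plus m) (core_minus n) = 0"
    "cinner (core_minus m) (core_plus n) = 0" "cinner (core_minus m) (core_minus n) = 0"
    "cinner (g 0) (core_plus n) = 0" "cinner (g 0) (core_minus n) = 0"
    "cinner (core_plus n) (g 0) = 0" "cinner (core_minus n) (g 0) = 0"
  using assms unfolding core_plus_def core_minus_def Let_def
  by (simp_all add: cinner_simps cinner_g cinner_Mw cinner_Mw_g cinner_g_Mw)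

lemma ortho_core: "ortho {n. core_eigenvalue n \<noteq> 0} core_eigenvector"
  unfolding ortho_def
proof (intro allI)
  have mc: "cinner (core_minus n) (core_plus n) = 0" if "alpha n \<noteq> 0" for n
    using core_pair(3)[OF that] cinner_commute[of "core_minus n"] by simp
  have z: "cinner (g 0) (core_plus n) = 0 \<and> cinner (g 0) (core_minus n) = 0 \<and>
      cinner (core_plus n) (g 0) = 0 \<and> cinner (core_minus n) (g 0) = 0" for n
    using core_orthogonal_levels(5-8)[of "Suc n" n] by auto
  have pos: "cinner (core_eigenvector (Suc i)) (core_eigenvector (Suc j))
      = (if i = j \<and> alpha (j div 2) \<noteq> 0 then 1 else 0)" for i j
  proof (cases "i div 2 = j div 2")
    case False
    then show ?thesis by (auto simp: core_eigenvector_def core_orthogonal_levels)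
  next
    case True
    \<comment> \<open>Within one level the two indices differ exactly by parity.\<close>
    have "i = j \<longleftrightarrow> even i = even j"
      using True by (metis dvd_mult_div_cancel odd_two_times_div_two_succ)
    then show ?thesis
      using True core_pair(1-3)[of "j div 2"] mc[of "j div 2"] by (auto simp: core_eigenvector_def)
  qed
  fix m n
  show "cinner (core_eigenvector m) (core_eigenvector n) = (if m = n \<and> n \<in> {n. core_eigenvalue n \<noteq> 0} then 1 else 0)"
  proof (cases m)
    case 0
    then show ?thesis by (cases n) (auto simp: core_eigenvector_def core_eigenvalue_def cinner_g z)
  next
    case (Suc i)
    then show ?thesis
    proof (cases n)
      case 0
      then show ?thesis using Suc by (auto simp: core_eigenvector_def core_eigenvalue_def cinner_g z)
    next
      case (Suc j)
      with \<open>m = Suc i\<close> show ?thesis by (simp add: pos) (simp add: core_eigenvalue_def)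
    qed
  qed
qed

lemma cmod_core_eigenvalue:
  "(\<lambda>n. cmod (core_eigenvalue n)) = case_nat 1 (\<lambda>k. cmod (alpha (k div 2)))"
  by (rule ext) (simp add: core_eigenvalue_def norm_mult norm_power split: nat.split)

lemma core_eigenvalue_lim: "core_eigenvalue \<longlonglongrightarrow> 0"
proof -
  have "filterlim (\<lambda>k::nat. k div 2) sequentially sequentially"
    unfolding filterlim_at_top
  proof
    fix N :: nat
    show "\<forall>\<^sub>F k in sequentially. N \<le> k div 2"
      using eventually_ge_at_top[of "2 * N"] by eventually_elim simp
  qed
  then have "(\<lambda>k. cmod (alpha (k div 2))) \<longlonglongrightarrow> 0"
    using tendsto_norm[OF alpha_lim] filterlim_compose by fastforce
  then have "(\<lambda>k. cmod (core_eigenvalue (Suc k))) \<longlonglongrightarrow> 0"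
    using cmod_core_eigenvalue by (simp add: fun_eq_iff)
  then show ?thesis
    by (simp add: filterlim_sequentially_Suc tendsto_norm_zero_iff)
qed

lemma schmidt_core: "schmidt M core_eigenvalue core_eigenvector core_eigenvector"
proof
  show "core_eigenvector n \<in> M" for n
    unfolding core_eigenvector_def core_plus_def core_minus_def Let_def
    by (auto split: nat.split simp: g_in_M hardy2.subspace_0[OF subM]
        intro!: hardy2.subspace_scale[OF subM] hardy2.subspace_diff[OF subM] Mw_in_M g_in_M)
qed (rule subM closedM ortho_core core_eigenvalue_lim)+

lemma core_operator_eq:
  assumes F: "F \<in> M"
  shows "core_operator M F = schmidt_op core_eigenvalue core_eigenvector core_eigenvector F" (is "_ = ?S")
proof -
  interpret C: schmidt M core_eigenvalue core_eigenvector core_eigenvector by (rule schmidt_core)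
  define x where "x = (\<lambda>k. cscale (core_eigenvalue k * cinner F (core_eigenvector k)) (core_eigenvector k))"
  have "(\<lambda>k. x (Suc k)) sums (?S - x 0)"
    using C.op_sums[of F] unfolding x_def[symmetric] by (simp add: sums_Suc_iff)
  \<comment> \<open>A convergent series may be summed in pairs; each pair is the spectral form of
    one difference of projections.\<close>
  then have "(\<lambda>n. \<Sum>k\<in>{n * 2..<n * 2 + 2}. x (Suc k)) sums (?S - x 0)"
    by (rule sums_group) simp
  moreover have "(\<Sum>k\<in>{n * 2..<n * 2 + 2}. x (Suc k))
      = cscale (cinner F (g (Suc n))) (g (Suc n)) - cscale (cinner F (Mw (g n))) (Mw (g n))" for n
  proof -
    have "{n * 2..<n * 2 + 2} = {2 * n, Suc (2 * n)}" by auto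
    then have "(\<Sum>k\<in>{n * 2..<n * 2 + 2}. x (Suc k)) = x (Suc (2 * n)) + x (Suc (Suc (2 * n)))" by simp
    also have "\<dots> = cscale (cinner F (g (Suc n))) (g (Suc n)) - cscale (cinner F (Mw (g n))) (Mw (g n))"
    proof (cases "alpha n = 0")
      case True
      then show ?thesis
        using core_trivial_pair[OF True] by (simp add: x_def core_eigenvector_def)
    next
      case False
      then show ?thesis
        using core_pair(4)[OF False] by (simp add: x_def core_eigenvector_def core_eigenvalue_def)
    qed
    finally show ?thesis .
  qed
  ultimately have "core_operator M F - cscale (cinner F (g 0)) (g 0) = ?S - x 0"
    using sums_unique2[OF core_operator_sums[OF F]] by simp
  then show ?thesis by (simp add: x_def core_eigenvector_def core_eigenvalue_def)
qed

text \<open>Each degree n is spanned by the images of \<open>phi 0\<close> to \<open>phi n\<close>.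
  Existence gives meaning to the chosen basis in \<open>hs_norm_sq\<close>.\<close>

lemma orthonormal_basis_exists: "\<exists>B. orthonormal_basis_on M B"
proof -
  let ?B = "{H n (phi k) |n k. k \<le> n}"
  have "H n A \<in> hardy2.span ?B" if "below m A" "m \<le> Suc n" for m n A
    using that
  proof (induction m arbitrary: A)
    case 0
    then show ?case by (simp add: H_0 hardy2.span_zero)
  next
    case (Suc m)
    define c where "c = coeff A m / complex_of_real (kappa m)"
    define A' where "A' = A - smult c (phi m)"
    have "coeff A' m = 0" "below (Suc m) A'"
      using kappa_pos[of m] Suc.prems below_phi[of m]
      by (auto simp: A'_def c_def coeff_phi intro!: below_diff below_smult)
    then have "below m A'" unfolding below_def by (metis le_antisym not_less_eq_eq)
    then have "H n A' \<in> hardy2.span ?B" using Suc by simp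
    moreover have "H n (phi m) \<in> ?B" using Suc.prems by auto
    moreover have "A = smult c (phi m) + A'" by (simp add: A'_def)
    then have "H n A = cscale c (H n (phi m)) + H n A'" by (metis H_add H_smult)
    ultimately show ?case by (simp only:) (rule hardy2.span_add[OF hardy2.span_scale[OF hardy2.span_base]])
  qed
  then have "D \<subseteq> hardy2.span ?B"
    by (intro hardy2.span_minimal hardy2.subspace_span) auto
  moreover have "hardy2.span ?B \<subseteq> D"
    by (intro hardy2.span_mono) (auto intro: below_mono[OF below_phi])
  ultimately have "closure (hardy2.span ?B) = M" by (simp add: M_eq)
  moreover have "cinner e e' = (if e = e' then 1 else 0)" if e: "e \<in> ?B" "e' \<in> ?B" for e e'
  proof -
    from e obtain n k n' k' where *: "e = H n (phi k)" "k \<le> n" "e' = H n' (phi k')" "k' \<le> n'" by auto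
    then have c: "cinner e e' = (if n = n' \<and> k = k' then 1 else 0)"
      using below_mono[OF below_phi[of k], of "Suc n"] below_mono[OF below_phi[of k'], of "Suc n'"]
      by (simp add: cinner_H phi_orthonormal)
    show ?thesis
    proof (cases "n = n' \<and> k = k'")
      case False
      \<comment> \<open>Distinct index pairs give distinct vectors: their inner product is 0, while
        each has norm 1.\<close>
      have "cinner e e = 1"
        using * below_mono[OF below_phi[of k], of "Suc n"] by (simp add: cinner_H phi_orthonormal)
      then show ?thesis using c False by auto
    qed (use c * in auto)
  qed
  ultimately show ?thesis unfolding orthonormal_basis_on_def by blast
qed

end

section \<open>The submodule of a homogeneous polynomial\<close>

lemma suminf_ennreal_case_nat:
  fixes x :: "nat \<Rightarrow> ennreal"
  shows "(\<Sum>n. case_nat a x n) = a + (\<Sum>n. x n)"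
proof -
  have "(\<lambda>n. case_nat a x (Suc n)) sums (\<Sum>n. x n)" by (simp add: summable_sums)
  then have "case_nat a x sums ((\<Sum>n. x n) + case_nat a x 0)" by (rule sums_Suc)
  from sums_unique[OF this] show ?thesis by (simp add: add.commute)
qed

text \<open>Partial sums of even length determine the limit, and in them every term occurs
  twice.\<close>

lemma suminf_ennreal_duplicate:
  fixes x :: "nat \<Rightarrow> ennreal"
  shows "(\<Sum>k. x (k div 2)) = 2 * (\<Sum>n. x n)"
proof -
  have "(\<lambda>N. \<Sum>k<2 * N. x (k div 2)) \<longlonglongrightarrow> (\<Sum>k. x (k div 2))"
    using filterlim_compose[OF summable_LIMSEQ filterlim_subseq[of "\<lambda>N. 2 * N"], of "\<lambda>k. x (k div 2)"]
    by (auto simp: strict_mono_def)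
  moreover have "(\<Sum>k<2 * N. x (k div 2)) = (\<Sum>n<N. 2 * x n)" for N
    by (induction N) (simp_all add: mult_2 add.assoc)
  ultimately have "(\<lambda>n. 2 * x n) sums (\<Sum>k. x (k div 2))" by (simp add: sums_def)
  then have "(\<Sum>n. 2 * x n) = (\<Sum>k. x (k div 2))" using sums_unique by metis
  then show ?thesis by (simp add: ennreal_suminf_cmult)
qed

lemma summable_iff_suminf_ennreal:
  fixes x :: "nat \<Rightarrow> real"
  assumes "\<And>n. 0 \<le> x n"
  shows "summable x \<longleftrightarrow> (\<Sum>n. ennreal (x n)) \<noteq> top"
proof
  assume "summable x"
  from suminf_ennreal2[OF assms this] show "(\<Sum>n. ennreal (x n)) \<noteq> top" by simp
next
  assume "(\<Sum>n. ennreal (x n)) \<noteq> top"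
  then show "summable x" by (rule summable_suminf_not_top[OF assms])
qed

section \<open>Spectra and norms read off the Schmidt forms\<close>

context graded_module
begin

lemma PzPw_singular_values:
  "lists_nonzero_singular_values M (\<lambda>F. Pz M (Pw M F)) (case_nat 1 (\<lambda>n. cmod (alpha n)))"
  using schmidt.singular_values[OF schmidt_PzPw PzPw_eq] by (simp add: cmod_c0)

lemma cross_commutator_singular_values:
  "lists_nonzero_singular_values M (cross_commutator M) (\<lambda>n. cmod (alpha n))"
  by (rule schmidt.singular_values[OF schmidt_cross cross_commutator_eq])

lemma core_operator_eigenvalues:
  "lists_nonzero_eigenvalues M (core_operator M)
     (case_nat 1 (\<lambda>k. (-1) ^ k * complex_of_real (cmod (alpha (k div 2)))))"
  using schmidt.eigenvalues[OF schmidt_core refl core_operator_eq] unfolding core_eigenvalue_def .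

lemma suminf_core_eigenvalue:
  assumes "\<phi> 1 = 1"
  shows "(\<Sum>n. \<phi> (cmod (core_eigenvalue n)) :: ennreal) = 1 + 2 * (\<Sum>n. \<phi> (cmod (alpha n)))"
proof -
  have "\<phi> (cmod (core_eigenvalue n)) = case_nat 1 (\<lambda>k. \<phi> (cmod (alpha (k div 2)))) n" for n
    using fun_cong[OF cmod_core_eigenvalue, of n] assms by (simp split: nat.split)
  then show ?thesis
    by (simp only: suminf_ennreal_case_nat suminf_ennreal_duplicate[of "\<lambda>n. \<phi> (cmod (alpha n))"])
qed

text \<open>The identity holds in the extended non-negative reals before any summability is known;
  membership then means that both sides are finite.\<close>

lemma schatten_core:
  assumes r: "r > 0"
  shows "schatten_norm_powr r M (core_operator M) = 1 + 2 * (\<Sum>n. ennreal (cmod (alpha n) powr r))"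
    and "in_schatten r M (core_operator M) \<longleftrightarrow> summable (\<lambda>n. cmod (alpha n) powr r)"
proof -
  have "(\<lambda>n. cmod (core_eigenvalue n)) \<longlonglongrightarrow> 0"
    using core_eigenvalue_lim by (rule tendsto_norm_zero)
  then have "schatten_norm_powr r M (core_operator M) = (\<Sum>n. ennreal (cmod (core_eigenvalue n) powr r))"
    unfolding schatten_norm_powr_def
    by (intro suminf_singular_value[of _ _ _ "\<lambda>x. ennreal (x powr r)"]
        schmidt.singular_values[OF schmidt_core core_operator_eq]) simp_all
  also have "\<dots> = 1 + 2 * (\<Sum>n. ennreal (cmod (alpha n) powr r))"
    by (rule suminf_core_eigenvalue) simp
  finally show eq: "schatten_norm_powr r M (core_operator M) = 1 + 2 * (\<Sum>n. ennreal (cmod (alpha n) powr r))" .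
  have "in_schatten r M (core_operator M) \<longleftrightarrow> schatten_norm_powr r M (core_operator M) \<noteq> top"
    unfolding in_schatten_def schatten_norm_powr_def
    using schmidt.compact_op[OF schmidt_core core_operator_eq] by (simp add: summable_iff_suminf_ennreal)
  also have "\<dots> \<longleftrightarrow> summable (\<lambda>n. cmod (alpha n) powr r)"
    unfolding eq by (simp add: summable_iff_suminf_ennreal ennreal_mult_eq_top_iff)
  finally show "in_schatten r M (core_operator M) \<longleftrightarrow> summable (\<lambda>n. cmod (alpha n) powr r)" .
qed

lemma hilbert_schmidt: "hilbert_schmidt_submodule M"
proof -
  obtain B where B: "orthonormal_basis_on M B" using orthonormal_basis_exists by blast
  have "hs_norm_sq M (core_operator M) = (\<Sum>n. ennreal ((cmod (core_eigenvalue n))\<^sup>2))"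
    by (rule schmidt.hs_norm[OF schmidt_core core_operator_eq B])
  also have "\<dots> = 1 + 2 * (\<Sum>n. ennreal ((cmod (alpha n))\<^sup>2))"
    by (rule suminf_core_eigenvalue[of "\<lambda>x. ennreal (x\<^sup>2)"]) simp
  also have "\<dots> < top"
    using alpha_summable summable_iff_suminf_ennreal[of "\<lambda>n. (cmod (alpha n))\<^sup>2"]
    by (simp add: less_top[symmetric] ennreal_mult_eq_top_iff)
  finally show ?thesis
    unfolding hilbert_schmidt_submodule_def hilbert_schmidt_on_def
    using schmidt.bounded_op[OF schmidt_core core_operator_eq] by simp
qed

lemma Sigma0_eq: "Sigma0 M = 1 + (\<Sum>n. ennreal ((cmod (alpha n))\<^sup>2))"
proof -
  obtain B where B: "orthonormal_basis_on M B" using orthonormal_basis_exists by blast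
  have "Sigma0 M = (\<Sum>n. ennreal ((cmod (c0 n))\<^sup>2))"
    unfolding Sigma0_def by (rule schmidt.hs_norm[OF schmidt_PzPw PzPw_eq B])
  also have "(\<lambda>n. ennreal ((cmod (c0 n))\<^sup>2)) = case_nat 1 (\<lambda>n. ennreal ((cmod (alpha n))\<^sup>2))"
    by (rule ext) (simp add: c0_0 c0_Suc split: nat.split)
  finally show ?thesis by (simp add: suminf_ennreal_case_nat)
qed

lemma Sigma1_eq: "Sigma1 M = (\<Sum>n. ennreal ((cmod (alpha n))\<^sup>2))"
proof -
  obtain B where B: "orthonormal_basis_on M B" using orthonormal_basis_exists by blast
  show ?thesis
    unfolding Sigma1_def by (rule schmidt.hs_norm[OF schmidt_cross cross_commutator_eq B])
qed

end

text \<open>For \<open>degree A \<le> m\<close> this is the form w^m A(z/w); coefficients beyond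
  \<open>m\<close> are discarded.\<close>

lift_definition hom_form :: "nat \<Rightarrow> complex poly \<Rightarrow> hardy2" is
  "\<lambda>m A (i, j). if i + j = m then coeff A i else 0"
proof -
  fix m and A :: "complex poly"
  let ?a = "\<lambda>(i, j). if i + j = m then coeff A i else 0"
  have "(\<lambda>k. (cmod (?a k))\<^sup>2) summable_on {..m} \<times> {..m}"
    by (rule summable_on_finite) auto
  then show "(\<lambda>k. (cmod (?a k))\<^sup>2) summable_on UNIV"
    by (subst summable_on_cong_neutral[where T = "{..m} \<times> {..m}" and g = "\<lambda>k. (cmod (?a k))\<^sup>2"])
      (auto split: if_splits)
qed

lemma hom_form_add: "hom_form m (A + B) = hom_form m A + hom_form m B"
  by (rule hardy2_eqI) (auto simp: hom_form.rep_eq plus_hardy2.rep_eq)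

lemma hom_form_smult: "hom_form m (smult c A) = cscale c (hom_form m A)"
  by (rule hardy2_eqI) (auto simp: hom_form.rep_eq cscale.rep_eq)

lemma Mz_hom_form: "Mz (hom_form m A) = hom_form (Suc m) (pCons 0 A)"
  by (rule hardy2_eqI) (auto simp: hom_form.rep_eq Mz.rep_eq coeff_pCons split: nat.split)

text \<open>Without the degree bound, the right side could contain a coefficient at z^(m + 1) that
  the left side had discarded.\<close>

lemma Mw_hom_form: "degree A \<le> m \<Longrightarrow> Mw (hom_form m A) = hom_form (Suc m) A"
  by (rule hardy2_eqI) (auto simp: hom_form.rep_eq Mw.rep_eq coeff_eq_0 split: nat.split)

lemma cinner_hom_form:
  assumes "degree A \<le> m"
  shows "cinner (hom_form m A) (hom_form n B) = (if m = n then coeff_ip A B else 0)"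
proof (cases "m = n")
  case True
  have "cinner (hom_form m A) (hom_form m B)
      = (\<Sum>\<^sub>\<infinity>k\<in>(\<lambda>i. (i, m - i)) ` {..m}. hcoeff (hom_form m A) k * cnj (hcoeff (hom_form m B) k))"
    unfolding cinner_def by (rule infsum_cong_neutral) (auto simp: hom_form.rep_eq image_iff)
  also have "\<dots> = (\<Sum>i\<le>m. coeff A i * cnj (coeff B i))"
    by (subst infsum_finite, simp, subst sum.reindex) (auto simp: inj_on_def hom_form.rep_eq)
  finally show ?thesis using True by (simp add: coeff_ip_atMost[OF assms])
next
  case False
  then have "hcoeff (hom_form m A) k * cnj (hcoeff (hom_form n B) k) = 0" for k
    by (cases k) (simp add: hom_form.rep_eq)
  then have "cinner (hom_form m A) (hom_form n B) = 0"
    unfolding cinner_def by (simp only: infsum_0_simp)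
  then show ?thesis using False by simp
qed

definition dehomogenize :: "complex poly poly \<Rightarrow> complex poly" where
  "dehomogenize p = map_poly (\<lambda>c. poly c 1) p"

lemma poly_dehomogenize: "poly (dehomogenize p) z = eval2 p z 1"
  unfolding dehomogenize_def eval2_def
  by (induction p) (simp_all add: map_poly_pCons)

lemma homogeneous_imp_hom_form:
  assumes "p \<noteq> 0" "homogeneous p"
  obtains d where "hardy_of_poly p = hom_form d (dehomogenize p)"
    "degree (dehomogenize p) \<le> d" "dehomogenize p \<noteq> 0"
proof -
  obtain d where d: "\<And>i j. coeff (coeff p i) j \<noteq> 0 \<Longrightarrow> i + j = d"
    using assms(2) unfolding homogeneous_def by blast
  have c: "coeff (dehomogenize p) i = (if i \<le> d then coeff (coeff p i) (d - i) else 0)" for i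
  proof (cases "i \<le> d")
    case True
    \<comment> \<open>Homogeneity leaves at most the monomial w^(d - i) in \<open>coeff p i\<close>,
      so setting w = 1 loses nothing.\<close>
    have "coeff (coeff p i) j = coeff (monom (coeff (coeff p i) (d - i)) (d - i)) j" for j
      using d[of i j] by (cases "coeff (coeff p i) j = 0") auto
    then have "coeff p i = monom (coeff (coeff p i) (d - i)) (d - i)" by (rule poly_eqI)
    then have "poly (coeff p i) 1 = coeff (coeff p i) (d - i)" by (metis mult.right_neutral poly_monom power_one)
    then show ?thesis using True by (simp add: dehomogenize_def coeff_map_poly)
  next
    case False
    then have "coeff p i = 0" using d[of i] by (intro poly_eqI) force
    then show ?thesis using False by (simp add: dehomogenize_def coeff_map_poly)
  qed
  have eq: "hardy_of_poly p = hom_form d (dehomogenize p)"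
  proof (rule hardy2_eqI)
    fix k :: "nat \<times> nat"
    obtain i j where "k = (i, j)" by (cases k)
    then show "hcoeff (hardy_of_poly p) k = hcoeff (hom_form d (dehomogenize p)) k"
      using d[of i j] by (auto simp: hardy_of_poly.rep_eq hom_form.rep_eq c)
  qed
  have "degree (dehomogenize p) \<le> d" by (rule degree_le) (simp add: c)
  moreover have "dehomogenize p \<noteq> 0"
  proof
    assume "dehomogenize p = 0"
    then have "hcoeff (hardy_of_poly p) (i, j) = 0" for i j
      unfolding eq by (simp add: hom_form.rep_eq)
    then have "p = 0" by (intro poly_eqI) (simp add: hardy_of_poly.rep_eq)
    then show False using assms(1) by simp
  qed
  ultimately show ?thesis using eq that by blast
qed

section \<open>Polynomial multiples of the generator\<close>

lemma hardy_of_poly_add: "hardy_of_poly (p + q) = hardy_of_poly p + hardy_of_poly q"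
  by (rule hardy2_eqI) (auto simp: hardy_of_poly.rep_eq plus_hardy2.rep_eq)

lemma hardy_of_poly_scale: "hardy_of_poly (smult [:c:] p) = cscale c (hardy_of_poly p)"
  by (rule hardy2_eqI) (auto simp: hardy_of_poly.rep_eq cscale.rep_eq)

lemma hardy_of_poly_0: "hardy_of_poly 0 = 0"
  by (rule hardy2_eqI) (auto simp: hardy_of_poly.rep_eq zero_hardy2.rep_eq)

text \<open>The nested polynomial type dictates two inductions, an inner one over powers of w and an
  outer one over powers of z.\<close>

lemma range_hardy_of_poly_minimal:
  assumes S: "hardy2.subspace S" "\<And>F. F \<in> S \<Longrightarrow> Mz F \<in> S" "\<And>F. F \<in> S \<Longrightarrow> Mw F \<in> S"
    and "hardy_of_poly p \<in> S"
  shows "hardy_of_poly (p * q) \<in> S"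
proof -
  have a: "hardy_of_poly (smult a p) \<in> S" for a
  proof (induction a)
    case 0
    then show ?case by (simp add: hardy_of_poly_0 hardy2.subspace_0[OF S(1)])
  next
    case (pCons c a)
    have "smult (pCons c a) p = smult [:c:] p + [:[:0, 1:]:] * smult a p"
      by (rule poly_eqI, rule poly_eqI) (simp add: coeff_pCons algebra_simps split: nat.split)
    then show ?case
      by (simp only: hardy_of_poly_add hardy_of_poly_scale Mw_hardy_of_poly[symmetric])
        (intro hardy2.subspace_add[OF S(1)] hardy2.subspace_scale[OF S(1)] S(3) assms(4) pCons(2))
  qed
  show ?thesis
  proof (induction q)
    case 0
    then show ?case by (simp add: hardy_of_poly_0 hardy2.subspace_0[OF S(1)])
  next
    case (pCons b q)
    have "p * pCons b q = smult b p + [:0, 1:] * (p * q)" by simp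
    then show ?case
      using pCons(2) a[of b]
      by (simp only: hardy_of_poly_add Mz_hardy_of_poly[symmetric]) (intro hardy2.subspace_add[OF S(1)] S(2))
  qed
qed

lemma subspace_range_hardy_of_poly: "hardy2.subspace (range (\<lambda>q. hardy_of_poly (p * q)))"
proof (rule hardy2.subspaceI)
  show "0 \<in> range (\<lambda>q. hardy_of_poly (p * q))"
    by (rule range_eqI[of _ _ 0]) (simp add: hardy_of_poly_0)
next
  fix F G assume "F \<in> range (\<lambda>q. hardy_of_poly (p * q))" "G \<in> range (\<lambda>q. hardy_of_poly (p * q))"
  then obtain q r where "F = hardy_of_poly (p * q)" "G = hardy_of_poly (p * r)" by blast
  then show "F + G \<in> range (\<lambda>q. hardy_of_poly (p * q))"
    by (intro range_eqI[of _ _ "q + r"]) (simp add: hardy_of_poly_add distrib_left)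
next
  fix c F assume "F \<in> range (\<lambda>q. hardy_of_poly (p * q))"
  then obtain q where "F = hardy_of_poly (p * q)" by blast
  then show "cscale c F \<in> range (\<lambda>q. hardy_of_poly (p * q))"
    by (intro range_eqI[of _ _ "smult [:c:] q"]) (simp add: hardy_of_poly_scale)
qed

text \<open>The factor \<open>s\<close> is the reciprocal of the L^2 norm of q, making the image of
  1 in degree 0 a unit vector. The multiples of \<open>p\<close> and the span of the
  \<open>H n A\<close> turn out to be equal even before closure.\<close>

lemma graded_module_submodule_gen:
  assumes p: "hardy_of_poly p = hom_form d Q" "degree Q \<le> d" "Q \<noteq> 0"
  defines "s \<equiv> complex_of_real (1 / sqrt (Re (coeff_ip Q Q)))"
  shows "graded_module (weighted_ip Q) (\<lambda>n A. hom_form (d + n) (smult s (Q * A))) (submodule_gen p)"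
proof -
  interpret szego "weighted_ip Q" by (rule weighted_ip_szego[OF p(3)])
  define H where "H = (\<lambda>n A. hom_form (d + n) (smult s (Q * A)))"
  have "s \<noteq> 0" using coeff_ip_pos[OF p(3)] by (simp add: s_def)
  have deg: "degree (smult s (Q * A)) \<le> d + n" if "below (Suc n) A" for n A
    using that p(2) degree_mult_le[of Q A] degree_smult_le[of s "Q * A"] unfolding below_Suc_degree by linarith
  have Hadd: "H n (A + B) = H n A + H n B" for n A B
    by (simp add: H_def distrib_left smult_add_right hom_form_add)
  have Hsmult: "H n (smult c A) = cscale c (H n A)" for n c A
    unfolding H_def by (simp add: hom_form_smult[symmetric] mult.commute)
  have MzH: "Mz (H n A) = H (Suc n) (pCons 0 A)" for n A
    by (simp add: H_def Mz_hom_form)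
  have MwH: "Mw (H n A) = H (Suc n) A" if "below (Suc n) A" for n A
    using Mw_hom_form[OF deg[OF that]] by (simp add: H_def)
  let ?G = "{H n A |n A. below (Suc n) A}"
  let ?R = "range (\<lambda>q. hardy_of_poly (p * q))"
  have H01: "H 0 1 = cscale s (hardy_of_poly p)" by (simp add: H_def p(1) hom_form_smult)
  have Rz: "Mz F \<in> ?R" if F: "F \<in> ?R" for F
  proof -
    from F obtain q where "F = hardy_of_poly (p * q)" by blast
    then have "Mz F = hardy_of_poly (p * ([:0, 1:] * q))"
      by (simp only: Mz_hardy_of_poly mult.left_commute)
    then show ?thesis by blast
  qed
  have Rw: "Mw F \<in> ?R" if F: "F \<in> ?R" for F
  proof -
    from F obtain q where "F = hardy_of_poly (p * q)" by blast
    then have "Mw F = hardy_of_poly (p * ([:[:0, 1:]:] * q))"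
      by (simp only: Mw_hardy_of_poly mult.left_commute)
    then show ?thesis by blast
  qed
  have HR: "H n A \<in> ?R" if "below (Suc n) A" for n A
    using that
  proof (induction n arbitrary: A)
    case 0
    then obtain c where "A = [:c:]" unfolding below_Suc_degree by (auto elim: degree_eq_zeroE)
    then have "H 0 A = cscale c (H 0 1)" using Hsmult[of 0 c 1] by simp
    also have "\<dots> = hardy_of_poly (p * [:[:c * s:]:])"
      unfolding H01 by (simp add: hardy_of_poly_scale[symmetric] mult.commute)
    finally show ?case by blast
  next
    case (Suc n)
    obtain c A' where A: "A = pCons c A'" by (rule pCons_cases)
    have A': "below (Suc n) A'" using Suc.prems by (simp add: A)
    have b: "below (Suc n) [:c:]" by (simp add: below_Suc_degree)
    \<comment> \<open>The constant coefficient is raised to degree n + 1 by w, the rest by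
      z.\<close>
    have "H (Suc n) A = Mw (H n [:c:]) + Mz (H n A')"
      using Hadd[of "Suc n" "[:c:]" "pCons 0 A'"] by (simp add: A MzH MwH[OF b])
    then show ?case
      using Rw[OF Suc.IH[OF b]] Rz[OF Suc.IH[OF A']]
        hardy2.subspace_add[OF subspace_range_hardy_of_poly] by simp
  qed
  have spanR: "hardy2.span ?G \<subseteq> ?R"
    by (rule hardy2.span_minimal[OF _ subspace_range_hardy_of_poly]) (use HR in auto)
  have V: "V F \<in> hardy2.span ?G" if F: "F \<in> hardy2.span ?G" and V: "\<And>F G. V (F + G) = V F + V G"
      "\<And>c F. V (cscale c F) = cscale c (V F)" "\<And>F. F \<in> ?G \<Longrightarrow> V F \<in> hardy2.span ?G" for V F
  proof -
    have "V 0 = 0" using V(1)[of 0 0] by simp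
    then have "hardy2.subspace {F. V F \<in> hardy2.span ?G}"
      by (intro hardy2.subspaceI) (auto simp: V hardy2.span_zero hardy2.span_add hardy2.span_scale)
    then have "hardy2.span ?G \<subseteq> {F. V F \<in> hardy2.span ?G}"
      using V(3) by (intro hardy2.span_minimal) auto
    then show ?thesis using F by auto
  qed
  \<comment> \<open>Conversely, the span contains \<open>p\<close> and is invariant under both
    shifts, hence contains every multiple of \<open>p\<close>.\<close>
  have "?R \<subseteq> hardy2.span ?G"
  proof (rule image_subsetI, rule range_hardy_of_poly_minimal)
    show "Mz F \<in> hardy2.span ?G" if "F \<in> hardy2.span ?G" for F
    proof (rule V[OF that Mz_add Mz_scale])
      fix F assume "F \<in> ?G"
      then obtain n A where "F = H n A" "below (Suc n) A" by blast
      then have "Mz F = H (Suc n) (pCons 0 A)" "below (Suc (Suc n)) (pCons 0 A)"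
        by (simp_all add: MzH)
      then show "Mz F \<in> hardy2.span ?G" by (intro hardy2.span_base) blast
    qed
    show "Mw F \<in> hardy2.span ?G" if "F \<in> hardy2.span ?G" for F
    proof (rule V[OF that Mw_add Mw_scale])
      fix F assume "F \<in> ?G"
      then obtain n A where "F = H n A" "below (Suc n) A" by blast
      then show "Mw F \<in> hardy2.span ?G"
        using below_mono[of "Suc n" A "Suc (Suc n)"] by (intro hardy2.span_base) (use MwH in auto)
    qed
    have "hardy_of_poly p = cscale (1 / s) (H 0 1)" using \<open>s \<noteq> 0\<close> by (simp add: H01)
    moreover have "H 0 1 \<in> ?G" using below_1[of 0] by blast
    ultimately show "hardy_of_poly p \<in> hardy2.span ?G"
      by (simp only:) (rule hardy2.span_scale[OF hardy2.span_base])
  qed (rule hardy2.subspace_span)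
  with spanR have "?R = hardy2.span ?G" by blast
  then have M: "submodule_gen p = closure (hardy2.span ?G)"
    by (simp add: submodule_gen_def)
  have "graded_module (weighted_ip Q) H (submodule_gen p)"
  proof
    have ss: "s * cnj s = 1 / coeff_ip Q Q"
    proof -
      have "coeff_ip Q Q = complex_of_real (Re (coeff_ip Q Q))" by (simp add: coeff_ip_self)
      moreover have "s * cnj s = complex_of_real (1 / Re (coeff_ip Q Q))"
        using coeff_ip_pos[OF p(3)] by (simp add: s_def flip: of_real_mult)
      ultimately show ?thesis by (metis of_real_1 of_real_divide)
    qed
    fix m n A B assume A: "below (Suc m) A" and "below (Suc n) B"
    have "coeff_ip (smult s (Q * A)) (smult s (Q * B)) = weighted_ip Q A B"
      using coeff_ip_commute[of "Q * A" "smult s (Q * B)"] coeff_ip_commute[of "Q * A" "Q * B"] ss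
      by (simp add: coeff_ip_smult_left weighted_ip_def mult.assoc[symmetric])
    then show "cinner (H m A) (H n B) = (if m = n then weighted_ip Q A B else 0)"
      using cinner_hom_form[OF deg[OF A], of "d + n"] by (simp add: H_def)
  qed (simp_all add: Hadd Hsmult MzH MwH M weighted_alpha_square_summable[OF p(3)])
  then show ?thesis unfolding H_def .
qed

theorem theorem1p1:
  fixes p :: "complex poly poly" and M :: "hardy2 set" and \<alpha> :: "nat \<Rightarrow> complex"
  assumes "p \<noteq> 0" and "homogeneous p"
    and "M = submodule_gen p" and "\<alpha> = verblunsky (mu p)"
  shows
    "lists_nonzero_singular_values M (\<lambda>f. Pz M (Pw M f)) (case_nat 1 (\<lambda>n. cmod (\<alpha> n))) \<and>
     lists_nonzero_singular_values M (cross_commutator M) (\<lambda>n. cmod (\<alpha> n)) \<and>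
     lists_nonzero_eigenvalues M (core_operator M)
       (case_nat 1 (\<lambda>k. (-1) ^ k * complex_of_real (cmod (\<alpha> (k div 2))))) \<and>
     (\<forall>r::real. r > 0 \<longrightarrow>
        (in_schatten r M (core_operator M) \<longleftrightarrow> summable (\<lambda>n. cmod (\<alpha> n) powr r)) \<and>
        schatten_norm_powr r M (core_operator M) = 1 + 2 * (\<Sum>n. ennreal (cmod (\<alpha> n) powr r))) \<and>
     hilbert_schmidt_submodule M \<and>
     Sigma0 M = 1 + (\<Sum>n. ennreal ((cmod (\<alpha> n))\<^sup>2)) \<and>
     Sigma1 M = (\<Sum>n. ennreal ((cmod (\<alpha> n))\<^sup>2))"
proof -
  obtain d where Q: "hardy_of_poly p = hom_form d (dehomogenize p)"
    "degree (dehomogenize p) \<le> d" "dehomogenize p \<noteq> 0"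
    using homogeneous_imp_hom_form[OF assms(1,2)] by blast
  interpret graded_module "weighted_ip (dehomogenize p)"
    "\<lambda>n A. hom_form (d + n) (smult (complex_of_real (1 / sqrt (Re (coeff_ip (dehomogenize p) (dehomogenize p))))) (dehomogenize p * A))"
    M
    unfolding assms(3) by (rule graded_module_submodule_gen[OF Q])
  have \<alpha>: "\<alpha> = alpha"
    unfolding assms(4) by (rule verblunsky_mu[OF poly_dehomogenize[symmetric] Q(3)])
  show ?thesis
    unfolding \<alpha>
    by (intro conjI allI impI PzPw_singular_values cross_commutator_singular_values
        core_operator_eigenvalues schatten_core hilbert_schmidt Sigma0_eq Sigma1_eq)
qed

end
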